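(* Let $F$ be a positive functional of excursions of $X$ as defined in the context, with characteristic measure $n_F$, and let $\mu$ be a probability measure on $\mathbb R_+$ with $\mu(\{0\})=0$ and $n_F([y,\infty))>0$ for $y\in\mathrm{supp}(\mu)$. Define $$\psi_\mu(y)=\int_0^y\frac{\mathbf 1_{\mu(\{s\})=0}\,d\mu(s)}{\overline\mu(s)\,n_F([s,\infty))}+\sum_{s<y}\frac{\ln\big(\overline\mu(s)/\overline\mu(s+)\big)}{n_F([s,\infty))}\mathbf 1_{\mu(\{s\})>0},$$ and let $\varphi_\mu$ be its right-continuous inverse. Then the stopping time $$T^F_{\varphi_\mu}=\inf\{t>0:F_t\ge\varphi_\mu(L_t)\}$$ is a.s. finite and solves the Skorokhod embedding problem for $F$, i.e. $F_{T^F_{\varphi_\mu}}\sim\mu$. Furthermore, $T^F_{\varphi_\mu}$ is minimal and $\sup_{t\le T^F_{\varphi_\mu}}F_t=F_{T^F_{\varphi_\mu}}$. For $\mu$ a probability measure on $\mathbb R_+$ with $\mu(\{0\})=\varsigma>0$ (and $n_F([y,\infty))>0$ for $y\in\mathrm{supp}(\mu)$), define $\tilde\mu=\mu-\varsigma(\delta_0-\delta_\infty)$, a probability measure on $(0,\infty]$. Then $\psi_{\tilde\mu}(\infty)<\infty$ and the stopping time $$\tilde T^F_\mu=T^F_{\varphi_{\tilde\mu}}\wedge\inf\{t>0:L_t=\psi_{\tilde\mu}(\infty)\}$$ embeds $\mu$ in $F$, i.e. $F_{\tilde T^F_\mu}\sim\mu$.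
   Context: **Markov process.** $X=(X_t)_{t\ge0}$ is a process with right-continuous paths in a Polish space $E$ with a distinguished point $0$, started at $0$, with natural filtration $(\mathcal F_t)$ (right-continuous and completed). There are probability measures $(\mathbb P_x)_{x\in E}$ such that for every stopping time $T<\infty$, under $\mathbb P(\cdot|X_T=x)$, $(X_{T+t})_{t\ge 0}$ is independent of $\mathcal F_T$ and has the law of $X$ under $\mathbb P_x$; $\mathbb P=\mathbb P_0$. The point $0$ is regular ($\mathbb P_0(\inf\{t>0:X_t=0\}=0)=1$), instantaneous ($\mathbb P_0(\inf\{t\ge0:X_t\ne0\}=0)=1$) and recurrent. Put $\mathcal Z=\{t:X_t=0\}$, $g_t=\sup\{u\le t:X_u=0\}$, $d_t=\inf\{u>t:X_u=0\}$. **Local time and excursions.** $L=(L_t)$ is the local time of $X$ at $0$ (unique up to a multiplicative constant): the support of $dL$ is a.s. contained in $\overline{\mathcal Z}$, and for any stopping time $T$ with $X_T=0$ a.s. on $\{T<\infty\}$, under $\mathbb P(\cdot|T<\infty)$ the process $(X_{T+t},L_{T+t}-L_T)_{t\ge 0}$ is independent of $\mathcal F_T$ and has the law of $(X,L)$ under $\mathbb P$. $\tau_l=\inf\{s\ge 0:L_s>l\}$ is a subordinator with infinite Lévy measure; $L_\infty=\infty$ a.s. The excursion space is $U=\{\epsilon:\mathbb R_+\to E:\ \exists V(\epsilon),\ \epsilon(s)=0\Leftrightarrow s\in\{0\}\cup[V(\epsilon),\infty)\}$, with an added isolated point $\Upsilon$. The excursion process is $e_l=(X_{\tau_{l-}+s},0\le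 s\le\tau_l-\tau_{l-})$ if $\tau_{l-}<\tau_l$ (extended by $0$), and $e_l=\Upsilon$ otherwise; it is a Poisson point process with characteristic (Itô) measure $n$ (normalised consistently with $L$). **Functionals.** A functional is $F:U\times\mathbb R_+\to\mathbb R$, written $F(\epsilon,t)=F(\epsilon)(t)$, such that for each $\epsilon$: $F(\epsilon)$ is a monotone continuous function of time, $F(\epsilon)(0)=0$, $F(\epsilon)(t)=F(\epsilon)(V(\epsilon))$ for $t\ge V(\epsilon)$; $F(\epsilon,t)$ depends only on $(\epsilon_s)_{s\le t}$; $F(\Upsilon)\equiv0$; and $|F(\epsilon,V(\epsilon))|>0$ for all $\epsilon\in U$. It is positive if it takes values in $\mathbb R_+$. It induces the process $F_t=F(e_{L_t})(t-g_t)$, which is right-continuous with left limits and, when it jumps, jumps to $0$. The terminal values $(F(e_l,V(e_l)))_{l\ge0}$ form a Poisson point process whose characteristic measure, the image of $n$ under $\epsilon\mapsto F(\epsilon,V(\epsilon))$, is denoted $n_F$ and called the characteristic measure of $F$. **Notation.** $\overline\mu(t)=\mu([t,\infty))$ is the left-continuous tail, $\overline\mu(t+)$ its right limit; for $\tilde\mu$ on $(0,\infty]$ the tail includes the mass at $\infty$, i.e. $\overline{\tilde\mu}(t)=\tilde\mu([t,\infty])$; $\psi_{\tilde\mu}$, $\varphi_{\tilde\mu}$ are defined by the same formulae with $\tilde\mu$ in place of $\mu$, and $\psi_{\tilde\mu}(\infty)=\lim_{y\to\infty}\psi_{\tilde\mu}(y)$. The right-continuous inverse is $\varphi(x)=\inf\{y\ge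 0:\psi(y)>x\}$ ($\inf\emptyset=\infty$). **Minimality.** A stopping time $T$ is minimal for a process $(F_t)$ if for every stopping time $S$, $S\le T$ and $F_S\sim F_T$ imply $S=T$ a.s.
   Formalization: Added: at each atom y of μ, n-a.e. excursion with terminal value y reaches y before its end; for μ({0})>0, the integral over (0,∞) of dμ(y)/n_F([y,∞)) is finite; the infimum for L_t=ψ(∞) allows t=0. Without these the claim can fail. *)

theory Defs
  imports "HOL-Probability.Probability"
begin

text \<open>
  Deterministic times are nonnegative reals; random times take values in \<^typ>\<open>ennreal\<close>, with value
  \<open>\<top>\<close> for "never". Processes have the type \<open>real \<Rightarrow> 'a \<Rightarrow> 'b\<close> (time, then sample point), and only
  their values at nonnegative times matter.
\<close>

definition pre_filtration :: "'a measure \<Rightarrow> (real \<Rightarrow> 'a \<Rightarrow> 'b::topological_space) \<Rightarrow> ennreal \<Rightarrow> 'a set set" where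
  "pre_filtration M X s = sigma_sets (space M)
     ({X r -` B \<inter> space M | r B. 0 \<le> r \<and> ennreal r \<le> s \<and> B \<in> sets borel} \<union> null_sets M)"

text \<open>
  For \<open>t < \<top>\<close> the intersection runs over all \<open>s > t\<close>, and \<open>s = \<top>\<close> adds no constraint since the
  family increases; for \<open>t = \<top>\<close> it gives the \<open>\<sigma>\<close>-algebra generated by the whole path and the null sets.
\<close>

definition usual_filtration :: "'a measure \<Rightarrow> (real \<Rightarrow> 'a \<Rightarrow> 'b::topological_space) \<Rightarrow> ennreal \<Rightarrow> 'a measure" where
  "usual_filtration M X t = sigma (space M) (\<Inter>s\<in>{s. t < s \<or> s = \<top>}. pre_filtration M X s)"

abbreviation sigma_at :: "'a measure \<Rightarrow> (real \<Rightarrow> 'a \<Rightarrow> 'b::topological_space) \<Rightarrow> ('a \<Rightarrow> ennreal) \<Rightarrow> 'a measure" where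
  "sigma_at M X T \<equiv> filtration.pre_sigma (space M) (usual_filtration M X) T"

lemma filtration_usual_filtration: "filtration (space M) (usual_filtration M X)"
proof
  show "space (usual_filtration M X i) = space M" for i
    unfolding usual_filtration_def by (rule space_measure_of_conv)
  have "pre_filtration M X \<top> \<subseteq> Pow (space M)"
  proof
    fix A assume "A \<in> pre_filtration M X \<top>"
    then show "A \<in> Pow (space M)"
      unfolding pre_filtration_def
      by (intro PowI, elim sigma_sets_into_sp[rotated]) (auto dest: null_setsD2 sets.sets_into_space)
  qed
  then have sub: "(\<Inter>s\<in>{s. t < s \<or> s = \<top>}. pre_filtration M X s) \<subseteq> Pow (space M)" for t
    by blast
  show "sets (usual_filtration M X i) \<subseteq> sets (usual_filtration M X j)" if "i \<le> j" for i j
    unfolding usual_filtration_def sets_measure_of[OF sub]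
    using that by (intro sigma_sets_mono') auto
qed

definition at_time :: "(real \<Rightarrow> 'a \<Rightarrow> 'b) \<Rightarrow> ('a \<Rightarrow> ennreal) \<Rightarrow> 'a \<Rightarrow> 'b" where
  "at_time Y T \<omega> = Y (enn2real (T \<omega>)) \<omega>"

definition first_time :: "(real \<Rightarrow> bool) \<Rightarrow> ennreal" where
  "first_time P = Inf {ennreal t | t. 0 \<le> t \<and> P t}"

abbreviation path_space :: "(real \<Rightarrow> 'b::topological_space) measure" where
  "path_space \<equiv> PiM {0..} (\<lambda>_. borel)"

locale markov_process = prob_space M + complete_measure M
  for M :: "'a measure" +
  fixes X :: "real \<Rightarrow> 'a \<Rightarrow> 'e::polish_space"
    and z :: 'e
    and K :: "'e \<Rightarrow> (real \<Rightarrow> 'e) measure"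
  assumes X_measurable: "0 \<le> t \<Longrightarrow> X t \<in> borel_measurable M"
    and X_right_continuous: "\<omega> \<in> space M \<Longrightarrow> 0 \<le> t \<Longrightarrow> continuous (at_right t) (\<lambda>s. X s \<omega>)"
    and X_start: "AE \<omega> in M. X 0 \<omega> = z"
    and kernel: "K \<in> borel \<rightarrow>\<^sub>M prob_algebra path_space"
    and law_at_z: "K z = distr M path_space (\<lambda>\<omega>. \<lambda>t\<in>{0..}. X t \<omega>)"
    and strong_markov:
      "\<lbrakk>stopping_time (usual_filtration M X) T; \<forall>\<omega>\<in>space M. T \<omega> < \<top>;
        A \<in> sets (sigma_at M X T); B \<in> sets path_space\<rbrakk> \<Longrightarrow>
        emeasure M {\<omega>\<in>A. (\<lambda>t\<in>{0..}. X (enn2real (T \<omega>) + t) \<omega>) \<in> B}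
          = (\<integral>\<^sup>+\<omega>\<in>A. emeasure (K (at_time X T \<omega>)) B \<partial>M)"
    and regular: "AE \<omega> in M. first_time (\<lambda>t. 0 < t \<and> X t \<omega> = z) = 0"
    and instantaneous: "AE \<omega> in M. first_time (\<lambda>t. X t \<omega> \<noteq> z) = 0"
    and recurrent: "AE \<omega> in M. \<forall>t\<ge>0. \<exists>s\<ge>t. X s \<omega> = z"

definition zero_set :: "(real \<Rightarrow> 'a \<Rightarrow> 'e) \<Rightarrow> 'e \<Rightarrow> 'a \<Rightarrow> real set" where
  "zero_set X z \<omega> = {t. 0 \<le> t \<and> X t \<omega> = z}"

definition last_zero :: "(real \<Rightarrow> 'a \<Rightarrow> 'e) \<Rightarrow> 'e \<Rightarrow> real \<Rightarrow> 'a \<Rightarrow> real" where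
  "last_zero X z t \<omega> = Sup (zero_set X z \<omega> \<inter> {..t})"

text \<open>The support of the Stieltjes measure \<open>dL\<close> of a continuous nondecreasing function on \<open>[0,\<infinity>)\<close>.\<close>

definition increase_support :: "(real \<Rightarrow> real) \<Rightarrow> real set" where
  "increase_support L = {t. 0 \<le> t \<and> (\<forall>\<delta>>0. L (max 0 (t - \<delta>)) < L (t + \<delta>))}"

definition inverse_local_time :: "(real \<Rightarrow> 'a \<Rightarrow> real) \<Rightarrow> real \<Rightarrow> 'a \<Rightarrow> ennreal" where
  "inverse_local_time L l \<omega> = first_time (\<lambda>s. L s \<omega> > l)"

text \<open>The left limit of the inverse local time; it is \<open>0\<close> at \<open>l = 0\<close>, since \<open>Sup {} = 0\<close>.\<close>

definition inverse_local_time_left :: "(real \<Rightarrow> 'a \<Rightarrow> real) \<Rightarrow> real \<Rightarrow> 'a \<Rightarrow> ennreal" where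
  "inverse_local_time_left L l \<omega> = (SUP m\<in>{0..<l}. inverse_local_time L m \<omega>)"

definition excursion_paths :: "'e \<Rightarrow> (real \<Rightarrow> 'e) set" where
  "excursion_paths z =
     {\<epsilon> \<in> extensional {0..}. \<exists>v>0. \<forall>s\<ge>0. \<epsilon> s = z \<longleftrightarrow> s = 0 \<or> v \<le> s}"

definition lifetime :: "'e \<Rightarrow> (real \<Rightarrow> 'e) \<Rightarrow> real" where
  "lifetime z \<epsilon> = (THE v. 0 < v \<and> (\<forall>s\<ge>0. \<epsilon> s = z \<longleftrightarrow> s = 0 \<or> v \<le> s))"

text \<open>\<^const>\<open>None\<close> is the isolated point \<open>\<Upsilon>\<close> added to the excursion space.\<close>

definition excursion_process ::
    "(real \<Rightarrow> 'a \<Rightarrow> 'e) \<Rightarrow> 'e \<Rightarrow> (real \<Rightarrow> 'a \<Rightarrow> real) \<Rightarrow> real \<Rightarrow> 'a \<Rightarrow> (real \<Rightarrow> 'e) option" where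
  "excursion_process X z L l \<omega> =
    (let a = inverse_local_time_left L l \<omega>; b = inverse_local_time L l \<omega> in
     if a < b then Some (\<lambda>s\<in>{0..}. if ennreal s \<le> b - a then X (enn2real a + s) \<omega> else z)
     else None)"

definition poisson_random_measure ::
    "'a measure \<Rightarrow> 'b measure \<Rightarrow> ('a \<Rightarrow> 'b set \<Rightarrow> ennreal) \<Rightarrow> bool" where
  "poisson_random_measure M S N \<longleftrightarrow>
     (\<forall>B\<in>sets S. (\<lambda>\<omega>. N \<omega> B) \<in> borel_measurable M \<and>
        (emeasure S B < \<top> \<longrightarrow>
          (\<forall>k. measure M {\<omega>\<in>space M. N \<omega> B = of_nat k} = exp (- measure S B) * measure S B ^ k / fact k)) \<and>
        (emeasure S B = \<top> \<longrightarrow> (AE \<omega> in M. N \<omega> B = \<top>))) \<and>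
     (\<forall>B :: nat \<Rightarrow> 'b set. range B \<subseteq> sets S \<longrightarrow> disjoint_family B \<longrightarrow>
        prob_space.indep_vars M (\<lambda>_. borel) (\<lambda>i \<omega>. N \<omega> (B i)) UNIV)"

definition poisson_point_process ::
    "'a measure \<Rightarrow> (real \<Rightarrow> 'a \<Rightarrow> 'b option) \<Rightarrow> 'b measure \<Rightarrow> bool" where
  "poisson_point_process M e n \<longleftrightarrow>
     (AE \<omega> in M. \<forall>l\<ge>0. e l \<omega> = None \<or> e l \<omega> \<in> Some ` space n) \<and>
     poisson_random_measure M (restrict_space lborel {0..} \<Otimes>\<^sub>M n)
       (\<lambda>\<omega> B. emeasure (count_space UNIV) {l. 0 \<le> l \<and> (\<exists>\<epsilon>. e l \<omega> = Some \<epsilon> \<and> (l, \<epsilon>) \<in> B)})"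

text \<open>
  \<open>U\<close> is the excursion space carrying the characteristic measure \<open>n\<close>. It may be the set of all paths of
  the shape required by \<^const>\<open>excursion_paths\<close>, or only those sharing the path regularity of \<open>X\<close> (continuous
  excursions when \<open>X\<close> is continuous, say): functionals such as the running maximum are continuous in
  time and measurable only on the latter. The total mass of \<open>n\<close> is that of the Levy measure of the
  inverse local time, which is the image of \<open>n\<close> under \<^const>\<open>lifetime\<close>.
\<close>

locale excursion_setting = markov_process M X z K
  for M :: "'a measure" and X :: "real \<Rightarrow> 'a \<Rightarrow> 'e::polish_space" and z K +
  fixes L :: "real \<Rightarrow> 'a \<Rightarrow> real"
    and U :: "(real \<Rightarrow> 'e) set"
    and n :: "(real \<Rightarrow> 'e) measure"
  assumes L_adapted: "0 \<le> t \<Longrightarrow> L t \<in> borel_measurable (usual_filtration M X (ennreal t))"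
    and L_paths: "AE \<omega> in M. L 0 \<omega> = 0 \<and> mono_on {0..} (\<lambda>t. L t \<omega>) \<and> continuous_on {0..} (\<lambda>t. L t \<omega>)"
    and L_support: "AE \<omega> in M. increase_support (\<lambda>t. L t \<omega>) \<subseteq> closure (zero_set X z \<omega>)"
    and L_regenerative:
      "\<lbrakk>stopping_time (usual_filtration M X) T; AE \<omega> in M. T \<omega> < \<top> \<longrightarrow> at_time X T \<omega> = z;
        A \<in> sets (sigma_at M X T); B \<in> sets (PiM {0..} (\<lambda>_. borel \<Otimes>\<^sub>M borel))\<rbrakk> \<Longrightarrow>
        measure M {\<omega>\<in>A. T \<omega> < \<top> \<and>
            (\<lambda>t\<in>{0..}. (X (enn2real (T \<omega>) + t) \<omega>, L (enn2real (T \<omega>) + t) \<omega> - at_time L T \<omega>)) \<in> B}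
          = measure M {\<omega>\<in>A. T \<omega> < \<top>} * measure M {\<omega>\<in>space M. (\<lambda>t\<in>{0..}. (X t \<omega>, L t \<omega>)) \<in> B}"
    and L_unbounded: "AE \<omega> in M. \<forall>l. \<exists>t\<ge>0. L t \<omega> > l"
    and U_excursions: "U \<subseteq> excursion_paths z"
    and sets_n: "sets n = sets (restrict_space path_space U)"
    and n_sigma_finite: "sigma_finite_measure n"
    and n_infinite: "emeasure n (space n) = \<top>"
    and excursions_poisson: "poisson_point_process M (excursion_process X z L) n"

definition functional_process ::
    "((real \<Rightarrow> 'e) \<Rightarrow> real \<Rightarrow> real) \<Rightarrow> (real \<Rightarrow> 'a \<Rightarrow> 'e) \<Rightarrow> 'e \<Rightarrow> (real \<Rightarrow> 'a \<Rightarrow> real) \<Rightarrow> real \<Rightarrow> 'a \<Rightarrow> real" where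
  "functional_process F X z L t \<omega> =
     (case excursion_process X z L (L t \<omega>) \<omega> of
        None \<Rightarrow> 0
      | Some \<epsilon> \<Rightarrow> F \<epsilon> (t - last_zero X z t \<omega>))"

text \<open>
  Dependence on \<open>(\<epsilon>\<^sub>s)\<close>, \<open>s \<le> t\<close>, only is measurability with respect to the \<open>\<sigma>\<close>-algebra generated by these
  coordinates. The right-continuity of the induced process does not follow from the other clauses: it
  amounts to the characteristic measure being finite away from \<open>0\<close>.
\<close>

definition excursion_functional ::
    "'a measure \<Rightarrow> (real \<Rightarrow> 'a \<Rightarrow> 'e::topological_space) \<Rightarrow> 'e \<Rightarrow> (real \<Rightarrow> 'a \<Rightarrow> real) \<Rightarrow> (real \<Rightarrow> 'e) set
      \<Rightarrow> ((real \<Rightarrow> 'e) \<Rightarrow> real \<Rightarrow> real) \<Rightarrow> bool" where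
  "excursion_functional M X z L U F \<longleftrightarrow>
     (\<forall>\<epsilon>\<in>U. (mono_on {0..} (F \<epsilon>) \<or> antimono_on {0..} (F \<epsilon>)) \<and> continuous_on {0..} (F \<epsilon>) \<and>
        F \<epsilon> 0 = 0 \<and> (\<forall>t\<ge>lifetime z \<epsilon>. F \<epsilon> t = F \<epsilon> (lifetime z \<epsilon>)) \<and> \<bar>F \<epsilon> (lifetime z \<epsilon>)\<bar> > 0) \<and>
     (\<forall>t\<ge>0. (\<lambda>\<epsilon>. F \<epsilon> t) \<in>
        borel_measurable (vimage_algebra U (\<lambda>\<epsilon>. restrict \<epsilon> {0..t}) (PiM {0..t} (\<lambda>_. borel)))) \<and>
     (AE \<omega> in M. \<forall>t\<ge>0. continuous (at_right t) (\<lambda>s. functional_process F X z L s \<omega>) \<and>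
        (0 < t \<longrightarrow> (\<exists>x. ((\<lambda>s. functional_process F X z L s \<omega>) \<longlongrightarrow> x) (at_left t))))"

definition positive_functional :: "(real \<Rightarrow> 'e) set \<Rightarrow> ((real \<Rightarrow> 'e) \<Rightarrow> real \<Rightarrow> real) \<Rightarrow> bool" where
  "positive_functional U F \<longleftrightarrow> (\<forall>\<epsilon>\<in>U. \<forall>t\<ge>0. 0 \<le> F \<epsilon> t)"

definition terminal_value :: "'e \<Rightarrow> ((real \<Rightarrow> 'e) \<Rightarrow> real \<Rightarrow> real) \<Rightarrow> (real \<Rightarrow> 'e) \<Rightarrow> real" where
  "terminal_value z F \<epsilon> = F \<epsilon> (lifetime z \<epsilon>)"

definition characteristic_measure ::
    "'e \<Rightarrow> (real \<Rightarrow> 'e) measure \<Rightarrow> ((real \<Rightarrow> 'e) \<Rightarrow> real \<Rightarrow> real) \<Rightarrow> real measure" where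
  "characteristic_measure z n F = distr n borel (terminal_value z F)"

definition measure_support :: "'b::topological_space measure \<Rightarrow> 'b set" where
  "measure_support \<mu> = {x. \<forall>G. open G \<longrightarrow> x \<in> G \<longrightarrow> emeasure \<mu> G > 0}"

text \<open>
  Target laws are put on \<open>[0,\<infinity>]\<close>, so that the boundary can be defined at once for laws charging \<open>\<infinity>\<close>.
\<close>

definition extend_law :: "real measure \<Rightarrow> ennreal measure" where
  "extend_law \<mu> = distr \<mu> borel ennreal"

text \<open>\<open>\<mu> - \<mu>{0} (\<delta>\<^sub>0 - \<delta>\<^sub>\<infinity>)\<close>: the mass at \<open>0\<close> is moved to \<open>\<infinity>\<close>.\<close>

definition shift_zero_mass :: "real measure \<Rightarrow> ennreal measure" where
  "shift_zero_mass \<mu> = distr \<mu> borel (\<lambda>x. if x = 0 then \<top> else ennreal x)"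

text \<open>\<open>ln (a / b)\<close> for \<open>0 < b \<le> a < \<infinity>\<close>, and \<open>\<infinity>\<close> for \<open>b = 0\<close>.\<close>

definition ln_ratio :: "ennreal \<Rightarrow> ennreal \<Rightarrow> ennreal" where
  "ln_ratio a b = (if b = 0 then \<top> else ennreal (ln (enn2real a / enn2real b)))"

definition psi :: "real measure \<Rightarrow> ennreal measure \<Rightarrow> real \<Rightarrow> ennreal" where
  "psi \<nu> \<mu> y =
     (\<integral>\<^sup>+s\<in>{0..ennreal y}. indicator {s. emeasure \<mu> {s} = 0} s
        / (emeasure \<mu> {s..} * emeasure \<nu> {enn2real s..}) \<partial>\<mu>) +
     (\<integral>\<^sup>+s. ln_ratio (emeasure \<mu> {s..}) (emeasure \<mu> {s<..}) / emeasure \<nu> {enn2real s..}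
        \<partial>count_space {s. s < ennreal y \<and> emeasure \<mu> {s} > 0})"

definition psi_infinity :: "real measure \<Rightarrow> ennreal measure \<Rightarrow> ennreal" where
  "psi_infinity \<nu> \<mu> = Lim at_top (psi \<nu> \<mu>)"

definition phi :: "real measure \<Rightarrow> ennreal measure \<Rightarrow> real \<Rightarrow> ennreal" where
  "phi \<nu> \<mu> x = first_time (\<lambda>y. psi \<nu> \<mu> y > ennreal x)"

definition boundary_time :: "(real \<Rightarrow> 'a \<Rightarrow> real) \<Rightarrow> (real \<Rightarrow> 'a \<Rightarrow> real) \<Rightarrow> (real \<Rightarrow> ennreal) \<Rightarrow> 'a \<Rightarrow> ennreal" where
  "boundary_time Y L \<phi> \<omega> = first_time (\<lambda>t. 0 < t \<and> ennreal (Y t \<omega>) \<ge> \<phi> (L t \<omega>))"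

text \<open>
  Since \<open>L\<close> vanishes at time \<open>0\<close>, allowing \<open>t = 0\<close> matters only at level \<open>0\<close>, where the time is then
  \<open>0\<close> instead of \<open>\<infinity>\<close>; this is the level that occurs for the law \<open>\<delta>\<^sub>0\<close>.
\<close>

definition local_time_level :: "(real \<Rightarrow> 'a \<Rightarrow> real) \<Rightarrow> ennreal \<Rightarrow> 'a \<Rightarrow> ennreal" where
  "local_time_level L c \<omega> = first_time (\<lambda>t. ennreal (L t \<omega>) = c)"

definition has_law :: "'a measure \<Rightarrow> ('a \<Rightarrow> real) \<Rightarrow> real measure \<Rightarrow> bool" where
  "has_law M Y \<mu> \<longleftrightarrow> Y \<in> borel_measurable M \<and> distr M borel Y = \<mu>"

definition skorokhod_embeds ::
    "'a measure \<Rightarrow> (ennreal \<Rightarrow> 'a measure) \<Rightarrow> (real \<Rightarrow> 'a \<Rightarrow> real) \<Rightarrow> real measure \<Rightarrow> ('a \<Rightarrow> ennreal) \<Rightarrow> bool" where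
  "skorokhod_embeds M \<F> Y \<mu> T \<longleftrightarrow>
     stopping_time \<F> T \<and> (AE \<omega> in M. T \<omega> < \<top>) \<and> has_law M (at_time Y T) \<mu>"

definition minimal_stopping_time ::
    "'a measure \<Rightarrow> (ennreal \<Rightarrow> 'a measure) \<Rightarrow> (real \<Rightarrow> 'a \<Rightarrow> real) \<Rightarrow> ('a \<Rightarrow> ennreal) \<Rightarrow> bool" where
  "minimal_stopping_time M \<F> Y T \<longleftrightarrow>
     (\<forall>S. stopping_time \<F> S \<longrightarrow> (AE \<omega> in M. S \<omega> \<le> T \<omega>) \<longrightarrow>
        has_law M (at_time Y S) (distr M borel (at_time Y T)) \<longrightarrow> (AE \<omega> in M. S \<omega> = T \<omega>))"

end

theory Submission
  imports Defs
begin

text \<open>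
  Let \<open>q\<close> be the right-continuous quantile function of \<open>\<mu>\<close> and \<open>\<sigma> = \<mu>{0}\<close>. Then \<open>\<psi> (y)\<close> is the integral of
  \<open>1 / ((1 + \<sigma> - u) n\<^sub>F([q u, \<infinity>)))\<close> over those \<open>u \<in> (\<sigma>, 1)\<close> with \<open>q u < y\<close>: the levels \<open>u\<close> with \<open>q u\<close> not an
  atom give the integral in the definition of \<open>\<psi>\<close>, and the levels sent to one atom give one logarithm. With \<open>G\<close> the
  corresponding primitive, \<open>\<phi> (G u) = q u\<close>, and substituting \<open>l = G u\<close> turns the expected number of
  excursions that reach the boundary at a value below \<open>y\<close> into the integral of \<open>1 / (1 + \<sigma> - u)\<close>, that is,
  into \<open>- ln\<close> of the tail of the shifted law at \<open>y\<close>. As the excursions form a Poisson point process, this gives the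
  law of the boundary value at the first crossing.

  On almost every path, \<open>F\<close> crosses the boundary inside an excursion and continuously, and the boundary increases
  with the local time. Hence the process is strictly below its final value at all earlier times, which
  gives both the supremum property and minimality.
\<close>

section \<open>The boundary\<close>

text \<open>The constant \<open>1 + \<sigma> - u\<close> is a tail of the shifted law: once the mass
  \<sigma> has moved from 0 to infinity, the tail at a non-atom \<open>q u\<close> is
  \<open>1 + \<sigma> - u\<close>, which falls from 1 at u = \<sigma> to \<sigma> at u = 1. One
  computation thus covers both claims. No excursion crosses the boundary with probability \<sigma>;
  on that event the capped time stops where the process is 0. The obstacle is the end of an
  excursion: there X is back at \<open>z\<close> and the process is back at 0, so a boundary met by
  the terminal value alone is not met by the process. This matters when the boundary rests at an
  atom of \<mu> for a whole interval of local times, and there \<open>atoms_reached\<close> rules it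
  out. Finiteness of \<psi> at infinity is not automatic, since the tails of the characteristic
  measure may decay too fast for \<mu>. As \<open>1 + \<sigma> - u\<close> stays between \<sigma>
  and 1, it amounts to the \<mu>-integrability of the reciprocal tail on the positive half line,
  which the second claim assumes.\<close>

lemma first_time_le: "0 \<le> t \<Longrightarrow> P t \<Longrightarrow> first_time P \<le> ennreal t"
  unfolding first_time_def by (rule Inf_lower) auto

lemma le_first_time_iff: "x \<le> first_time P \<longleftrightarrow> (\<forall>t\<ge>0. P t \<longrightarrow> x \<le> ennreal t)"
  unfolding first_time_def le_Inf_iff by auto

section \<open>Monotone maps, half lines and a logarithmic integral\<close>

text \<open>Superlevel sets are up-sets, hence empty, everything, or rays starting at their infimum.
  The generic order type covers functions on \<open>real\<close> and on \<open>ennreal\<close>,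
  where the shifted law lives.\<close>

lemma borel_measurable_mono_order:
  fixes f :: "'a::{conditionally_complete_linorder, linorder_topology} \<Rightarrow> 'b::{linorder_topology, second_countable_topology}"
  assumes "mono f" shows "f \<in> borel_measurable borel"
proof (rule borel_measurableI_greater)
  fix y
  let ?S = "{x. y < f x}"
  have up: "x' \<in> ?S" if "x \<in> ?S" "x \<le> x'" for x x'
    using that monoD[OF assms, of x x'] by auto
  have "?S \<in> sets borel"
  proof (cases "?S = {} \<or> \<not> bdd_below ?S")
    case True
    moreover have "?S = UNIV" if unb: "\<not> bdd_below ?S"
    proof -
      have "x \<in> ?S" for x
      proof -
        obtain w where "w \<in> ?S" "w < x"
          using unb unfolding bdd_below_def by (meson not_le)
        then show ?thesis using up[of w x] by auto
      qed
      then show ?thesis by auto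
    qed
    ultimately show ?thesis by auto
  next
    case False
    then have ne: "?S \<noteq> {}" and bdd: "bdd_below ?S" by auto
    have le: "Inf ?S \<le> x" if "x \<in> ?S" for x
      using cInf_lower[OF that bdd] .
    have gt: "x \<in> ?S" if "Inf ?S < x" for x
      using cInf_lessD[OF ne that] up by (metis less_imp_le)
    define c where "c = Inf ?S"
    have S: "x \<in> ?S \<longleftrightarrow> c < x \<or> (c \<in> ?S \<and> x = c)" for x
      using le[of x] gt[of x] unfolding c_def[symmetric] by (metis order.not_eq_order_implies_strict)
    have "?S = {c..} \<or> ?S = {c<..}"
    proof (cases "c \<in> ?S")
      case True
      then have "x \<in> ?S \<longleftrightarrow> x \<in> {c..}" for x
        using S[of x] unfolding atLeast_iff by (metis le_less)
      then show ?thesis by blast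
    next
      case False
      then have "x \<in> ?S \<longleftrightarrow> x \<in> {c<..}" for x
        using S[of x] unfolding greaterThan_iff by metis
      then show ?thesis by blast
    qed
    moreover have "{c..} \<in> sets borel" "{c<..} \<in> sets borel"
      by auto
    ultimately show ?thesis by metis
  qed
  then show "{x \<in> space borel. y < f x} \<in> sets borel" by simp
qed

text \<open>A sublevel set of a decreasing map is an up-set, so its indicator is increasing.\<close>

lemma borel_measurable_antimono_order:
  fixes f :: "'a::{conditionally_complete_linorder, linorder_topology} \<Rightarrow> 'b::{linorder_topology, second_countable_topology}"
  assumes "antimono f" shows "f \<in> borel_measurable borel"
proof (rule borel_measurableI_less)
  fix y
  let ?g = "\<lambda>x. if f x < y then (1::real) else 0"
  have "mono ?g"
    using antimonoD[OF assms] by (intro monoI) (auto split: if_splits dest: le_less_trans)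
  then have [measurable]: "?g \<in> borel_measurable borel"
    by (rule borel_measurable_mono_order)
  have "{x \<in> space borel. f x < y} = {x \<in> space borel. ?g x = 1}"
    by auto
  also have "\<dots> \<in> sets borel" by measurable
  finally show "{x \<in> space borel. f x < y} \<in> sets borel" .
qed

text \<open>Open half lines are the natural test sets here: the tails \<open>{y..}\<close> and the
  sum over s < y in \<open>psi\<close> are left-continuous in y.\<close>

lemma measure_eqI_Iio:
  fixes M N :: "real measure"
  assumes "sets M = sets borel" "sets N = sets borel"
    and fin: "\<And>x. emeasure M {..<x} < \<infinity>"
    and eq: "\<And>x. emeasure M {..<x} = emeasure N {..<x}"
  shows "M = N"
proof (rule measure_eqI_generator_eq)
  let ?E = "range (lessThan::real \<Rightarrow> real set)"
  show "Int_stable ?E"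
  proof (rule Int_stableI)
    fix S T assume "S \<in> ?E" "T \<in> ?E"
    then obtain x y where "S = {..<x}" "T = {..<y}" by auto
    then have "S \<inter> T = {..<min x y}" by auto
    then show "S \<inter> T \<in> ?E" by blast
  qed
  show "sets M = sigma_sets UNIV ?E" "sets N = sigma_sets UNIV ?E"
    using assms(1,2) by (simp_all add: borel_Iio)
  show "(\<Union>i::nat. {..<real i}) = UNIV"
    by (auto intro: reals_Archimedean2)
  show "emeasure M X = emeasure N X" if "X \<in> ?E" for X
    using that eq by auto
qed (use fin in \<open>auto simp: less_top[symmetric] less_le\<close>)

text \<open>The antiderivative is \<open>- ln (d - u)\<close>. At b = d the integral diverges, in
  accordance with the value \<open>\<top>\<close> of \<open>ln_ratio\<close> for a vanishing second
  argument; this happens at a last atom when the law has no mass at 0.\<close>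

lemma nn_integral_reciprocal:
  fixes a b d :: real
  assumes "a < d" "a \<le> b" "b \<le> d"
  shows "(\<integral>\<^sup>+u. ennreal (1 / (d - u)) * indicator {a<..<b} u \<partial>lborel) = ln_ratio (ennreal (d - a)) (ennreal (d - b))"
proof -
  have *: "(\<integral>\<^sup>+u. ennreal (1 / (d - u)) * indicator {a<..<b} u \<partial>lborel) = ennreal (ln (d - a) - ln (d - b))"
    if "a \<le> b" "b < d" for b
  proof -
    have "(\<integral>\<^sup>+u. ennreal (1 / (d - u)) * indicator {a<..<b} u \<partial>lborel) =
        (\<integral>\<^sup>+u. ennreal (1 / (d - u)) * indicator {a..b} u \<partial>lborel)"
    proof (rule nn_integral_cong_AE)
      show "AE u in lborel. ennreal (1 / (d - u)) * indicator {a<..<b} u = ennreal (1 / (d - u)) * indicator {a..b} u"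
        using AE_lborel_singleton[of a] AE_lborel_singleton[of b]
        by eventually_elim (auto simp: indicator_def)
    qed
    also have "\<dots> = ennreal (- ln (d - b) - (- ln (d - a)))"
      using that by (intro nn_integral_FTC_Icc) (auto intro!: derivative_eq_intros)
    finally show ?thesis by simp
  qed
  show ?thesis
  proof (cases "b < d")
    case True
    then show ?thesis
      using assms *[of b] by (simp add: ln_ratio_def ln_div)
  next
    case False
    then have b: "b = d" using assms by simp
    have "of_nat k \<le> (\<integral>\<^sup>+u. ennreal (1 / (d - u)) * indicator {a<..<b} u \<partial>lborel)" for k
    proof -
      \<comment> \<open>Chosen so that the integral up to \<open>b'\<close> is exactly k.\<close>
      define b' where "b' = d - (d - a) * exp (- real k)"
      have b': "a \<le> b'" "b' < d"
        using assms mult_left_mono[of "exp (- real k)" 1 "d - a"] by (auto simp: b'_def field_simps)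
      have "ln (d - a) - ln (d - b') = real k"
        using assms by (simp add: b'_def ln_mult)
      then have "of_nat k = (\<integral>\<^sup>+u. ennreal (1 / (d - u)) * indicator {a<..<b'} u \<partial>lborel)"
        using *[OF b'] by (simp add: ennreal_of_nat_eq_real_of_nat)
      also have "\<dots> \<le> (\<integral>\<^sup>+u. ennreal (1 / (d - u)) * indicator {a<..<b} u \<partial>lborel)"
        using b' b by (intro nn_integral_mono) (auto simp: indicator_def)
      finally show ?thesis .
    qed
    then have "(\<integral>\<^sup>+u. ennreal (1 / (d - u)) * indicator {a<..<b} u \<partial>lborel) = \<top>"
      by (meson ennreal_Ex_less_of_nat less_top not_le)
    then show ?thesis
      using b by (simp add: ln_ratio_def)
  qed
qed

section \<open>Change of variable along the primitive of a positive weight\<close>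

text \<open>The weight need not be integrable at b, so boundedness is only required up to points u <
  b, and the total mass of \<open>D\<close> may be infinite.\<close>

locale cumulative_weight =
  fixes f :: "real \<Rightarrow> ennreal" and a b :: real
  assumes f_measurable [measurable]: "f \<in> borel_measurable borel"
    and f_bounded: "\<And>u. u < b \<Longrightarrow> \<exists>C\<ge>0. \<forall>v. a < v \<longrightarrow> v \<le> u \<longrightarrow> f v \<le> ennreal C"
    and f_pos: "\<And>u. a < u \<Longrightarrow> u < b \<Longrightarrow> 0 < f u"
begin

definition D :: "real measure" where
  "D = density lborel (\<lambda>u. f u * indicator {a<..<b} u)"

text \<open>A real-valued primitive, meaningful for u < b only: if the total mass is infinite,
  \<open>measure\<close> returns the default 0 from b on.\<close>

definition G :: "real \<Rightarrow> real" where
  "G u = measure D {..u}"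

lemma sets_D [simp, measurable_cong]: "sets D = sets borel"
  by (simp add: D_def)

lemma space_D [simp]: "space D = UNIV"
  by (simp add: D_def)

lemma emeasure_D: "A \<in> sets borel \<Longrightarrow> emeasure D A = (\<integral>\<^sup>+u. f u * indicator {a<..<b} u * indicator A u \<partial>lborel)"
  unfolding D_def by (subst emeasure_density) auto

lemma emeasure_D_restrict:
  assumes "A \<in> sets borel"
  shows "emeasure D A = emeasure D (A \<inter> {a<..<b})"
  using assms by (subst (1 2) emeasure_D) (auto intro!: nn_integral_cong simp: indicator_def)

lemma D_Ioc_le:
  assumes "a \<le> u" "u \<le> v" "0 \<le> C" "\<forall>w. a < w \<longrightarrow> w \<le> v \<longrightarrow> f w \<le> ennreal C"
  shows "emeasure D {u<..v} \<le> ennreal (C * (v - u))"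
proof -
  have "emeasure D {u<..v} \<le> (\<integral>\<^sup>+w. ennreal C * indicator {u<..v} w \<partial>lborel)"
    using assms by (subst emeasure_D) (auto intro!: nn_integral_mono simp: indicator_def)
  also have "\<dots> = ennreal (C * (v - u))"
    using assms by (subst nn_integral_cmult_indicator) (auto simp: ennreal_mult')
  finally show ?thesis .
qed

lemma D_atMost_eq: "emeasure D {..u} = emeasure D {a<..u}"
  by (subst (1 2) emeasure_D_restrict) (auto intro!: arg_cong[where f="emeasure D"])

lemma D_atMost_finite:
  assumes "u < b" shows "emeasure D {..u} < \<top>"
proof (cases "a \<le> u")
  case True
  obtain C where "C \<ge> 0" "\<forall>v. a < v \<longrightarrow> v \<le> u \<longrightarrow> f v \<le> ennreal C"
    using f_bounded[OF assms] by auto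
  then have "emeasure D {a<..u} \<le> ennreal (C * (u - a))"
    using True by (intro D_Ioc_le) auto
  also have "\<dots> < \<top>" by simp
  finally show ?thesis by (simp add: D_atMost_eq)
qed (simp add: D_atMost_eq)

lemma emeasure_D_atMost: "u < b \<Longrightarrow> emeasure D {..u} = ennreal (G u)"
  using D_atMost_finite[of u] by (simp add: G_def emeasure_eq_ennreal_measure)

lemma G_nonneg: "0 \<le> G u"
  by (simp add: G_def)

lemma G_a: "G a = 0"
  using D_atMost_eq[of a] by (simp add: G_def measure_def)

lemma D_Ioc:
  assumes "u \<le> v" "v < b"
  shows "emeasure D {u<..v} = ennreal (G v - G u)"
proof -
  have "emeasure D ({..v} - {..u}) = emeasure D {..v} - emeasure D {..u}"
    using assms D_atMost_finite[of u] by (intro emeasure_Diff) auto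
  moreover have "{..v} - {..u} = {u<..v}" by auto
  ultimately show ?thesis
    using assms emeasure_D_atMost[of u] emeasure_D_atMost[of v] by (simp add: ennreal_minus G_nonneg)
qed

lemma G_mono:
  assumes "u \<le> v" "v < b" shows "G u \<le> G v"
proof -
  have "emeasure D {..u} \<le> emeasure D {..v}"
    using assms by (intro emeasure_mono) auto
  then show ?thesis
    using assms emeasure_D_atMost[of u] emeasure_D_atMost[of v] by (simp add: G_nonneg)
qed

text \<open>A null interval would force the weight to vanish almost everywhere on it, against
  \<open>f_pos\<close>. This is the source of strict monotonicity of \<open>G\<close>.\<close>

lemma emeasure_D_pos:
  assumes "a \<le> u" "u < v" "v \<le> b"
  shows "0 < emeasure D {u<..<v}"
proof (rule ccontr)
  assume "\<not> 0 < emeasure D {u<..<v}"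
  then have "(\<integral>\<^sup>+w. f w * indicator {a<..<b} w * indicator {u<..<v} w \<partial>lborel) = 0"
    by (subst emeasure_D[symmetric]) (auto simp: zero_less_iff_neq_zero)
  then have "AE w in lborel. f w * indicator {a<..<b} w * indicator {u<..<v} w = 0"
    by (subst (asm) nn_integral_0_iff_AE) auto
  then have "AE w in lborel. w \<notin> {u<..<v}"
  proof eventually_elim
    case (elim w)
    then show ?case using f_pos[of w] assms by (auto simp: indicator_def)
  qed
  then have "emeasure lborel {u<..<v} = 0"
    by (subst (asm) AE_iff_measurable[of "{u<..<v}"]) auto
  then show False using assms by simp
qed

lemma G_strict_mono:
  assumes "a \<le> u" "u < v" "v < b" shows "G u < G v"
proof -
  have "0 < emeasure D {u<..<v}"
    using assms by (intro emeasure_D_pos) auto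
  also have "\<dots> \<le> emeasure D {u<..v}"
    by (intro emeasure_mono) auto
  finally show ?thesis
    using assms by (simp add: D_Ioc)
qed

lemma G_less_iff:
  assumes "a \<le> u" "u < b" "a \<le> v" "v < b"
  shows "G u < G v \<longleftrightarrow> u < v"
  using G_strict_mono[of u v] G_mono[of v u] assms by force

lemma G_lt_total:
  assumes "a \<le> u" "u < b" shows "ennreal (G u) < emeasure D UNIV"
proof -
  obtain v where v: "u < v" "v < b" using assms dense by blast
  have "G u < G v"
    using G_strict_mono[of u v] v assms by auto
  then have "ennreal (G u) < emeasure D {..v}"
    using v emeasure_D_atMost[of v] G_nonneg[of u] by (simp add: ennreal_less_iff)
  also have "\<dots> \<le> emeasure D UNIV"
    by (intro emeasure_mono) auto
  finally show ?thesis .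
qed

text \<open>A bound C of the weight on \<open>{a<..c}\<close> is a Lipschitz constant of the
  primitive there.\<close>

lemma G_continuous:
  assumes "a \<le> c" "c < b" shows "continuous_on {a..c} G"
proof -
  obtain C where C: "C \<ge> 0" "\<forall>v. a < v \<longrightarrow> v \<le> c \<longrightarrow> f v \<le> ennreal C"
    using f_bounded[OF assms(2)] by auto
  have lip: "\<bar>G u - G v\<bar> \<le> C * \<bar>u - v\<bar>" if "a \<le> v" "v \<le> u" "u \<le> c" for u v
  proof -
    have "ennreal (G u - G v) \<le> ennreal (C * (u - v))"
      using that C assms D_Ioc[of v u] D_Ioc_le[of v u C] by auto
    then show ?thesis
      using that C assms G_mono[of v u] by (simp add: ennreal_le_iff)
  qed
  have "C-lipschitz_on {a..c} G"
  proof (rule lipschitz_onI)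
    fix u v assume "u \<in> {a..c}" "v \<in> {a..c}"
    then show "dist (G u) (G v) \<le> C * dist u v"
      using lip[of u v] lip[of v u] by (cases "u \<le> v") (auto simp: dist_real_def abs_minus_commute)
  qed (use C in auto)
  then show ?thesis by (rule lipschitz_on_continuous_on)
qed

lemma G_measurable [measurable]: "G \<in> borel_measurable borel"
proof -
  have "mono (\<lambda>u. emeasure D {..u})"
    by (intro monoI emeasure_mono) auto
  then have "(\<lambda>u. emeasure D {..u}) \<in> borel_measurable borel"
    by (rule borel_measurable_mono_order)
  then show ?thesis
    unfolding G_def measure_def by simp
qed

lemma G_attains:
  assumes "0 \<le> r" "ennreal r < emeasure D UNIV"
  obtains u where "a \<le> u" "u < b" "G u = r"
proof -
  have "\<exists>c. a \<le> c \<and> c < b \<and> r < G c"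
  proof (rule ccontr)
    assume neg: "\<not> ?thesis"
    \<comment> \<open>Exhausting the interval from the left: if \<open>G\<close> never exceeded r,
      the total mass would be at most r. The intermediate value theorem can then be applied on a
      compact interval.\<close>
    have "emeasure D {a<..<b} = (SUP k. emeasure D {..b - 1 / Suc k})"
    proof -
      have "(SUP k. emeasure D {..b - 1 / Suc k}) = emeasure D (\<Union>k. {..b - 1 / real (Suc k)})"
        proof (rule SUP_emeasure_incseq)
          show "incseq (\<lambda>k. {..b - 1 / real (Suc k)})"
            by (intro incseq_SucI) (auto elim!: order_trans intro!: divide_left_mono)
        qed auto
      also have "\<dots> = emeasure D ((\<Union>k. {..b - 1 / real (Suc k)}) \<inter> {a<..<b})"
        by (intro emeasure_D_restrict) auto
      also have "(\<Union>k. {..b - 1 / real (Suc k)}) \<inter> {a<..<b} = {a<..<b}"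
      proof -
        have "\<exists>k. u \<le> b - 1 / real (Suc k)" if u: "u < b" for u
        proof -
          obtain k where "inverse (real (Suc k)) < b - u"
            using reals_Archimedean[of "b - u"] u by auto
          then show ?thesis by (intro exI[of _ k]) (simp add: inverse_eq_divide)
        qed
        then show ?thesis by auto
      qed
      finally show ?thesis by simp
    qed
    also have "\<dots> \<le> ennreal r"
    proof (rule SUP_least)
      fix k
      have "G (b - 1 / Suc k) \<le> r"
      proof (cases "a \<le> b - 1 / Suc k")
        case True
        moreover have "b - 1 / Suc k < b" by simp
        ultimately show ?thesis using neg by (meson not_less)
      next
        case False
        then have "G (b - 1 / Suc k) \<le> 0"
          using D_atMost_eq[of "b - 1 / Suc k"] by (simp add: G_def measure_def)
        then show ?thesis using assms by simp
      qed
      then show "emeasure D {..b - 1 / Suc k} \<le> ennreal r"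
        by (subst emeasure_D_atMost) (auto intro: ennreal_leI)
    qed
    finally show False
      using assms emeasure_D_restrict[of UNIV] by simp
  qed
  then obtain c where c: "a \<le> c" "c < b" "r < G c" by auto
  then obtain u where "a \<le> u" "u \<le> c" "G u = r"
    using IVT'[of G a r c] G_continuous[of c] assms G_a by auto
  then show ?thesis using that c by auto
qed

text \<open>For r in the range, r = \<open>G u\<close>, and by strict monotonicity the set where
  \<open>G\<close> is below r is, inside the interval, the half line below u, whose
  \<open>D\<close>-mass is again \<open>G u\<close>.\<close>

lemma distr_G:
  "distr D borel G = density lborel (indicator {m. 0 \<le> m \<and> ennreal m < emeasure D UNIV})" (is "_ = density lborel (indicator ?I)")
proof (rule measure_eqI_Iio)
  have I [measurable]: "?I \<in> sets borel" by measurable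
  have eq: "emeasure (distr D borel G) {..<r} = min (ennreal r) (emeasure D UNIV) \<and>
    emeasure (density lborel (indicator ?I)) {..<r} = min (ennreal r) (emeasure D UNIV)" for r
  proof (intro conjI)
    have d: "emeasure (distr D borel G) {..<r} = emeasure D {u. G u < r}"
      by (subst emeasure_distr) (auto simp: vimage_def)
    also have "\<dots> = emeasure D ({u. G u < r} \<inter> {a<..<b})"
      by (rule emeasure_D_restrict) measurable
    also have "\<dots> = min (ennreal r) (emeasure D UNIV)"
    proof (cases "0 \<le> r \<and> ennreal r < emeasure D UNIV")
      case True
      then obtain u where u: "a \<le> u" "u < b" "G u = r"
        using G_attains by blast
      then have "{u. G u < r} \<inter> {a<..<b} = {..<u} \<inter> {a<..<b}"
        using G_less_iff by (auto)
      moreover have "emeasure D ({..<u} \<inter> {a<..<b}) = emeasure D {..u}"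
      proof -
        have "emeasure D ({..<u} \<inter> {a<..<b}) = emeasure D {..<u}"
          by (rule emeasure_D_restrict[symmetric]) auto
        also have "\<dots> = emeasure D {..u}"
        proof -
          have "AE w in lborel. w \<noteq> u" by (rule AE_lborel_singleton)
          then show ?thesis
            by (subst (1 2) emeasure_D) (auto intro!: nn_integral_cong_AE simp: indicator_def elim!: eventually_mono)
        qed
        finally show ?thesis .
      qed
      ultimately show ?thesis
        using u True emeasure_D_atMost[of u] by (simp add: min_def less_imp_le)
    next
      case False
      show ?thesis
      proof (cases "0 \<le> r")
        case True
        with False have "emeasure D UNIV \<le> ennreal r" by auto
        moreover from this have "{u. G u < r} \<inter> {a<..<b} = {a<..<b}"
          using order.strict_trans2[OF G_lt_total] ennreal_less_iff[OF G_nonneg] by (force intro: less_imp_le)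
        ultimately show ?thesis
          using emeasure_D_restrict[of UNIV] by (simp add: min_def)
      next
        case False
        then have "\<not> G u < r" for u using G_nonneg[of u] by auto
        then have "{u. G u < r} = {}" by simp
        then show ?thesis using False by (simp add: ennreal_neg)
      qed
    qed
    finally show "emeasure (distr D borel G) {..<r} = min (ennreal r) (emeasure D UNIV)" .
    have "emeasure (density lborel (indicator ?I)) {..<r} = emeasure lborel (?I \<inter> {..<r})"
      by (subst emeasure_density) (auto simp: indicator_inter_arith[symmetric])
    also have "\<dots> = min (ennreal r) (emeasure D UNIV)"
    proof (cases "0 \<le> r \<and> ennreal r \<le> emeasure D UNIV")
      case True
      have "ennreal m < emeasure D UNIV" if "0 \<le> m" "m < r" for m
        using that True order.strict_trans2[of "ennreal m" "ennreal r"] by (auto simp: ennreal_less_iff)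
      then have "?I \<inter> {..<r} = {0..<r}"
        by auto
      then show ?thesis using True by (simp add: min_def)
    next
      case False
      show ?thesis
      proof (cases "0 \<le> r")
        case True
        with False have lt: "emeasure D UNIV < ennreal r" by auto
        then obtain t where t: "0 \<le> t" "emeasure D UNIV = ennreal t"
          by (cases "emeasure D UNIV") auto
        then have "?I \<inter> {..<r} = {0..<t}"
          using lt by (auto simp: ennreal_less_iff)
        then show ?thesis using t lt by (simp add: min_absorb2 less_imp_le)
      next
        case False
        then have "?I \<inter> {..<r} = {}" by auto
        then show ?thesis using False by (simp add: ennreal_neg)
      qed
    qed
    finally show "emeasure (density lborel (indicator ?I)) {..<r} = min (ennreal r) (emeasure D UNIV)" .
  qed
  show "emeasure (distr D borel G) {..<r} < \<infinity>" for r
    using eq[of r] by (simp add: min_less_iff_disj)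
  show "emeasure (distr D borel G) {..<r} = emeasure (density lborel (indicator ?I)) {..<r}" for r
    using eq[of r] by simp
qed auto

text \<open>Substitution m = \<open>G u\<close> read off from the image measure, so that no
  derivative of \<open>G\<close> is involved; the weight is merely measurable.\<close>

lemma nn_integral_G:
  assumes [measurable]: "h \<in> borel_measurable borel"
  shows "(\<integral>\<^sup>+m. h m * indicator {m. 0 \<le> m \<and> ennreal m < emeasure D UNIV} m \<partial>lborel) =
    (\<integral>\<^sup>+u. h (G u) * (f u * indicator {a<..<b} u) \<partial>lborel)"
proof -
  let ?I = "{m. 0 \<le> m \<and> ennreal m < emeasure D UNIV}"
  have [measurable]: "?I \<in> sets borel" by measurable
  have "(\<integral>\<^sup>+m. h m * indicator ?I m \<partial>lborel) = (\<integral>\<^sup>+m. h m \<partial>density lborel (indicator ?I))"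
    by (subst nn_integral_density) (measurable, simp only: mult.commute)
  also have "\<dots> = (\<integral>\<^sup>+u. h (G u) \<partial>D)"
    unfolding distr_G[symmetric] by (rule nn_integral_distr) measurable
  also have "\<dots> = (\<integral>\<^sup>+u. h (G u) * (f u * indicator {a<..<b} u) \<partial>lborel)"
    unfolding D_def by (subst nn_integral_density) (measurable, simp only: mult.commute)
  finally show ?thesis .
qed

end

text \<open>Left-continuity of the mass of open half lines, in the form in which it shows that a
  supremum of such y is attained.\<close>

lemma emeasure_lessThan_le_iff:
  fixes M :: "real measure"
  assumes [measurable_cong]: "sets M = sets borel"
  shows "emeasure M {..<y} \<le> c \<longleftrightarrow> (\<forall>x<y. emeasure M {..<x} \<le> c)"
proof
  assume *: "emeasure M {..<y} \<le> c"
  show "\<forall>x<y. emeasure M {..<x} \<le> c"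
  proof (intro allI impI)
    fix x assume "x < y"
    then have "emeasure M {..<x} \<le> emeasure M {..<y}"
      by (intro emeasure_mono) auto
    with * show "emeasure M {..<x} \<le> c" by simp
  qed
next
  assume *: "\<forall>x<y. emeasure M {..<x} \<le> c"
  have "(\<Union>k. {..<y - 1 / real (Suc k)}) = {..<y}"
  proof -
    have "\<exists>k. u < y - 1 / real (Suc k)" if u: "u < y" for u
    proof -
      obtain k where "inverse (real (Suc k)) < y - u"
        using reals_Archimedean[of "y - u"] u by auto
      then show ?thesis by (intro exI[of _ k]) (simp add: inverse_eq_divide)
    qed
    moreover have "y - 1 / real (Suc k) < y" for k by simp
    ultimately show ?thesis by (auto intro: less_trans)
  qed
  moreover have "(SUP k. emeasure M {..<y - 1 / real (Suc k)}) = emeasure M (\<Union>k. {..<y - 1 / real (Suc k)})"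
  proof (rule SUP_emeasure_incseq)
    show "incseq (\<lambda>k. {..<y - 1 / real (Suc k)})"
      by (intro incseq_SucI) (auto elim!: order.strict_trans2 intro!: divide_left_mono)
  qed auto
  moreover have "(SUP k. emeasure M {..<y - 1 / real (Suc k)}) \<le> c"
    using * by (intro SUP_least) simp
  ultimately show "emeasure M {..<y} \<le> c" by simp
qed

text \<open>Suited to quantities known only through their finite lower bounds, such as generalised
  inverses.\<close>

lemma ennreal_eqI_real:
  assumes "\<And>y. 0 \<le> y \<Longrightarrow> ennreal y \<le> a \<longleftrightarrow> ennreal y \<le> b"
  shows "a = b"
proof -
  have *: "b \<le> a" if *: "\<And>y. 0 \<le> y \<Longrightarrow> ennreal y \<le> a \<longleftrightarrow> ennreal y \<le> b" for a b :: ennreal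
  proof (rule ccontr)
    assume "\<not> b \<le> a"
    then have "a < b" by simp
    from dense[OF this] obtain c where c: "a < c" "c < b" by blast
    then obtain y where "0 \<le> y" "c = ennreal y" by (cases c) auto
    then show False using *[of y] c by auto
  qed
  show ?thesis using *[of a b] *[of b a] assms by (intro antisym) auto
qed

lemma inverse_antimono_ennreal: "a \<le> b \<Longrightarrow> inverse b \<le> inverse (a::ennreal)"
  by (cases a b rule: ennreal2_cases; cases "a = 0") (auto simp: inverse_ennreal le_imp_inverse_le top_unique)

section \<open>Quantiles of the target law and the weight on its levels\<close>

locale boundary_data = prob_space \<mu> for \<mu> :: "real measure" +
  fixes \<nu> :: "real measure"
  assumes sets_\<mu> [simp, measurable_cong]: "sets \<mu> = sets borel"
    and \<mu>_nonneg: "emeasure \<mu> {..<0} = 0"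
    and sets_\<nu> [simp, measurable_cong]: "sets \<nu> = sets borel"
    and \<nu>_finite: "0 < y \<Longrightarrow> emeasure \<nu> {y..} < \<top>"
    and \<nu>_pos: "y \<in> measure_support \<mu> \<Longrightarrow> 0 < emeasure \<nu> {y..}"
begin

lemma space_\<mu> [simp]: "space \<mu> = UNIV"
  using sets_eq_imp_space_eq[OF sets_\<mu>] by simp

lemma space_\<nu> [simp]: "space \<nu> = UNIV"
  using sets_eq_imp_space_eq[OF sets_\<nu>] by simp

definition \<sigma> :: real where "\<sigma> = prob {0}"

text \<open>Outside \<open>[0, 1)\<close> the set under \<open>Sup\<close> is empty or all of the
  reals, hence the default 0.\<close>

definition q :: "real \<Rightarrow> real" where
  "q u = (if 0 \<le> u \<and> u < 1 then Sup {y. prob {..<y} \<le> u} else 0)"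

lemma prob_lessThan_nonpos: "y \<le> 0 \<Longrightarrow> prob {..<y} = 0"
proof -
  assume "y \<le> 0"
  then have "emeasure \<mu> {..<y} \<le> emeasure \<mu> {..<0}"
    by (intro emeasure_mono) auto
  then show ?thesis using \<mu>_nonneg by (simp add: measure_def)
qed

lemma prob_mono: "A \<subseteq> B \<Longrightarrow> B \<in> sets borel \<Longrightarrow> prob A \<le> prob B"
  by (rule finite_measure_mono) auto

lemma prob_atMost_0: "prob {..0} = \<sigma>"
proof -
  have "prob ({..<0} \<union> {0}) = prob {..<0} + prob {0}"
    by (intro finite_measure_Union) auto
  moreover have "{..<0} \<union> {0} = {..(0::real)}" by auto
  ultimately show ?thesis using prob_lessThan_nonpos[of 0] by (simp add: \<sigma>_def)
qed

lemma prob_atMost: "prob {..x} = prob {..<x} + prob {x}"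
proof -
  have "prob ({..<x} \<union> {x}) = prob {..<x} + prob {x}"
    by (intro finite_measure_Union) auto
  moreover have "{..<x} \<union> {x} = {..x}" by auto
  ultimately show ?thesis by simp
qed

lemma \<sigma>_le: "0 < y \<Longrightarrow> \<sigma> \<le> prob {..<y}"
  unfolding \<sigma>_def by (intro prob_mono) auto

lemma \<sigma>_bounds: "0 \<le> \<sigma>" "\<sigma> \<le> 1"
  by (auto simp: \<sigma>_def)

text \<open>Continuity from above along the half lines ending at \<open>x + 1 / (k + 1)\<close>,
  which decrease to \<open>{..x}\<close>.\<close>

lemma prob_lessThan_right:
  assumes "prob {..x} < u" obtains y where "x < y" "prob {..<y} < u"
proof -
  have "(\<Inter>k. {..<x + 1 / real (Suc k)}) = {..x}"
  proof -
    have "w \<le> x" if "\<forall>k. w < x + 1 / real (Suc k)" for w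
    proof (rule ccontr)
      assume "\<not> w \<le> x"
      then obtain k where "inverse (real (Suc k)) < w - x"
        using reals_Archimedean[of "w - x"] by auto
      then show False using that[rule_format, of k] by (simp add: inverse_eq_divide)
    qed
    moreover have "w < x + 1 / real (Suc k)" if "w \<le> x" for w k
      using that by (auto intro: le_less_trans)
    ultimately show ?thesis by auto
  qed
  moreover have "(\<lambda>k. prob {..<x + 1 / real (Suc k)}) \<longlonglongrightarrow> prob (\<Inter>k. {..<x + 1 / real (Suc k)})"
  proof (rule finite_Lim_measure_decseq)
    show "decseq (\<lambda>k. {..<x + 1 / real (Suc k)})"
      by (intro decseq_SucI) (auto elim!: order.strict_trans2 intro!: divide_left_mono)
  qed auto
  ultimately have "(\<lambda>k. prob {..<x + 1 / real (Suc k)}) \<longlonglongrightarrow> prob {..x}"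
    by simp
  then have "\<forall>\<^sub>F k in sequentially. prob {..<x + 1 / real (Suc k)} < u"
    using assms by (rule order_tendstoD)
  then obtain k where "prob {..<x + 1 / real (Suc k)} < u"
    by (auto simp: eventually_sequentially)
  then show ?thesis by (intro that[of "x + 1 / real (Suc k)"]) auto
qed

lemma prob_lessThan_le_iff: "prob {..<y} \<le> u \<longleftrightarrow> (\<forall>x<y. prob {..<x} \<le> u)"
proof (cases "0 \<le> u")
  case True
  then show ?thesis
    using emeasure_lessThan_le_iff[OF sets_\<mu>, of y "ennreal u"] by (simp add: emeasure_eq_measure)
next
  case False
  have "\<not> prob A \<le> u" for A
    using False measure_nonneg[of \<mu> A] by (auto simp del: measure_nonneg)
  then show ?thesis
    using lt_ex[of y] by auto
qed

text \<open>Left-continuity of the mass of open half lines makes the defining supremum attained, so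
  the equivalence holds without exceptional levels. Almost every later use of \<open>q\<close> goes
  through it.\<close>

lemma q_iff:
  assumes "0 \<le> u" "u < 1"
  shows "y \<le> q u \<longleftrightarrow> prob {..<y} \<le> u"
proof -
  let ?S = "{y. prob {..<y} \<le> u}"
  have ne: "0 \<in> ?S" using prob_lessThan_nonpos[of 0] assms by simp
  have "(\<lambda>k. prob {..<real k}) \<longlonglongrightarrow> prob (\<Union>k. {..<real k})"
    by (rule finite_Lim_measure_incseq) (auto simp: incseq_def)
  moreover have "(\<Union>k. {..<real k}) = UNIV" by (auto intro: reals_Archimedean2)
  ultimately have "(\<lambda>k. prob {..<real k}) \<longlonglongrightarrow> 1"
    using prob_space by simp
  then have "\<forall>\<^sub>F k in sequentially. u < prob {..<real k}"
    using assms by (intro order_tendstoD) auto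
  then obtain k where k: "u < prob {..<real k}"
    by (auto simp: eventually_sequentially)
  have "y \<le> real k" if "y \<in> ?S" for y
  proof (rule ccontr)
    assume "\<not> y \<le> real k"
    then have "prob {..<real k} \<le> prob {..<y}" by (intro prob_mono) auto
    then show False using that k by simp
  qed
  then have bdd: "bdd_above ?S" by (rule bdd_aboveI)
  have Sup: "prob {..<Sup ?S} \<le> u"
    unfolding prob_lessThan_le_iff[of "Sup ?S"]
  proof (intro allI impI)
    fix x assume "x < Sup ?S"
    then obtain s where s: "s \<in> ?S" "x < s"
      using less_cSup_iff[OF _ bdd] ne by blast
    then have "prob {..<x} \<le> prob {..<s}" by (intro prob_mono) auto
    then show "prob {..<x} \<le> u" using s by simp
  qed
  show ?thesis
  proof
    assume "y \<le> q u"
    then have "prob {..<y} \<le> prob {..<Sup ?S}"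
      using assms by (intro prob_mono) (auto simp: q_def)
    then show "prob {..<y} \<le> u" using Sup by simp
  next
    assume "prob {..<y} \<le> u"
    then show "y \<le> q u"
      using cSup_upper[OF _ bdd, of y] assms by (simp add: q_def)
  qed
qed

lemma q_less_iff: "0 \<le> u \<Longrightarrow> u < 1 \<Longrightarrow> q u < y \<longleftrightarrow> u < prob {..<y}"
  using q_iff[of u y] by auto

lemma q_nonneg: "0 \<le> q u"
  using q_iff[of u 0] prob_lessThan_nonpos[of 0] by (cases "0 \<le> u \<and> u < 1") (auto simp: q_def)

lemma q_mono: "0 \<le> u \<Longrightarrow> u \<le> v \<Longrightarrow> v < 1 \<Longrightarrow> q u \<le> q v"
  using q_iff[of v "q u"] q_iff[of u "q u"] by auto

lemma q_measurable [measurable]: "q \<in> borel_measurable borel"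
  unfolding borel_measurable_iff_ge
proof
  fix y
  have "{u. y \<le> q u} = {u. 0 \<le> u \<and> u < 1 \<and> prob {..<y} \<le> u} \<union> {u. \<not> (0 \<le> u \<and> u < 1) \<and> y \<le> 0}"
    using q_iff by (auto simp: q_def)
  then show "{u \<in> space borel. y \<le> q u} \<in> sets borel" by simp
qed

text \<open>The mass of \<open>{..<y}\<close> tends to \<sigma> as y decreases to 0, so it is still
  below u for some positive y.\<close>

lemma q_pos:
  assumes "\<sigma> < u" "u < 1" shows "0 < q u"
proof -
  obtain y where "0 < y" "prob {..<y} < u"
    using prob_lessThan_right[of 0 u] assms prob_atMost_0 by auto
  then show ?thesis using q_iff[of u y] assms \<sigma>_bounds by auto
qed

lemma q_eq_0: "0 \<le> u \<Longrightarrow> u < \<sigma> \<Longrightarrow> q u = 0"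
proof -
  assume u: "0 \<le> u" "u < \<sigma>"
  have "\<not> 0 < q u"
    using q_iff[of u "q u"] u \<sigma>_le[of "q u"] \<sigma>_bounds by auto
  then show ?thesis using q_nonneg[of u] by auto
qed

lemma q_between:
  assumes "0 \<le> u" "u < 1" shows "prob {..<q u} \<le> u" "u \<le> prob {..q u}"
proof -
  show "prob {..<q u} \<le> u" using q_iff[of u "q u"] assms by simp
  show "u \<le> prob {..q u}"
  proof (rule ccontr)
    assume "\<not> ?thesis"
    then obtain y where "q u < y" "prob {..<y} < u"
      using prob_lessThan_right[of "q u" u] by auto
    then show False using q_iff[of u y] assms by simp
  qed
qed

text \<open>More than u of the mass lies below any point to the right of \<open>q u\<close>, at most
  u lies below \<open>q u\<close> itself, so every neighbourhood has positive mass. This carries the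
  tail hypothesis on the support over to all levels.\<close>

lemma q_support:
  assumes "0 \<le> u" "u < 1" shows "q u \<in> measure_support \<mu>"
  unfolding measure_support_def
proof (intro CollectI allI impI)
  fix S assume S: "open S" "q u \<in> S"
  then obtain e where e: "0 < e" "ball (q u) e \<subseteq> S"
    by (auto simp: open_contains_ball)
  have 1: "u < prob {..<q u + e}"
    using e q_less_iff[of u "q u + e"] assms by simp
  have "prob {..q u - e} \<le> prob {..<q u}"
    using e by (intro prob_mono) auto
  then have 2: "prob {..q u - e} \<le> u"
    using q_between(1)[OF assms] by simp
  have "prob ({..<q u + e} - {..q u - e}) = prob {..<q u + e} - prob {..q u - e}"
    using e by (intro finite_measure_Diff) auto
  moreover have "{..<q u + e} - {..q u - e} \<subseteq> S"
    using e(2) by (auto simp: dist_real_def subset_iff)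
  then have "prob ({..<q u + e} - {..q u - e}) \<le> prob S"
    using S(1) by (intro prob_mono) auto
  ultimately have "0 < prob S" using 1 2 by simp
  then show "0 < emeasure \<mu> S"
    using S by (simp add: emeasure_eq_measure)
qed

lemma distr_q: "distr (density lborel (indicator {0<..<1})) borel q = \<mu>"
proof (rule measure_eqI_Iio)
  have *: "emeasure (distr (density lborel (indicator {0<..<1})) borel q) {..<x} = emeasure \<mu> {..<x}" for x
  proof -
    have "emeasure (distr (density lborel (indicator {0<..<1})) borel q) {..<x} =
        emeasure (density lborel (indicator {0<..<1})) {u. q u < x}"
      by (subst emeasure_distr) (auto simp: vimage_def)
    also have "\<dots> = emeasure lborel ({0<..<1} \<inter> {u. q u < x})"
      by (subst emeasure_density) (auto simp: indicator_inter_arith[symmetric])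
    also have "{0<..<1} \<inter> {u. q u < x} = {0<..<1} \<inter> {..<prob {..<x}}"
      using q_less_iff by auto
    also have "\<dots> = {0<..<prob {..<x}}"
      using prob_le_1[of "{..<x}"] by (auto simp del: prob_le_1)
    finally show ?thesis by (simp add: emeasure_eq_measure)
  qed
  show "emeasure (distr (density lborel (indicator {0<..<1})) borel q) {..<x} = emeasure \<mu> {..<x}" for x by fact
  show "emeasure (distr (density lborel (indicator {0<..<1})) borel q) {..<x} < \<infinity>" for x
    by (simp add: * emeasure_eq_measure)
qed auto

lemma nn_integral_\<mu>:
  assumes [measurable]: "h \<in> borel_measurable borel"
  shows "(\<integral>\<^sup>+x. h x \<partial>\<mu>) = (\<integral>\<^sup>+u. h (q u) * indicator {0<..<1} u \<partial>lborel)"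
proof -
  have "(\<integral>\<^sup>+x. h x \<partial>\<mu>) = (\<integral>\<^sup>+u. h (q u) \<partial>density lborel (indicator {0<..<1}))"
    by (subst distr_q[symmetric]) (intro nn_integral_distr; measurable)
  also have "\<dots> = (\<integral>\<^sup>+u. h (q u) * indicator {0<..<1} u \<partial>lborel)"
    by (subst nn_integral_density) (measurable, simp only: mult.commute)
  finally show ?thesis .
qed

definition f :: "real \<Rightarrow> ennreal" where
  "f u = ennreal (1 / (1 + \<sigma> - u)) / emeasure \<nu> {q u..}"

lemma tail_measurable [measurable]: "(\<lambda>y. emeasure \<nu> {y..}) \<in> borel_measurable borel"
  by (intro borel_measurable_antimono_order antimonoI emeasure_mono) auto

lemma \<nu>_q: "\<sigma> < u \<Longrightarrow> u < 1 \<Longrightarrow> 0 < emeasure \<nu> {q u..}" "\<sigma> < u \<Longrightarrow> u < 1 \<Longrightarrow> emeasure \<nu> {q u..} < \<top>"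
  using \<nu>_pos[OF q_support] \<nu>_finite[OF q_pos] \<sigma>_bounds by auto

sublocale cumulative_weight f \<sigma> 1
proof
  show "f \<in> borel_measurable borel" unfolding f_def by measurable
  show "0 < f u" if "\<sigma> < u" "u < 1" for u
    using that \<nu>_q[of u] \<sigma>_bounds by (auto simp: f_def ennreal_zero_less_divide)
  show "\<exists>C\<ge>0. \<forall>v. \<sigma> < v \<longrightarrow> v \<le> u \<longrightarrow> f v \<le> ennreal C" if "u < 1" for u
  proof (cases "\<sigma> < u")
    case True
    \<comment> \<open>Since \<open>q\<close> is increasing, the tail of \<nu> is smallest at u, and
      \<open>1 + \<sigma> - v\<close> is at least \<open>1 - u\<close>.\<close>
    have "f v \<le> ennreal (1 / (1 - u)) / emeasure \<nu> {q u..}" if "\<sigma> < v" "v \<le> u" for v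
    proof -
      have "emeasure \<nu> {q u..} \<le> emeasure \<nu> {q v..}"
        using q_mono[of v u] that \<open>u < 1\<close> \<sigma>_bounds by (intro emeasure_mono) auto
      moreover have "1 / (1 + \<sigma> - v) \<le> 1 / (1 - u)"
        using that \<open>u < 1\<close> \<sigma>_bounds by (intro divide_left_mono) auto
      ultimately show ?thesis
        unfolding f_def divide_ennreal_def
        by (intro mult_mono ennreal_leI inverse_antimono_ennreal) auto
    qed
    moreover have "ennreal (1 / (1 - u)) / emeasure \<nu> {q u..} < \<top>"
      using \<nu>_q[of u] True that by (auto simp: ennreal_divide_eq_top_iff less_top[symmetric])
    ultimately show ?thesis
      by (intro exI[of _ "enn2real (ennreal (1 / (1 - u)) / emeasure \<nu> {q u..})"]) auto
  next
    case False
    then show ?thesis by (intro exI[of _ 0]) auto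
  qed
qed

lemma D_AE_eq:
  assumes "A \<in> sets borel" "B \<in> sets borel"
    and "AE u in lborel. \<sigma> < u \<longrightarrow> u < 1 \<longrightarrow> (u \<in> A \<longleftrightarrow> u \<in> B)"
  shows "emeasure D A = emeasure D B"
  using assms by (subst (1 2) emeasure_D) (auto intro!: nn_integral_cong_AE simp: indicator_def elim!: eventually_mono)

lemma D_q_less: "emeasure D {u. q u < y} = emeasure D {..<prob {..<y}}"
  using q_less_iff \<sigma>_bounds by (intro D_AE_eq AE_I2) auto

section \<open>Tails of the shifted law and the formula for psi\<close>

abbreviation \<mu>' :: "ennreal measure" where "\<mu>' \<equiv> shift_zero_mass \<mu>"

lemma shift_measurable [measurable]: "(\<lambda>x::real. if x = 0 then \<top> else ennreal x) \<in> borel_measurable borel"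
  by measurable

lemma sets_\<mu>' [simp, measurable_cong]: "sets \<mu>' = sets borel"
  by (simp add: shift_zero_mass_def)

lemma emeasure_\<mu>': "A \<in> sets borel \<Longrightarrow> emeasure \<mu>' A = emeasure \<mu> {x. (if x = 0 then \<top> else ennreal x) \<in> A}"
  unfolding shift_zero_mass_def by (subst emeasure_distr) (auto simp: vimage_def cong: measurable_cong_sets)

text \<open>The tail includes infinity, so the preimage also contains the point 0; this is the
  origin of the summand \<sigma>.\<close>

lemma \<mu>'_atLeast:
  assumes "0 < x" shows "emeasure \<mu>' {ennreal x..} = ennreal (1 + \<sigma> - prob {..<x})"
proof -
  have "emeasure \<mu>' {ennreal x..} = emeasure \<mu> {w. (if w = 0 then \<top> else ennreal w) \<in> {ennreal x..}}"
    by (rule emeasure_\<mu>') simp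
  also have "{w. (if w = 0 then \<top> else ennreal w) \<in> {ennreal x..}} = (UNIV - {..<x}) \<union> {0}"
    using assms by (auto simp: ennreal_le_iff2)
  also have "emeasure \<mu> ((UNIV - {..<x}) \<union> {0}) = ennreal (prob ((UNIV - {..<x}) \<union> {0}))"
    by (rule emeasure_eq_measure)
  also have "prob ((UNIV - {..<x}) \<union> {0}) = prob (UNIV - {..<x}) + prob {0}"
    using assms by (intro finite_measure_Union) auto
  also have "prob (UNIV - {..<x}) = 1 - prob {..<x}"
    using prob_compl[of "{..<x}"] by simp
  finally show ?thesis by (simp add: \<sigma>_def algebra_simps)
qed

lemma \<mu>'_greaterThan:
  assumes "0 < x" shows "emeasure \<mu>' {ennreal x<..} = ennreal (1 + \<sigma> - prob {..x})"
proof -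
  have "emeasure \<mu>' {ennreal x<..} = emeasure \<mu> {w. (if w = 0 then \<top> else ennreal w) \<in> {ennreal x<..}}"
    by (rule emeasure_\<mu>') simp
  also have "{w. (if w = 0 then \<top> else ennreal w) \<in> {ennreal x<..}} = (UNIV - {..x}) \<union> {0}"
    using assms by (auto simp: ennreal_less_iff)
  also have "emeasure \<mu> ((UNIV - {..x}) \<union> {0}) = ennreal (prob ((UNIV - {..x}) \<union> {0}))"
    by (rule emeasure_eq_measure)
  also have "prob ((UNIV - {..x}) \<union> {0}) = prob (UNIV - {..x}) + prob {0}"
    using assms by (intro finite_measure_Union) auto
  also have "prob (UNIV - {..x}) = 1 - prob {..x}"
    using prob_compl[of "{..x}"] by simp
  finally show ?thesis by (simp add: \<sigma>_def algebra_simps)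
qed

lemma \<mu>'_singleton:
  assumes "0 < x" shows "emeasure \<mu>' {ennreal x} = ennreal (prob {x})"
proof -
  have "{w. (if w = 0 then \<top> else ennreal w) \<in> {ennreal x}} = {x}"
    using assms by (auto simp: ennreal_eq_0_iff)
      (metis ennreal_inj ennreal_neg ennreal_eq_0_iff less_eq_real_def not_less)
  then show ?thesis by (subst emeasure_\<mu>') (auto simp: emeasure_eq_measure)
qed

lemma \<mu>'_0: "emeasure \<mu>' {0} = 0"
proof -
  have "{w. (if w = 0 then \<top> else ennreal w) \<in> {0}} = {..<0}"
    by (auto simp: ennreal_eq_0_iff)
  then show ?thesis using \<mu>_nonneg by (subst emeasure_\<mu>') auto
qed

lemma finite_measure_\<mu>': "finite_measure \<mu>'"
  unfolding shift_zero_mass_def by (intro finite_measure_distr) (simp cong: measurable_cong_sets)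

text \<open>Up to endpoints the levels sent to x fill the interval from \<open>prob {..<x}\<close>
  to \<open>prob {..x}\<close>. There the tail of \<nu> is constant, and the remaining reciprocal
  integrates to the logarithm of the ratio of the two tails of the shifted law.\<close>

lemma D_q_atom:
  assumes "0 < x" "0 < prob {x}"
  shows "emeasure D {u. q u = x} = ln_ratio (emeasure \<mu>' {ennreal x..}) (emeasure \<mu>' {ennreal x<..}) / emeasure \<nu> {x..}"
proof -
  have [measurable]: "{u. q u = x} \<in> sets borel"
  proof -
    have "{u \<in> space borel. q u = x} \<in> sets borel" by measurable
    then show ?thesis by simp
  qed
  have a: "prob {..<x} < 1" "prob {..x} \<le> 1" "prob {..<x} \<le> prob {..x}"
    using prob_atMost[of x] assms prob_le_1[of "{..x}"] by linarith+
  have ax: "\<sigma> \<le> prob {..<x}" using \<sigma>_le assms by simp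
  have "emeasure D {u. q u = x} = (\<integral>\<^sup>+u. f u * indicator {\<sigma><..<1} u * indicator {u. q u = x} u \<partial>lborel)"
    by (rule emeasure_D) measurable
  also have "\<dots> = (\<integral>\<^sup>+u. (ennreal (1 / ((1 + \<sigma>) - u)) * indicator {prob {..<x}<..<prob {..x}} u) / emeasure \<nu> {x..} \<partial>lborel)"
  proof (rule nn_integral_cong_AE)
    show "AE u in lborel. f u * indicator {\<sigma><..<1} u * indicator {u. q u = x} u =
      (ennreal (1 / ((1 + \<sigma>) - u)) * indicator {prob {..<x}<..<prob {..x}} u) / emeasure \<nu> {x..}"
      \<comment> \<open>Whether the two endpoint levels are sent to x is immaterial.\<close>
      using AE_lborel_singleton[of "prob {..<x}"] AE_lborel_singleton[of "prob {..x}"]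
    proof eventually_elim
      case (elim u)
      have "u \<in> {prob {..<x}<..<prob {..x}} \<longleftrightarrow> u \<in> {\<sigma><..<1} \<and> q u = x"
      proof
        assume u: "u \<in> {prob {..<x}<..<prob {..x}}"
        have "u < 1" using u a(2) by (meson greaterThanLessThan_iff less_le_trans)
        then have u1: "0 \<le> u" "u < 1" "\<sigma> < u" using u a ax \<sigma>_bounds by auto
        have "x \<le> q u" using q_iff[of u x] u u1 by simp
        moreover have "q u \<le> x"
        proof (rule ccontr)
          assume "\<not> q u \<le> x"
          then have "prob {..x} \<le> prob {..<q u}" by (intro prob_mono) auto
          then show False using q_between(1)[of u] u u1 by auto
        qed
        ultimately show "u \<in> {\<sigma><..<1} \<and> q u = x" using u1 by auto
      next
        assume "u \<in> {\<sigma><..<1} \<and> q u = x"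
        then show "u \<in> {prob {..<x}<..<prob {..x}}"
          using q_between[of u] elim \<sigma>_bounds by auto
      qed
      then show ?case by (auto simp: indicator_def f_def)
    qed
  qed
  also have "\<dots> = (\<integral>\<^sup>+u. ennreal (1 / ((1 + \<sigma>) - u)) * indicator {prob {..<x}<..<prob {..x}} u \<partial>lborel) / emeasure \<nu> {x..}"
    by (rule nn_integral_divide) measurable
  also have "(\<integral>\<^sup>+u. ennreal (1 / ((1 + \<sigma>) - u)) * indicator {prob {..<x}<..<prob {..x}} u \<partial>lborel) =
      ln_ratio (emeasure \<mu>' {ennreal x..}) (emeasure \<mu>' {ennreal x<..})"
    using a ax \<sigma>_bounds by (subst nn_integral_reciprocal) (auto intro: add_increasing2 simp: \<mu>'_atLeast[OF assms(1)] \<mu>'_greaterThan[OF assms(1)])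
  finally show ?thesis .
qed

text \<open>The quantile transform turns the integral over \<mu> into one over levels. At a
  non-atom, \<open>prob {..<q u}\<close> equals u, so the tail of the shifted law is exactly
  \<open>1 + \<sigma> - u\<close> and the integrand is \<open>f\<close>.\<close>

lemma psi_continuous_part:
  assumes "0 \<le> y"
  shows "(\<integral>\<^sup>+s\<in>{0..ennreal y}. indicator {s. emeasure \<mu>' {s} = 0} s
        / (emeasure \<mu>' {s..} * emeasure \<nu> {enn2real s..}) \<partial>\<mu>') = emeasure D {u. q u < y \<and> prob {q u} = 0}"
proof -
  interpret \<mu>': finite_measure \<mu>' by (rule finite_measure_\<mu>')
  have "emeasure \<mu>' {s} \<noteq> 0 \<longleftrightarrow> measure \<mu>' {s} \<noteq> 0" for s
    unfolding \<mu>'.emeasure_eq_measure ennreal_eq_0_iff using measure_nonneg[of \<mu>' "{s}"] by linarith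
  then have c: "countable {s. emeasure \<mu>' {s} \<noteq> 0}"
    using \<mu>'.countable_support by simp
  have "{s. emeasure \<mu>' {s} = 0} = - {s. emeasure \<mu>' {s} \<noteq> 0}" by auto
  also have "\<dots> \<in> sets borel"
    by (intro borel_comp sets.countable[OF _ c]) auto
  finally have [measurable]: "{s. emeasure \<mu>' {s} = 0} \<in> sets borel" .
  have [measurable]: "(\<lambda>s. emeasure \<mu>' {s..}) \<in> borel_measurable borel"
    by (intro borel_measurable_antimono_order antimonoI emeasure_mono) auto
  have c': "countable {x. prob {x} \<noteq> 0}"
    by (rule countable_support)
  have "{x. prob {x} = 0} = - {x. prob {x} \<noteq> 0}" by auto
  also have "\<dots> \<in> sets borel"
    by (intro borel_comp sets.countable[OF _ c']) auto
  finally have [measurable]: "{x. prob {x} = 0} \<in> sets borel" .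
  have [measurable]: "{u. q u < y \<and> prob {q u} = 0} \<in> sets borel"
  proof -
    have "{u \<in> space borel. q u < y \<and> q u \<in> {x. prob {x} = 0}} \<in> sets borel" by measurable
    then show ?thesis by simp
  qed
  define Q where "Q s = indicator {s. emeasure \<mu>' {s} = 0} s
        / (emeasure \<mu>' {s..} * emeasure \<nu> {enn2real s..}) * indicator {0..ennreal y} s" for s
  have [measurable]: "Q \<in> borel_measurable borel" unfolding Q_def by measurable
  define w where "w = (\<lambda>x::real. if x = 0 then \<top> else ennreal x)"
  have [measurable]: "w \<in> borel_measurable borel" unfolding w_def by measurable
  have "(\<integral>\<^sup>+s. Q s \<partial>\<mu>') = (\<integral>\<^sup>+x. Q (w x) \<partial>\<mu>)"
    unfolding shift_zero_mass_def w_def[symmetric] by (intro nn_integral_distr) (auto cong: measurable_cong_sets)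
  also have "\<dots> = (\<integral>\<^sup>+u. Q (w (q u)) * indicator {0<..<1} u \<partial>lborel)"
    by (rule nn_integral_\<mu>) measurable
  also have "\<dots> = (\<integral>\<^sup>+u. f u * indicator {\<sigma><..<1} u * indicator {u. q u < y \<and> prob {q u} = 0} u \<partial>lborel)"
  proof (rule nn_integral_cong_AE)
    \<comment> \<open>The integral includes the endpoint y while \<open>D\<close> is evaluated on
      \<open>q u < y\<close>; for non-atoms the discrepancy is the single level
      \<open>prob {..<y}\<close>. The level \<sigma> is dropped because \<open>q\<close> need not be
      positive there.\<close>
    show "AE u in lborel. Q (w (q u)) * indicator {0<..<1} u =
      f u * indicator {\<sigma><..<1} u * indicator {u. q u < y \<and> prob {q u} = 0} u"
      using AE_lborel_singleton[of \<sigma>] AE_lborel_singleton[of "prob {..<y}"]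
    proof eventually_elim
      case (elim u)
      show ?case
      proof (cases "0 < u \<and> u < 1")
        case False
        then show ?thesis using \<sigma>_bounds by (auto simp: indicator_def)
      next
        case u: True
        show ?thesis
        proof (cases "u < \<sigma>")
          case True
          \<comment> \<open>These levels carry the mass that was moved to infinity: \<open>w\<close>
            sends them to \<open>\<top>\<close>, outside the range of integration.\<close>
          then have "q u = 0" using u q_eq_0[of u] by simp
          then show ?thesis using True by (simp add: Q_def w_def indicator_def top_unique)
        next
          case False
          with elim have su: "\<sigma> < u" by simp
          then have qp: "0 < q u" using q_pos u by simp
          then have w: "w (q u) = ennreal (q u)" by (simp add: w_def)
          have e1: "emeasure \<mu>' {w (q u)} = 0 \<longleftrightarrow> prob {q u} = 0"
            using \<mu>'_singleton[OF qp] w by (simp add: measure_le_0_iff)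
          show ?thesis
          proof (cases "prob {q u} = 0")
            case False
            then show ?thesis using e1 by (simp add: Q_def)
          next
            case True
            then have pu: "prob {..<q u} = u"
              using q_between[of u] u prob_atMost[of "q u"] by simp
            have "q u \<noteq> y" using pu elim by auto
            moreover have "f u = 1 / (emeasure \<mu>' {w (q u)..} * emeasure \<nu> {enn2real (w (q u))..})"
            proof -
              obtain r where r: "0 \<le> r" "emeasure \<nu> {q u..} = ennreal r"
                using \<nu>_q(2)[of u] su u by (cases "emeasure \<nu> {q u..}") auto
              have "0 < r" using r \<nu>_q(1)[of u] su u by auto
              then show ?thesis
                using r \<mu>'_atLeast[OF qp] pu w qp u su \<sigma>_bounds
                by (simp add: f_def divide_ennreal ennreal_mult'[symmetric] divide_ennreal[of 1, simplified])
            qed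
            ultimately show ?thesis
              using e1 True w qp u su assms by (auto simp: Q_def indicator_def)
          qed
        qed
      qed
    qed
  qed
  also have "\<dots> = emeasure D {u. q u < y \<and> prob {q u} = 0}"
    by (rule emeasure_D[symmetric]) measurable
  finally show ?thesis unfolding Q_def .
qed

lemma psi_eq:
  assumes "0 \<le> y"
  shows "psi \<nu> \<mu>' y = emeasure D {u. q u < y}"
proof -
  \<comment> \<open>The atoms of the shifted law below y are finite and positive, since nothing is
    left at 0; \<open>ennreal\<close> identifies them with real atoms of \<mu>.\<close>
  define A where "A = {x. 0 < x \<and> x < y \<and> 0 < prob {x}}"
  have A: "bij_betw ennreal A {s. s < ennreal y \<and> emeasure \<mu>' {s} > 0}"
  proof (rule bij_betwI[where g=enn2real])
    show "ennreal \<in> A \<rightarrow> {s. s < ennreal y \<and> emeasure \<mu>' {s} > 0}"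
      by (auto simp: A_def \<mu>'_singleton ennreal_less_iff)
    show "enn2real \<in> {s. s < ennreal y \<and> emeasure \<mu>' {s} > 0} \<rightarrow> A"
    proof
      fix s assume s: "s \<in> {s. s < ennreal y \<and> emeasure \<mu>' {s} > 0}"
      then obtain r where r: "s = ennreal r" "0 \<le> r" by (cases s) auto
      have "r \<noteq> 0" using s r \<mu>'_0 by auto
      then have "0 < r" using r by simp
      then show "enn2real s \<in> A"
        using s r \<mu>'_singleton[of r] by (auto simp: A_def ennreal_less_iff)
    qed
    show "enn2real (ennreal x) = x" if "x \<in> A" for x using that by (simp add: A_def)
    show "ennreal (enn2real s) = s" if "s \<in> {s. s < ennreal y \<and> emeasure \<mu>' {s} > 0}" for s
      using that by (cases s) auto
  qed
  have "countable A"
    by (rule countable_subset[OF _ countable_support]) (auto simp: A_def)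
  have m: "{u. q u = x} \<in> sets borel" for x
  proof -
    have "{u \<in> space borel. q u = x} \<in> sets borel" by measurable
    then show ?thesis by simp
  qed
  have "(\<integral>\<^sup>+s. ln_ratio (emeasure \<mu>' {s..}) (emeasure \<mu>' {s<..}) / emeasure \<nu> {enn2real s..}
        \<partial>count_space {s. s < ennreal y \<and> emeasure \<mu>' {s} > 0}) =
      (\<integral>\<^sup>+x. ln_ratio (emeasure \<mu>' {ennreal x..}) (emeasure \<mu>' {ennreal x<..}) / emeasure \<nu> {enn2real (ennreal x)..} \<partial>count_space A)"
    by (rule nn_integral_bij_count_space[OF A, symmetric])
  also have "\<dots> = (\<integral>\<^sup>+x. emeasure D {u. q u = x} \<partial>count_space A)"
    by (intro nn_integral_cong) (auto simp: A_def D_q_atom)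
  also have "\<dots> = emeasure D (\<Union>x\<in>A. {u. q u = x})"
    using \<open>countable A\<close> m by (intro emeasure_UN_countable[symmetric]) (auto simp: disjoint_family_on_def)
  finally have 2: "(\<integral>\<^sup>+s. ln_ratio (emeasure \<mu>' {s..}) (emeasure \<mu>' {s<..}) / emeasure \<nu> {enn2real s..}
        \<partial>count_space {s. s < ennreal y \<and> emeasure \<mu>' {s} > 0}) = emeasure D (\<Union>x\<in>A. {u. q u = x})" .
  have mA: "(\<Union>x\<in>A. {u. q u = x}) \<in> sets borel"
    using \<open>countable A\<close> m by (intro sets.countable_UN') auto
  have mq: "{u. q u < y} \<in> sets borel"
  proof -
    have "{u \<in> space borel. q u < y} \<in> sets borel" by measurable
    then show ?thesis by simp
  qed
  have "emeasure D {u. q u < y \<and> prob {q u} = 0} = emeasure D ({u. q u < y} - (\<Union>x\<in>A. {u. q u = x}))"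
  proof (rule D_AE_eq)
    have c': "countable {x. prob {x} \<noteq> 0}"
      by (rule countable_support)
    have [measurable]: "{x. prob {x} \<noteq> 0} \<in> sets borel"
      by (rule sets.countable[OF _ c']) auto
    have "{u \<in> space borel. q u < y \<and> q u \<notin> {x. prob {x} \<noteq> 0}} \<in> sets borel" by measurable
    then show "{u. q u < y \<and> prob {q u} = 0} \<in> sets borel" by simp
    show "AE u in lborel. \<sigma> < u \<longrightarrow> u < 1 \<longrightarrow> (u \<in> {u. q u < y \<and> prob {q u} = 0} \<longleftrightarrow>
        u \<in> {u. q u < y} - (\<Union>x\<in>A. {u. q u = x}))"
      using q_pos by (auto simp: A_def zero_less_measure_iff)
  qed (use mq mA in auto)
  moreover have "({u. q u < y} - (\<Union>x\<in>A. {u. q u = x})) \<union> (\<Union>x\<in>A. {u. q u = x}) = {u. q u < y}"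
    by (auto simp: A_def)
  moreover have "emeasure D ({u. q u < y} - (\<Union>x\<in>A. {u. q u = x})) + emeasure D (\<Union>x\<in>A. {u. q u = x}) =
      emeasure D (({u. q u < y} - (\<Union>x\<in>A. {u. q u = x})) \<union> (\<Union>x\<in>A. {u. q u = x}))"
    using mA mq by (intro plus_emeasure) auto
  ultimately show ?thesis
    unfolding psi_def psi_continuous_part[OF assms] 2 by simp
qed

section \<open>The boundary as generalised inverse of psi\<close>

abbreviation \<phi> :: "real \<Rightarrow> ennreal" where "\<phi> \<equiv> phi \<nu> \<mu>'"

lemma phi_mono: "mono \<phi>"
  unfolding phi_def first_time_def by (intro monoI Inf_superset_mono) (auto intro: le_less_trans ennreal_leI)

lemma phi_measurable [measurable]: "\<phi> \<in> borel_measurable borel"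
  by (rule borel_measurable_mono_order[OF phi_mono])

lemma psi_eq_distr:
  assumes "0 \<le> y" shows "psi \<nu> \<mu>' y = emeasure (distr D borel q) {..<y}"
  unfolding psi_eq[OF assms] by (subst emeasure_distr) (auto simp: vimage_def)

text \<open>As the mass of an open half line, \<open>psi\<close> is increasing and left-continuous;
  an increasing left-continuous function and its right-continuous inverse are related by this
  equivalence.\<close>

lemma phi_iff:
  assumes "0 \<le> y" "0 \<le> x"
  shows "ennreal y \<le> \<phi> x \<longleftrightarrow> psi \<nu> \<mu>' y \<le> ennreal x"
proof
  assume *: "psi \<nu> \<mu>' y \<le> ennreal x"
  show "ennreal y \<le> \<phi> x"
    unfolding phi_def le_first_time_iff
  proof (intro allI impI)
    fix t :: real assume t: "0 \<le> t" "ennreal x < psi \<nu> \<mu>' t"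
    have "\<not> t < y"
    proof
      assume "t < y"
      then have "emeasure (distr D borel q) {..<t} \<le> emeasure (distr D borel q) {..<y}"
        by (intro emeasure_mono) auto
      then show False using * t assms by (simp add: psi_eq_distr)
    qed
    then show "ennreal y \<le> ennreal t" by (simp add: ennreal_leI)
  qed
next
  assume *: "ennreal y \<le> \<phi> x"
  show "psi \<nu> \<mu>' y \<le> ennreal x"
    unfolding psi_eq_distr[OF assms(1)]
  proof (subst emeasure_lessThan_le_iff, simp, intro allI impI)
    fix t assume "t < y"
    show "emeasure (distr D borel q) {..<t} \<le> ennreal x"
    proof (cases "0 \<le> t")
      case True
      show ?thesis
      proof (rule ccontr)
        assume "\<not> ?thesis"
        then have "\<phi> x \<le> ennreal t"
          unfolding phi_def using True by (intro first_time_le) (auto simp: psi_eq_distr)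
        with * have "ennreal y \<le> ennreal t" by simp
        then show False using \<open>t < y\<close> True by simp
      qed
    next
      case False
      \<comment> \<open>\<open>first_time\<close> only looks at nonnegative arguments, so negative t
        are settled by nonnegativity of the quantiles.\<close>
      then have "\<not> q u < t" for u using q_nonneg[of u] by auto
      then have "{u. q u < t} = {}" by simp
      then have "emeasure (distr D borel q) {..<t} = 0" by (subst emeasure_distr) (auto simp: vimage_def)
      then show ?thesis by simp
    qed
  qed
qed

text \<open>Both sides are compared through their real lower bounds y: each bound amounts to
  \<open>prob {..<y} \<le> u\<close>, on the left because \<open>G\<close> is strictly increasing
  beyond \<sigma>.\<close>

lemma phi_G:
  assumes "\<sigma> < u" "u < 1"
  shows "\<phi> (G u) = ennreal (q u)"
proof (rule ennreal_eqI_real)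
  fix y :: real assume y: "0 \<le> y"
  have "emeasure D {..<prob {..<y}} \<le> ennreal (G u) \<longleftrightarrow> prob {..<y} \<le> u"
  proof
    assume "prob {..<y} \<le> u"
    then have "emeasure D {..<prob {..<y}} \<le> emeasure D {..u}"
      by (intro emeasure_mono) auto
    then show "emeasure D {..<prob {..<y}} \<le> ennreal (G u)"
      using assms by (simp add: emeasure_D_atMost)
  next
    assume *: "emeasure D {..<prob {..<y}} \<le> ennreal (G u)"
    show "prob {..<y} \<le> u"
    proof (rule ccontr)
      assume "\<not> ?thesis"
      then obtain v where v: "u < v" "v < prob {..<y}" using dense[of u "prob {..<y}"] by auto
      then have v1: "v < 1" using prob_le_1[of "{..<y}"] by linarith
      have "ennreal (G v) = emeasure D {..v}"
        using emeasure_D_atMost[OF v1] by simp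
      also have "\<dots> \<le> emeasure D {..<prob {..<y}}"
        using v by (intro emeasure_mono) auto
      also note *
      finally have "G v \<le> G u" using G_nonneg by simp
      then show False using G_strict_mono[of u v] assms v v1 by simp
    qed
  qed
  then show "ennreal y \<le> \<phi> (G u) \<longleftrightarrow> ennreal y \<le> ennreal (q u)"
    using y assms \<sigma>_bounds by (simp add: phi_iff G_nonneg psi_eq D_q_less q_iff q_nonneg)
qed

lemma psi_le_total: "0 \<le> y \<Longrightarrow> psi \<nu> \<mu>' y \<le> emeasure D UNIV"
  by (auto simp: psi_eq intro!: emeasure_mono)

lemma psi_SUP: "(SUP k. psi \<nu> \<mu>' (real k)) = emeasure D UNIV"
proof -
  have "(SUP k. emeasure (distr D borel q) {..<real k}) = emeasure (distr D borel q) (\<Union>k. {..<real k})"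
    by (rule SUP_emeasure_incseq) (auto simp: incseq_def)
  also have "(\<Union>k. {..<real k}) = UNIV" by (auto intro: reals_Archimedean2)
  finally show ?thesis
    by (simp add: psi_eq_distr emeasure_distr)
qed

lemma psi_infinity_eq: "psi_infinity \<nu> \<mu>' = emeasure D UNIV"
  unfolding psi_infinity_def
proof (rule tendsto_Lim)
  show "(psi \<nu> \<mu>' \<longlongrightarrow> emeasure D UNIV) at_top"
  proof (rule order_tendstoI)
    fix a assume "a < emeasure D UNIV"
    then obtain k :: nat where k: "a < psi \<nu> \<mu>' (real k)"
      unfolding psi_SUP[symmetric] by (auto simp: less_SUP_iff)
    show "\<forall>\<^sub>F y in at_top. a < psi \<nu> \<mu>' y"
      using eventually_ge_at_top[of "real k"]
    proof eventually_elim
      case (elim y)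
      have "emeasure (distr D borel q) {..<real k} \<le> emeasure (distr D borel q) {..<y}"
        using elim by (intro emeasure_mono) auto
      then show ?case using k elim by (simp add: psi_eq_distr)
    qed
  next
    fix a assume "emeasure D UNIV < a"
    then show "\<forall>\<^sub>F y in at_top. psi \<nu> \<mu>' y < a"
      by (intro eventually_mono[OF eventually_ge_at_top[of 0]] le_less_trans[OF psi_le_total])
  qed
qed simp

text \<open>\<open>psi\<close> increases to the total mass of \<open>D\<close>; from this local time
  on the boundary is out of reach. It is the level at which the capped time stops.\<close>

lemma phi_top_iff:
  assumes "0 \<le> m" shows "\<phi> m = \<top> \<longleftrightarrow> emeasure D UNIV \<le> ennreal m"
proof
  assume "\<phi> m = \<top>"
  then have "psi \<nu> \<mu>' (real k) \<le> ennreal m" for k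
    using phi_iff[of "real k" m] assms by simp
  then show "emeasure D UNIV \<le> ennreal m"
    unfolding psi_SUP[symmetric] by (intro SUP_least)
next
  assume *: "emeasure D UNIV \<le> ennreal m"
  have "\<phi> m = \<top> \<longleftrightarrow> True"
  proof -
    have "ennreal y \<le> \<phi> m \<longleftrightarrow> ennreal y \<le> \<top>" if "0 \<le> y" for y
      using phi_iff[of y m] psi_le_total[of y] * assms that by (auto intro: order_trans)
    then show ?thesis using ennreal_eqI_real[of "\<phi> m" \<top>] by blast
  qed
  then show "\<phi> m = \<top>" by simp
qed

lemma phi_pos:
  assumes "0 < x" shows "0 < \<phi> x"
proof (cases "ennreal x < emeasure D UNIV")
  case True
  then obtain u where u: "\<sigma> \<le> u" "u < 1" "G u = x"
    using G_attains[of x] assms by auto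
  have "u \<noteq> \<sigma>" using u assms G_a by auto
  then show ?thesis
    using phi_G[of u] u q_pos[of u] by simp
next
  case False
  then show ?thesis using phi_top_iff[of x] assms by auto
qed

text \<open>The boundary is finite exactly on the local times in the range of \<open>G\<close>,
  where the substitution m = \<open>G u\<close> replaces it by the quantile.\<close>

lemma nn_integral_phi:
  assumes [measurable]: "k \<in> borel_measurable borel"
  shows "(\<integral>\<^sup>+m. k (\<phi> m) * indicator {m. 0 \<le> m \<and> \<phi> m < \<top>} m \<partial>lborel) =
    (\<integral>\<^sup>+u. k (ennreal (q u)) * (f u * indicator {\<sigma><..<1} u) \<partial>lborel)"
proof -
  have "(\<integral>\<^sup>+m. k (\<phi> m) * indicator {m. 0 \<le> m \<and> \<phi> m < \<top>} m \<partial>lborel) =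
      (\<integral>\<^sup>+m. k (\<phi> m) * indicator {m. 0 \<le> m \<and> ennreal m < emeasure D UNIV} m \<partial>lborel)"
  proof (intro nn_integral_cong)
    fix m
    show "k (\<phi> m) * indicator {m. 0 \<le> m \<and> \<phi> m < \<top>} m = k (\<phi> m) * indicator {m. 0 \<le> m \<and> ennreal m < emeasure D UNIV} m"
      using phi_top_iff[of m] less_top[of "\<phi> m"] by (auto simp: indicator_def not_le)
  qed
  also have "\<dots> = (\<integral>\<^sup>+u. k (\<phi> (G u)) * (f u * indicator {\<sigma><..<1} u) \<partial>lborel)"
    by (rule nn_integral_G) measurable
  also have "\<dots> = (\<integral>\<^sup>+u. k (ennreal (q u)) * (f u * indicator {\<sigma><..<1} u) \<partial>lborel)"
    by (intro nn_integral_cong) (auto simp: indicator_def phi_G)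
  finally show ?thesis .
qed

section \<open>Expected numbers of crossings\<close>

text \<open>The expected number of excursions that end at or above the boundary, counted at the
  local times where the boundary is below y.\<close>

definition level_mass :: "ennreal \<Rightarrow> ennreal" where
  "level_mass y = (\<integral>\<^sup>+m. emeasure \<nu> {enn2real (\<phi> m)..} * indicator {m. 0 \<le> m \<and> \<phi> m < y} m \<partial>lborel)"

text \<open>After the substitution the tail of \<nu> cancels against the denominator of
  \<open>f\<close>. For y = \<open>\<top>\<close> all crossings are counted and their expected
  number is \<open>- ln \<sigma>\<close>, infinite exactly when there is no mass at 0.\<close>

lemma level_mass_eq:
  assumes "y = \<top> \<or> (\<exists>r>0. y = ennreal r)"
  shows "level_mass y = ln_ratio 1 (ennreal (if y = \<top> then \<sigma> else 1 + \<sigma> - prob {..<enn2real y}))"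
proof -
  define p where "p = (if y = \<top> then 1 else prob {..<enn2real y})"
  have p: "\<sigma> \<le> p" "p \<le> 1"
    using assms \<sigma>_le \<sigma>_bounds by (auto simp: p_def)
  have "level_mass y = (\<integral>\<^sup>+m. (emeasure \<nu> {enn2real (\<phi> m)..} * indicator {..<y} (\<phi> m)) * indicator {m. 0 \<le> m \<and> \<phi> m < \<top>} m \<partial>lborel)"
    unfolding level_mass_def by (intro nn_integral_cong) (auto simp: indicator_def not_less top_unique)
  also have "\<dots> = (\<integral>\<^sup>+u. (emeasure \<nu> {enn2real (ennreal (q u))..} * indicator {..<y} (ennreal (q u))) * (f u * indicator {\<sigma><..<1} u) \<partial>lborel)"
    by (rule nn_integral_phi) measurable
  also have "\<dots> = (\<integral>\<^sup>+u. ennreal (1 / ((1 + \<sigma>) - u)) * indicator {\<sigma><..<p} u \<partial>lborel)"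
  proof (intro nn_integral_cong)
    fix u
    have "ennreal (q u) < y \<longleftrightarrow> u < p" if "\<sigma> < u" "u < 1"
      using that assms q_less_iff[of u "enn2real y"] \<sigma>_bounds q_nonneg[of u]
      by (auto simp: p_def ennreal_less_iff)
    moreover have "emeasure \<nu> {q u..} * f u = ennreal (1 / ((1 + \<sigma>) - u))" if "\<sigma> < u" "u < 1"
    proof -
      have "f u * emeasure \<nu> {q u..} = ennreal (1 / ((1 + \<sigma>) - u)) * (emeasure \<nu> {q u..} / emeasure \<nu> {q u..})"
        unfolding f_def by (rule ennreal_divide_times)
      then show ?thesis
        using \<nu>_q[OF that] by (simp add: mult.commute)
    qed
    ultimately show "(emeasure \<nu> {enn2real (ennreal (q u))..} * indicator {..<y} (ennreal (q u))) * (f u * indicator {\<sigma><..<1} u)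
      = ennreal (1 / ((1 + \<sigma>) - u)) * indicator {\<sigma><..<p} u"
      using p q_nonneg[of u] by (auto simp: indicator_def)
  qed
  also have "\<dots> = ln_ratio (ennreal (1 + \<sigma> - \<sigma>)) (ennreal (1 + \<sigma> - p))"
    using p \<sigma>_bounds by (intro nn_integral_reciprocal) auto
  also have "1 + \<sigma> - p = (if y = \<top> then \<sigma> else 1 + \<sigma> - prob {..<enn2real y})"
    by (simp add: p_def)
  finally show ?thesis by simp
qed

text \<open>Split at a height y: the crossings where the boundary is below y have total mass
  \<open>level_mass y\<close>, while those at a boundary of at least y need excursions of height y,
  of which at most l times the tail of \<nu> at y are expected.\<close>

lemma level_mass_locally_finite:
  "(\<integral>\<^sup>+m. emeasure \<nu> {enn2real (\<phi> m)..} * indicator {m. 0 \<le> m \<and> m \<le> l \<and> \<phi> m < \<top>} m \<partial>lborel) < \<top>"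
proof -
  \<comment> \<open>Keeps the tail of the shifted law at y positive, so that its logarithm is
    finite. With mass at 0 any y does; without it, a y close to 0.\<close>
  obtain y where y: "0 < y" "prob {..<y} < 1 + \<sigma>"
  proof (cases "\<sigma> = 0")
    case True
    then show ?thesis
      using prob_lessThan_right[of 0 1] prob_atMost_0 that by auto
  next
    case False
    then have "prob {..<1} < 1 + \<sigma>"
      using \<sigma>_bounds prob_le_1[of "{..<1}"] by linarith
    then show ?thesis using that[of 1] by simp
  qed
  have "level_mass (ennreal y) < \<top>"
    using y by (subst level_mass_eq) (auto simp: ln_ratio_def ennreal_eq_0_iff)
  moreover have "(\<integral>\<^sup>+m. emeasure \<nu> {y..} * indicator {0..l} m \<partial>lborel) < \<top>"
    using \<nu>_finite[OF y(1)] by (subst nn_integral_cmult_indicator) (auto simp: ennreal_mult_less_top emeasure_lborel_Icc_eq)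
  moreover have "(\<integral>\<^sup>+m. emeasure \<nu> {enn2real (\<phi> m)..} * indicator {m. 0 \<le> m \<and> m \<le> l \<and> \<phi> m < \<top>} m \<partial>lborel) \<le>
    (\<integral>\<^sup>+m. emeasure \<nu> {enn2real (\<phi> m)..} * indicator {m. 0 \<le> m \<and> \<phi> m < ennreal y} m + emeasure \<nu> {y..} * indicator {0..l} m \<partial>lborel)"
  proof (rule nn_integral_mono)
    fix m :: real
    show "emeasure \<nu> {enn2real (\<phi> m)..} * indicator {m. 0 \<le> m \<and> m \<le> l \<and> \<phi> m < \<top>} m \<le>
      emeasure \<nu> {enn2real (\<phi> m)..} * indicator {m. 0 \<le> m \<and> \<phi> m < ennreal y} m + emeasure \<nu> {y..} * indicator {0..l} m"
    proof (cases "0 \<le> m \<and> m \<le> l \<and> \<phi> m < \<top> \<and> \<not> \<phi> m < ennreal y")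
      case True
      then obtain r where "\<phi> m = ennreal r" "0 \<le> r" by (cases "\<phi> m") auto
      then have "y \<le> enn2real (\<phi> m)"
        using True y by (auto simp: ennreal_less_iff)
      then have "emeasure \<nu> {enn2real (\<phi> m)..} \<le> emeasure \<nu> {y..}"
        by (intro emeasure_mono) auto
      then show ?thesis using True by (auto simp: indicator_def)
    next
      case False
      then show ?thesis by (auto simp: indicator_def)
    qed
  qed
  moreover have "\<dots> = level_mass (ennreal y) + (\<integral>\<^sup>+m. emeasure \<nu> {y..} * indicator {0..l} m \<partial>lborel)"
    unfolding level_mass_def by (rule nn_integral_add) measurable
  ultimately show ?thesis
    by (simp add: le_less_trans)
qed

text \<open>At a non-atom only the single level \<open>prob {..<y}\<close> can be sent to y, and the
  substitution carries this null set over to local times.\<close>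

lemma phi_level_null:
  assumes "prob {y} = 0"
  shows "emeasure lborel {m. 0 \<le> m \<and> \<phi> m = ennreal y} = 0"
proof -
  have "emeasure lborel {m. 0 \<le> m \<and> \<phi> m = ennreal y} = (\<integral>\<^sup>+m. indicator {ennreal y} (\<phi> m) * indicator {m. 0 \<le> m \<and> \<phi> m < \<top>} m \<partial>lborel)"
  proof -
    have "(\<integral>\<^sup>+m. indicator {ennreal y} (\<phi> m) * indicator {m. 0 \<le> m \<and> \<phi> m < \<top>} m \<partial>lborel) =
      (\<integral>\<^sup>+m. indicator {m. 0 \<le> m \<and> \<phi> m = ennreal y} m \<partial>lborel)"
      by (intro nn_integral_cong) (auto simp: indicator_def)
    then show ?thesis by simp
  qed
  also have "\<dots> = (\<integral>\<^sup>+u. indicator {ennreal y} (ennreal (q u)) * (f u * indicator {\<sigma><..<1} u) \<partial>lborel)"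
    by (rule nn_integral_phi) measurable
  also have "\<dots> = (\<integral>\<^sup>+u. 0 \<partial>(lborel :: real measure))"
  proof (rule nn_integral_cong_AE)
    show "AE u in lborel. indicator {ennreal y} (ennreal (q u)) * (f u * indicator {\<sigma><..<1} u) = 0"
      using AE_lborel_singleton[of "prob {..<y}"]
    proof eventually_elim
      case (elim u)
      show ?case
      proof (cases "\<sigma> < u \<and> u < 1 \<and> ennreal (q u) = ennreal y")
        case True
        then have "q u = y" using q_pos[of u] by (metis ennreal_inj ennreal_neg ennreal_eq_0_iff less_eq_real_def not_less linorder_le_cases)
        then show ?thesis
          using q_between[of u] True \<sigma>_bounds elim prob_atMost[of y] assms by auto
      qed (auto simp: indicator_def)
    qed
  qed
  finally show ?thesis by simp
qed

text \<open>On the levels above \<sigma>, \<open>1 + \<sigma> - u\<close> is at least \<sigma>, so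
  \<open>f\<close> is at most \<open>1 / \<sigma>\<close> times the reciprocal tail; the quantile
  transform recognises the integral over \<mu>.\<close>

lemma total_finite:
  assumes "0 < \<sigma>" "(\<integral>\<^sup>+y\<in>{0<..}. 1 / emeasure \<nu> {y..} \<partial>\<mu>) < \<top>"
  shows "emeasure D UNIV < \<top>"
proof -
  have "emeasure D UNIV \<le> (\<integral>\<^sup>+u. ennreal (1 / \<sigma>) * (1 / emeasure \<nu> {q u..} * indicator {0<..} (q u) * indicator {0<..<1} u) \<partial>lborel)"
  proof (subst emeasure_D, simp, rule nn_integral_mono)
    fix u
    show "f u * indicator {\<sigma><..<1} u * indicator UNIV u \<le>
      ennreal (1 / \<sigma>) * (1 / emeasure \<nu> {q u..} * indicator {0<..} (q u) * indicator {0<..<1} u)"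
    proof (cases "\<sigma> < u \<and> u < 1")
      case True
      then have "1 / (1 + \<sigma> - u) \<le> 1 / \<sigma>"
        using assms by (intro divide_left_mono) auto
      then have "f u \<le> ennreal (1 / \<sigma>) / emeasure \<nu> {q u..}"
        unfolding f_def by (intro divide_right_mono_ennreal ennreal_leI)
      then show ?thesis
        using True q_pos[of u] assms by (simp add: indicator_def ennreal_times_divide)
    qed (auto simp: indicator_def)
  qed
  also have "\<dots> = ennreal (1 / \<sigma>) * (\<integral>\<^sup>+u. 1 / emeasure \<nu> {q u..} * indicator {0<..} (q u) * indicator {0<..<1} u \<partial>lborel)"
    by (rule nn_integral_cmult) measurable
  also have "(\<integral>\<^sup>+u. 1 / emeasure \<nu> {q u..} * indicator {0<..} (q u) * indicator {0<..<1} u \<partial>lborel) =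
      (\<integral>\<^sup>+y\<in>{0<..}. 1 / emeasure \<nu> {y..} \<partial>\<mu>)"
    by (rule nn_integral_\<mu>[symmetric]) measurable
  also have "ennreal (1 / \<sigma>) * \<dots> < \<top>"
    using assms by (simp add: ennreal_mult_less_top)
  finally show ?thesis .
qed

text \<open>The two laws treat only the point 0 differently. The first claim is therefore the case
  \<sigma> = 0 of the analysis of the shifted law.\<close>

lemma extend_law_eq:
  assumes "\<sigma> = 0" shows "extend_law \<mu> = \<mu>'"
  unfolding extend_law_def shift_zero_mass_def
proof (rule distr_cong_AE)
  show "AE x in \<mu>. ennreal x = (if x = 0 then \<top> else ennreal x)"
  proof (rule AE_I[where N="{0}"])
    show "emeasure \<mu> {0} = 0" using assms by (simp add: \<sigma>_def emeasure_eq_measure)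
  qed auto
qed (auto cong: measurable_cong_sets)

end

section \<open>Excursions of a single path\<close>

lemma lifetime_excursion:
  assumes "\<epsilon> \<in> excursion_paths z"
  shows "0 < lifetime z \<epsilon>" "0 \<le> s \<Longrightarrow> \<epsilon> s = z \<longleftrightarrow> s = 0 \<or> lifetime z \<epsilon> \<le> s"
proof -
  obtain v where v: "v > 0" "\<forall>s\<ge>0. \<epsilon> s = z \<longleftrightarrow> s = 0 \<or> v \<le> s"
    using assms by (auto simp: excursion_paths_def)
  have "lifetime z \<epsilon> = v"
    unfolding lifetime_def
  proof (rule the_equality)
    fix w assume w: "0 < w \<and> (\<forall>s\<ge>0. \<epsilon> s = z \<longleftrightarrow> s = 0 \<or> w \<le> s)"
    then have "w = 0 \<or> v \<le> w" "v = 0 \<or> w \<le> v" using v by (metis less_imp_le order_refl)+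
    then show "w = v" using v w by auto
  qed (use v in auto)
  with v show "0 < lifetime z \<epsilon>" "0 \<le> s \<Longrightarrow> \<epsilon> s = z \<longleftrightarrow> s = 0 \<or> lifetime z \<epsilon> \<le> s"
    by auto
qed

text \<open>Collects the almost sure properties of one path, so that everything about times and
  excursions becomes deterministic and exceptional sets are dealt with once.\<close>

locale good_path =
  fixes X :: "real \<Rightarrow> 'a \<Rightarrow> 'e::polish_space" and z :: 'e and L :: "real \<Rightarrow> 'a \<Rightarrow> real"
    and U :: "(real \<Rightarrow> 'e) set" and F :: "(real \<Rightarrow> 'e) \<Rightarrow> real \<Rightarrow> real" and \<omega> :: 'a
  assumes L_0: "L 0 \<omega> = 0"
    and L_mono_on: "mono_on {0..} (\<lambda>t. L t \<omega>)"
    and L_continuous: "continuous_on {0..} (\<lambda>t. L t \<omega>)"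
    and L_exceeds: "\<exists>t\<ge>0. l < L t \<omega>"
    and U_paths: "U \<subseteq> excursion_paths z"
    and excursion_in_U: "0 \<le> l \<Longrightarrow> excursion_process X z L l \<omega> = None \<or> excursion_process X z L l \<omega> \<in> Some ` U"
    and F_mono: "\<epsilon> \<in> U \<Longrightarrow> mono_on {0..} (F \<epsilon>)"
    and F_continuous: "\<epsilon> \<in> U \<Longrightarrow> continuous_on {0..} (F \<epsilon>)"
    and F_0: "\<epsilon> \<in> U \<Longrightarrow> F \<epsilon> 0 = 0"
begin

abbreviation e :: "real \<Rightarrow> (real \<Rightarrow> 'e) option" where
  "e l \<equiv> excursion_process X z L l \<omega>"

abbreviation Y :: "real \<Rightarrow> real" where
  "Y t \<equiv> functional_process F X z L t \<omega>"

lemma L_mono: "0 \<le> s \<Longrightarrow> s \<le> t \<Longrightarrow> L s \<omega> \<le> L t \<omega>"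
  using mono_onD[OF L_mono_on, of s t] by auto

lemma L_nonneg: "0 \<le> s \<Longrightarrow> 0 \<le> L s \<omega>"
  using L_mono[of 0 s] L_0 by simp

text \<open>If L has passed l at time s, continuity gives an earlier time with an intermediate
  value; so the first passage is strictly before s.\<close>

lemma inverse_local_time_ge_iff:
  assumes "0 \<le> s" "0 \<le> l"
  shows "ennreal s \<le> inverse_local_time L l \<omega> \<longleftrightarrow> L s \<omega> \<le> l"
proof
  assume "L s \<omega> \<le> l"
  then show "ennreal s \<le> inverse_local_time L l \<omega>"
    unfolding inverse_local_time_def le_first_time_iff
    using L_mono by (metis ennreal_leI linorder_le_cases not_le order_trans)
next
  assume *: "ennreal s \<le> inverse_local_time L l \<omega>"
  show "L s \<omega> \<le> l"
  proof (rule ccontr)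
    assume n: "\<not> L s \<omega> \<le> l"
    then obtain m where m: "l < m" "m < L s \<omega>" using dense[of l "L s \<omega>"] by auto
    have "\<exists>w\<ge>0. w \<le> s \<and> L w \<omega> = m"
      using IVT'[of "\<lambda>t. L t \<omega>" 0 m s] m assms L_0 continuous_on_subset[OF L_continuous, of "{0..s}"] by auto
    then obtain w where w: "0 \<le> w" "w \<le> s" "L w \<omega> = m" by auto
    then have "w < s" using m by (cases "w = s") auto
    have "inverse_local_time L l \<omega> \<le> ennreal w"
      unfolding inverse_local_time_def using w m by (intro first_time_le) auto
    with * have "ennreal s \<le> ennreal w" by simp
    then show False using \<open>w < s\<close> w assms by simp
  qed
qed

lemma inverse_local_time_left_le_iff:
  assumes "0 \<le> s" "0 \<le> l"
  shows "inverse_local_time_left L l \<omega> \<le> ennreal s \<longleftrightarrow> l \<le> L s \<omega>"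
proof
  assume "l \<le> L s \<omega>"
  then show "inverse_local_time_left L l \<omega> \<le> ennreal s"
    unfolding inverse_local_time_left_def inverse_local_time_def
    using assms by (intro SUP_least first_time_le) auto
next
  assume *: "inverse_local_time_left L l \<omega> \<le> ennreal s"
  show "l \<le> L s \<omega>"
  proof (rule ccontr)
    assume "\<not> l \<le> L s \<omega>"
    then obtain m where m: "L s \<omega> < m" "m < l" using dense[of "L s \<omega>" l] by auto
    obtain t where t: "0 \<le> t" "m < L t \<omega>" using L_exceeds by blast
    have st: "s \<le> t" using L_mono[of t s] t m assms by (cases "s \<le> t") auto
    have "\<exists>w\<ge>s. w \<le> t \<and> L w \<omega> = m"
      using IVT'[of "\<lambda>t. L t \<omega>" s m t] m t st assms continuous_on_subset[OF L_continuous, of "{s..t}"] by auto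
    then obtain w where w: "s \<le> w" "L w \<omega> = m" by auto
    then have "s < w" using m by (cases "w = s") auto
    have "0 \<le> m" using m L_nonneg[OF assms(1)] by simp
    then have "ennreal w \<le> inverse_local_time L m \<omega>"
      using w assms inverse_local_time_ge_iff[of w m] by simp
    also have "\<dots> \<le> inverse_local_time_left L l \<omega>"
      unfolding inverse_local_time_left_def using m \<open>0 \<le> m\<close> by (intro SUP_upper) auto
    also note *
    finally show False using \<open>s < w\<close> assms by simp
  qed
qed

lemma inverse_local_time_finite: "inverse_local_time L l \<omega> < \<top>"
proof -
  obtain t where "0 \<le> t" "l < L t \<omega>" using L_exceeds by blast
  then have "inverse_local_time L l \<omega> \<le> ennreal t"
    unfolding inverse_local_time_def by (intro first_time_le) auto
  then show ?thesis by (auto intro: le_less_trans)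
qed

definition start :: "real \<Rightarrow> real" where "start l = enn2real (inverse_local_time_left L l \<omega>)"
definition stop :: "real \<Rightarrow> real" where "stop l = enn2real (inverse_local_time L l \<omega>)"

lemma stop_eq: "inverse_local_time L l \<omega> = ennreal (stop l)"
  using inverse_local_time_finite[of l] by (simp add: stop_def)

lemma start_eq:
  assumes "0 \<le> l" shows "inverse_local_time_left L l \<omega> = ennreal (start l)"
proof -
  obtain t where "0 \<le> t" "l < L t \<omega>" using L_exceeds by blast
  then have "inverse_local_time_left L l \<omega> \<le> ennreal t"
    using inverse_local_time_left_le_iff[of t l] assms by auto
  then have "inverse_local_time_left L l \<omega> < \<top>" by (auto intro: le_less_trans)
  then show ?thesis by (simp add: start_def)
qed

lemma start_nonneg: "0 \<le> start l" and stop_nonneg: "0 \<le> stop l"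
  by (auto simp: start_def stop_def)

lemma start_le_iff: "0 \<le> s \<Longrightarrow> 0 \<le> l \<Longrightarrow> start l \<le> s \<longleftrightarrow> l \<le> L s \<omega>"
  using inverse_local_time_left_le_iff[of s l] start_eq[of l] by simp

lemma le_stop_iff: "0 \<le> s \<Longrightarrow> 0 \<le> l \<Longrightarrow> s \<le> stop l \<longleftrightarrow> L s \<omega> \<le> l"
  using inverse_local_time_ge_iff[of s l] stop_eq[of l] stop_nonneg[of l] by simp

lemma L_eq_iff: "0 \<le> s \<Longrightarrow> 0 \<le> l \<Longrightarrow> L s \<omega> = l \<longleftrightarrow> start l \<le> s \<and> s \<le> stop l"
  using start_le_iff[of s l] le_stop_iff[of s l] by auto

lemma L_attains:
  assumes "0 \<le> l" obtains s where "0 \<le> s" "L s \<omega> = l"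
proof -
  obtain t where t: "0 \<le> t" "l < L t \<omega>" using L_exceeds by blast
  have "\<exists>w\<ge>0. w \<le> t \<and> L w \<omega> = l"
    using IVT'[of "\<lambda>t. L t \<omega>" 0 l t] t assms L_0 continuous_on_subset[OF L_continuous, of "{0..t}"] by auto
  then show ?thesis using that by auto
qed

lemma start_le_stop: "0 \<le> l \<Longrightarrow> start l \<le> stop l"
  using L_attains[of l] L_eq_iff by (metis order_trans)

lemma L_start: "0 \<le> l \<Longrightarrow> L (start l) \<omega> = l"
  using L_eq_iff[of "start l" l] start_nonneg start_le_stop by auto

lemma start_inj: "0 \<le> l \<Longrightarrow> 0 \<le> l' \<Longrightarrow> start l = start l' \<Longrightarrow> l = l'"
  using L_start by metis

lemma stop_le_start: "0 \<le> l \<Longrightarrow> l < l' \<Longrightarrow> stop l \<le> start l'"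
  using le_stop_iff[of "start l'" l] L_start[of l'] start_nonneg[of l'] by linarith

lemma excursion_None_iff: "0 \<le> l \<Longrightarrow> e l = None \<longleftrightarrow> start l = stop l"
  using start_eq[of l] stop_eq[of l] start_le_stop[of l] start_nonneg[of l]
  by (auto simp: excursion_process_def Let_def ennreal_less_iff)

lemma excursion_Some:
  assumes "0 \<le> l" "e l = Some \<epsilon>"
  shows "\<epsilon> \<in> U" "start l < stop l"
    and "0 \<le> s \<Longrightarrow> \<epsilon> s = (if s \<le> stop l - start l then X (start l + s) \<omega> else z)"
proof -
  show "\<epsilon> \<in> U" using excursion_in_U[OF assms(1)] assms(2) by auto
  show "start l < stop l"
    using excursion_None_iff[OF assms(1)] start_le_stop[OF assms(1)] assms by auto
  assume s: "0 \<le> s"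
  have "ennreal s \<le> ennreal (stop l) - ennreal (start l) \<longleftrightarrow> s \<le> stop l - start l"
    using s start_nonneg start_le_stop[OF assms(1)] by (simp add: ennreal_minus)
  then show "\<epsilon> s = (if s \<le> stop l - start l then X (start l + s) \<omega> else z)"
    using assms s start_eq[OF assms(1)] stop_eq[of l] start_nonneg[of l]
    by (auto simp: excursion_process_def Let_def split: if_splits)
qed

lemma lifetime_props:
  assumes "\<epsilon> \<in> U"
  shows "0 < lifetime z \<epsilon>" "0 \<le> s \<Longrightarrow> \<epsilon> s = z \<longleftrightarrow> s = 0 \<or> lifetime z \<epsilon> \<le> s"
  using lifetime_excursion[OF subsetD[OF U_paths assms]] by auto

text \<open>Beyond the interval where the local time equals l the recorded path is \<open>z\<close>
  by definition, so the excursion is over by then. Hence the local time keeps the value l throughout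
  the excursion.\<close>

lemma lifetime_le:
  assumes "0 \<le> l" "e l = Some \<epsilon>"
  shows "start l + lifetime z \<epsilon> \<le> stop l"
proof (rule ccontr)
  assume "\<not> ?thesis"
  then obtain s where s: "stop l - start l < s" "s < lifetime z \<epsilon>"
    using dense[of "stop l - start l" "lifetime z \<epsilon>"] by auto
  note E = excursion_Some[OF assms]
  have "0 < s" using s E(2) by simp
  then have "\<epsilon> s = z" using E(3)[of s] s by simp
  then show False using lifetime_props(2)[OF E(1), of s] \<open>0 < s\<close> s by simp
qed

lemma X_excursion:
  assumes "0 \<le> l" "e l = Some \<epsilon>" "0 \<le> s" "s \<le> stop l - start l"
  shows "X (start l + s) \<omega> = z \<longleftrightarrow> s = 0 \<or> lifetime z \<epsilon> \<le> s"
  using excursion_Some[OF assms(1,2)] lifetime_props(2)[of \<epsilon> s] assms(3,4) by auto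

lemma X_start: "0 \<le> l \<Longrightarrow> e l = Some \<epsilon> \<Longrightarrow> X (start l) \<omega> = z"
  using X_excursion[of l \<epsilon> 0] start_le_stop[of l] by simp

lemma last_zero_excursion:
  assumes "0 \<le> l" "e l = Some \<epsilon>" "0 \<le> s" "s < lifetime z \<epsilon>"
  shows "last_zero X z (start l + s) \<omega> = start l"
  unfolding last_zero_def
proof (rule cSup_eq_maximum)
  show "start l \<in> zero_set X z \<omega> \<inter> {..start l + s}"
    using X_start[OF assms(1,2)] assms start_nonneg by (auto simp: zero_set_def)
  fix t assume t: "t \<in> zero_set X z \<omega> \<inter> {..start l + s}"
  show "t \<le> start l"
  proof (rule ccontr)
    assume "\<not> t \<le> start l"
    moreover have "X t \<omega> = z" "t \<le> start l + s" using t by (auto simp: zero_set_def)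
    ultimately show False
      using X_excursion[OF assms(1,2), of "t - start l"] lifetime_le[OF assms(1,2)] assms(4) by simp
  qed
qed

lemma last_zero_zero: "0 \<le> t \<Longrightarrow> X t \<omega> = z \<Longrightarrow> last_zero X z t \<omega> = t"
  unfolding last_zero_def by (rule cSup_eq_maximum) (auto simp: zero_set_def)

lemma Y_excursion:
  assumes "0 \<le> l" "e l = Some \<epsilon>" "0 \<le> s" "s < lifetime z \<epsilon>"
  shows "Y (start l + s) = F \<epsilon> s" "L (start l + s) \<omega> = l"
proof -
  show L: "L (start l + s) \<omega> = l"
    using L_eq_iff[of "start l + s" l] assms start_nonneg[of l] lifetime_le[OF assms(1,2)] by simp
  show "Y (start l + s) = F \<epsilon> s"
    using L last_zero_excursion[OF assms] assms by (simp add: functional_process_def)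
qed

text \<open>Without an excursion at the current local time the value is 0 by convention; otherwise t
  is itself a zero of X, the excursion has age 0, and \<open>F \<epsilon> 0 = 0\<close>.\<close>

lemma Y_zero:
  assumes "0 \<le> t" "start (L t \<omega>) = t \<or> X t \<omega> = z"
  shows "Y t = 0"
proof (cases "e (L t \<omega>)")
  case None
  then show ?thesis by (simp add: functional_process_def)
next
  case (Some \<epsilon>)
  note E = excursion_Some[OF L_nonneg[OF assms(1)] Some]
  have "X t \<omega> = z"
    using assms X_start[OF L_nonneg[OF assms(1)] Some] by auto
  then show ?thesis
    using Some last_zero_zero[OF assms(1)] F_0[OF E(1)] by (simp add: functional_process_def)
qed

lemma Y_nonzero:
  assumes "0 \<le> t" "start (L t \<omega>) \<noteq> t" "X t \<omega> \<noteq> z"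
  obtains \<epsilon> where "\<epsilon> \<in> U" "e (L t \<omega>) = Some \<epsilon>" "start (L t \<omega>) < t" "t < start (L t \<omega>) + lifetime z \<epsilon>"
    "Y t = F \<epsilon> (t - start (L t \<omega>))"
proof -
  let ?l = "L t \<omega>"
  have l: "0 \<le> ?l" using L_nonneg assms by simp
  have b: "start ?l \<le> t" "t \<le> stop ?l"
    using L_eq_iff[of t ?l] assms l by auto
  then have lt: "start ?l < t" using assms by simp
  then obtain \<epsilon> where \<epsilon>: "e ?l = Some \<epsilon>"
    using excursion_None_iff[OF l] b by (cases "e ?l") auto
  have "t < start ?l + lifetime z \<epsilon>"
    using X_excursion[OF l \<epsilon>, of "t - start ?l"] b assms by auto
  then show ?thesis
    using that[OF excursion_Some(1)[OF l \<epsilon>] \<epsilon> lt] Y_excursion[OF l \<epsilon>, of "t - start ?l"] lt by simp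
qed

lemma Y_0: "Y 0 = 0"
proof (rule Y_zero)
  have "start 0 \<le> 0" using start_le_iff[of 0 0] L_0 by simp
  then show "start (L 0 \<omega>) = 0 \<or> X 0 \<omega> = z" using L_0 start_nonneg[of 0] by simp
qed simp

lemma Y_nonneg: "0 \<le> t \<Longrightarrow> 0 \<le> Y t"
proof -
  assume t: "0 \<le> t"
  show ?thesis
  proof (cases "start (L t \<omega>) = t \<or> X t \<omega> = z")
    case True
    then show ?thesis using Y_zero[OF t] by simp
  next
    case False
    then obtain \<epsilon> where "\<epsilon> \<in> U" "start (L t \<omega>) < t" "Y t = F \<epsilon> (t - start (L t \<omega>))"
      using Y_nonzero[OF t] by metis
    then show ?thesis
      using mono_onD[OF F_mono[of \<epsilon>], of 0 "t - start (L t \<omega>)"] F_0[of \<epsilon>] by simp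
  qed
qed

text \<open>Infinitely many starting times would accumulate at some x, from the left or from the
  right. Each large excursion moves the process from 0 to \<open>y / 2\<close>, which contradicts
  the one-sided limit at x.\<close>

lemma finite_large_excursions:
  assumes right: "\<And>t. 0 \<le> t \<Longrightarrow> continuous (at_right t) Y"
    and left: "\<And>t. 0 < t \<Longrightarrow> \<exists>x. (Y \<longlongrightarrow> x) (at_left t)"
    and y: "0 < y"
  shows "finite {l. 0 \<le> l \<and> l \<le> 1 \<and> (\<exists>\<epsilon>. e l = Some \<epsilon> \<and> y \<le> F \<epsilon> (lifetime z \<epsilon>))}"
proof (rule ccontr)
  define A where "A = {l. 0 \<le> l \<and> l \<le> 1 \<and> (\<exists>\<epsilon>. e l = Some \<epsilon> \<and> y \<le> F \<epsilon> (lifetime z \<epsilon>))}"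
  define P where "P = start ` A"
  assume "infinite {l. 0 \<le> l \<and> l \<le> 1 \<and> (\<exists>\<epsilon>. e l = Some \<epsilon> \<and> y \<le> F \<epsilon> (lifetime z \<epsilon>))}"
  then have inf: "infinite A" by (simp add: A_def)
  have infP: "infinite P"
  proof -
    have "inj_on start A" using start_inj by (auto simp: inj_on_def A_def)
    then show ?thesis using inf finite_imageD unfolding P_def by blast
  qed
  have "start l \<le> start 1" if "l \<in> A" for l
    using start_le_iff[of "start 1" l] that L_start[of 1] start_nonneg by (auto simp: A_def)
  then have "P \<subseteq> {0..start 1}"
    using start_nonneg by (auto simp: P_def)
  then have "bounded P"
    by (rule bounded_subset[OF bounded_closed_interval])
  then obtain x where x: "x islimpt P"
    using bounded_infinite_imp_islimpt[OF subset_refl _ infP] by blast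
  have "0 \<le> x"
  proof -
    have "P \<subseteq> {0..}" using start_nonneg by (auto simp: P_def)
    then have "x islimpt {0..}" by (rule islimpt_subset[OF x])
    then show ?thesis using closed_limpt[of "{0::real..}"] by auto
  qed
  have no: False if I: "infinite (P \<inter> {u<..<w})" and c: "\<And>s. u < s \<Longrightarrow> s < w \<Longrightarrow> \<bar>Y s - c\<bar> < y / 4" for u w c
  proof -
    obtain p where p: "p \<in> P \<inter> {u<..<w}"
      using infinite_imp_nonempty[OF I] by blast
    have "infinite (P \<inter> {u<..<w} - {p})" using I by (rule infinite_remove)
    then obtain p' where p': "p' \<in> P \<inter> {u<..<w} - {p}"
      using infinite_imp_nonempty unfolding ex_in_conv[symmetric] by metis
    \<comment> \<open>The earlier excursion is over before the later one starts, so it stays within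
      the window; there the process takes the values 0 and \<open>y / 2\<close>, which cannot both
      lie within \<open>y / 4\<close> of c.\<close>
    have key: False if pp: "p1 \<in> P \<inter> {u<..<w}" "p2 \<in> P \<inter> {u<..<w}" "p1 < p2" for p1 p2
    proof -
      obtain l1 where l1: "p1 = start l1" "l1 \<in> A" using pp(1) by (auto simp: P_def)
      obtain l2 where l2: "p2 = start l2" "l2 \<in> A" using pp(2) by (auto simp: P_def)
      obtain \<epsilon> where \<epsilon>: "e l1 = Some \<epsilon>" "y \<le> F \<epsilon> (lifetime z \<epsilon>)" using l1 by (auto simp: A_def)
      have l12: "0 \<le> l1" "0 \<le> l2" using l1 l2 by (auto simp: A_def)
      note l1n = l12(1)
      note E = excursion_Some(1)[OF l1n \<epsilon>(1)]
      have "l1 < l2"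
        using start_le_iff[of "start l1" l2] L_start[of l1] pp(3) l1(1) l2(1) l12 start_nonneg[of l1] by simp
      then have "stop l1 \<le> p2" using stop_le_start[of l1 l2] l1n l2(1) by simp
      \<comment> \<open>Half the height is attained strictly before the lifetime, while
        \<open>Y\<close> still follows \<open>F\<close>; the full height might be attained only at
        the end.\<close>
      have "\<exists>s\<ge>0. s \<le> lifetime z \<epsilon> \<and> F \<epsilon> s = y / 2"
        using IVT'[of "F \<epsilon>" 0 "y / 2" "lifetime z \<epsilon>"] F_0[OF E] \<epsilon> y lifetime_props(1)[OF E]
          continuous_on_subset[OF F_continuous[OF E], of "{0..lifetime z \<epsilon>}"] by auto
      then obtain s where s: "0 \<le> s" "s \<le> lifetime z \<epsilon>" "F \<epsilon> s = y / 2" by auto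
      then have s': "s < lifetime z \<epsilon>" using \<epsilon> y by (cases "s = lifetime z \<epsilon>") auto
      have "Y (p1 + s) = y / 2" using Y_excursion(1)[OF l1n \<epsilon>(1) s(1) s'] s l1 by simp
      moreover have "Y p1 = 0"
        using Y_zero[of "start l1"] L_start[OF l1n] start_nonneg[of l1] l1(1) by simp
      moreover have "p1 + s < w"
        using s' lifetime_le[OF l1n \<epsilon>(1)] l1(1) \<open>stop l1 \<le> p2\<close> pp(2) by simp
      ultimately show False
        using c[of p1] c[of "p1 + s"] pp(1) s(1) by simp
    qed
    show False
    proof (cases "p < p'")
      case True
      then show ?thesis using key[of p p'] p p' by blast
    next
      case False
      then have "p' < p" using p' by auto
      then show ?thesis using key[of p' p] p p' by blast
    qed
  qed
  have "(Y \<longlongrightarrow> Y x) (at_right x)"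
    using right[OF \<open>0 \<le> x\<close>] by (simp add: continuous_within)
  then have "\<forall>\<^sub>F s in at_right x. \<bar>Y s - Y x\<bar> < y / 4"
    using y tendstoD[of Y "Y x" "at_right x" "y / 4"] by (simp add: dist_real_def)
  then obtain w where w: "x < w" "\<And>s. x < s \<Longrightarrow> s < w \<Longrightarrow> \<bar>Y s - Y x\<bar> < y / 4"
    unfolding eventually_at_right_field by auto
  have "\<exists>u<x. finite (P \<inter> {u<..<x})"
  proof (cases "x = 0")
    case True
    have "\<not> start l < 0" for l using start_nonneg[of l] by simp
    with True have "P \<inter> {x - 1<..<x} = {}" by (auto simp: P_def)
    then have "finite (P \<inter> {x - 1<..<x})" by simp
    then show ?thesis by (intro exI[of _ "x - 1"]) simp
  next
    case False
    then obtain c where "(Y \<longlongrightarrow> c) (at_left x)" using left[of x] \<open>0 \<le> x\<close> by auto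
    then have "\<forall>\<^sub>F s in at_left x. \<bar>Y s - c\<bar> < y / 4"
      using y tendstoD[of Y c "at_left x" "y / 4"] by (simp add: dist_real_def)
    then obtain u where u: "u < x" "\<And>s. u < s \<Longrightarrow> s < x \<Longrightarrow> \<bar>Y s - c\<bar> < y / 4"
      unfolding eventually_at_left_field by auto
    then have "finite (P \<inter> {u<..<x})" using no[of u x c] by auto
    then show ?thesis using u by auto
  qed
  then obtain u where u: "u < x" "finite (P \<inter> {u<..<x})" by auto
  have fw: "finite (P \<inter> {x<..<w})" using no[of x w "Y x"] w by auto
  define d where "d = min (x - u) (w - x)"
  have "P \<inter> ball x d \<subseteq> (P \<inter> {u<..<x}) \<union> {x} \<union> (P \<inter> {x<..<w})"
    by (auto simp: d_def dist_real_def)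
  then have "finite (P \<inter> ball x d)"
    using u(2) fw by (meson finite.emptyI finite.insertI finite_UnI finite_subset)
  moreover have "0 < d" using u w by (simp add: d_def)
  ultimately show False
    using x by (simp add: islimpt_eq_infinite_ball)
qed

end

section \<open>The first crossing on a single path\<close>

text \<open>Local finiteness provides a first crossing, positivity keeps zeros of the process from
  counting as hits, and \<open>boundary_reached\<close> makes each crossing visible before the
  process drops back to 0.\<close>

locale good_boundary = good_path +
  fixes \<phi> :: "real \<Rightarrow> ennreal"
  assumes boundary_mono: "mono \<phi>"
    and boundary_pos: "0 < l \<Longrightarrow> 0 < \<phi> l"
    and no_excursion_0: "excursion_process X z L 0 \<omega> = None"
    and boundary_reached: "0 \<le> l \<Longrightarrow> excursion_process X z L l \<omega> = Some \<epsilon> \<Longrightarrow> \<phi> l \<le> ennreal (F \<epsilon> (lifetime z \<epsilon>)) \<Longrightarrow>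
      \<exists>s\<ge>0. s < lifetime z \<epsilon> \<and> \<phi> l \<le> ennreal (F \<epsilon> s)"
    and finite_crossings: "finite ({l. 0 \<le> l \<and> (\<exists>\<epsilon>. excursion_process X z L l \<omega> = Some \<epsilon> \<and>
      \<phi> l \<le> ennreal (F \<epsilon> (lifetime z \<epsilon>)))} \<inter> {..l})"
begin

definition crossings :: "real set" where
  "crossings = {l. 0 \<le> l \<and> (\<exists>\<epsilon>. e l = Some \<epsilon> \<and> \<phi> l \<le> ennreal (F \<epsilon> (lifetime z \<epsilon>)))}"

abbreviation T :: ennreal where
  "T \<equiv> boundary_time (functional_process F X z L) L \<phi> \<omega>"

text \<open>The boundary may vanish at local time 0, and then any value would be a hit. As no
  excursion is attached to local time 0, L leaves 0 immediately.\<close>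

lemma L_pos:
  assumes "0 < t" shows "0 < L t \<omega>"
proof -
  have "start 0 = 0" using start_le_iff[of 0 0] L_0 start_nonneg[of 0] by simp
  then have "stop 0 = 0"
    using excursion_None_iff[of 0] no_excursion_0 by simp
  then show ?thesis
    using le_stop_iff[of t 0] assms by auto
qed

lemma hit_crossing:
  assumes "0 < t" "\<phi> (L t \<omega>) \<le> ennreal (Y t)"
  obtains \<epsilon> where "L t \<omega> \<in> crossings" "e (L t \<omega>) = Some \<epsilon>" "start (L t \<omega>) < t" "t < start (L t \<omega>) + lifetime z \<epsilon>"
    "Y t = F \<epsilon> (t - start (L t \<omega>))"
proof -
  have "0 < ennreal (Y t)"
    using boundary_pos[OF L_pos[OF assms(1)]] assms(2) by (rule less_le_trans)
  then have "Y t \<noteq> 0" by auto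
  then have "start (L t \<omega>) \<noteq> t" "X t \<omega> \<noteq> z"
    using Y_zero[of t] assms by auto
  then obtain \<epsilon> where \<epsilon>: "\<epsilon> \<in> U" "e (L t \<omega>) = Some \<epsilon>" "start (L t \<omega>) < t" "t < start (L t \<omega>) + lifetime z \<epsilon>"
    "Y t = F \<epsilon> (t - start (L t \<omega>))"
    using Y_nonzero[of t] assms by (metis less_imp_le)
  have "F \<epsilon> (t - start (L t \<omega>)) \<le> F \<epsilon> (lifetime z \<epsilon>)"
    using \<epsilon> by (intro mono_onD[OF F_mono]) auto
  then have "\<phi> (L t \<omega>) \<le> ennreal (F \<epsilon> (lifetime z \<epsilon>))"
    using assms(2) \<epsilon> by (auto intro: order_trans ennreal_leI)
  then have "L t \<omega> \<in> crossings"
    using \<epsilon> L_nonneg[of t] assms by (auto simp: crossings_def)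
  then show ?thesis using that \<epsilon> by blast
qed

lemma boundary_time_top:
  assumes "crossings = {}" shows "T = \<top>"
proof -
  have "False" if "0 < t" "\<phi> (L t \<omega>) \<le> ennreal (Y t)" for t
    by (rule hit_crossing[OF that]) (simp add: assms)
  then have "\<top> \<le> T"
    unfolding boundary_time_def le_first_time_iff by blast
  then show ?thesis by (simp add: top_unique)
qed

definition first_level :: real where "first_level = Inf crossings"

text \<open>Below any given crossing there are finitely many others, so the infimum is a
  minimum.\<close>

lemma first_level:
  assumes "crossings \<noteq> {}"
  shows "first_level \<in> crossings" "l \<in> crossings \<Longrightarrow> first_level \<le> l"
proof -
  have bdd: "bdd_below crossings" by (rule bdd_belowI[of _ 0]) (auto simp: crossings_def)
  show 1: "first_level \<le> l" if "l \<in> crossings" for l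
    unfolding first_level_def using that bdd by (rule cInf_lower)
  obtain k where k: "k \<in> crossings" using assms by auto
  let ?C = "crossings \<inter> {..k}"
  have fin: "finite ?C" using finite_crossings[of k] by (simp add: crossings_def)
  have "?C \<noteq> {}" using k by auto
  then have m: "Min ?C \<in> ?C" using fin by (rule Min_in[rotated])
  have "Min ?C \<le> l" if "l \<in> crossings" for l
    using that Min_le[OF fin, of l] m by (cases "l \<le> k") auto
  then have "Min ?C \<le> first_level"
    unfolding first_level_def using assms by (intro cInf_greatest)
  moreover have "first_level \<le> Min ?C" using 1 m by blast
  ultimately show "first_level \<in> crossings" using m by auto
qed

text \<open>Before t the process is compared with the final boundary value, not only with the
  current one; this strict inequality serves the supremum and minimality claims. The right
  neighbourhood in the last clause makes the hitting time detectable at rational times.\<close>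

lemma boundary_time_crossing:
  assumes "crossings \<noteq> {}"
  obtains t where "0 < t" "T = ennreal t" "L t \<omega> = first_level" "ennreal (Y t) = \<phi> first_level"
    "\<And>s. 0 \<le> s \<Longrightarrow> s < t \<Longrightarrow> ennreal (Y s) < \<phi> first_level"
    "\<exists>w>t. \<forall>s. t \<le> s \<longrightarrow> s < w \<longrightarrow> \<phi> (L s \<omega>) \<le> ennreal (Y s)"
proof -
  let ?l = first_level
  obtain \<epsilon> where l: "0 \<le> ?l" "e ?l = Some \<epsilon>" "\<phi> ?l \<le> ennreal (F \<epsilon> (lifetime z \<epsilon>))"
    using first_level(1)[OF assms] by (auto simp: crossings_def)
  note E = excursion_Some(1)[OF l(1,2)]
  have lpos: "0 < ?l" using l no_excursion_0 by (cases "?l = 0") auto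
  obtain s1 where s1: "0 \<le> s1" "s1 < lifetime z \<epsilon>" "\<phi> ?l \<le> ennreal (F \<epsilon> s1)"
    using boundary_reached[OF l] by auto
  then have "\<phi> ?l < \<top>" by (auto intro: le_less_trans)
  then obtain r where r: "\<phi> ?l = ennreal r" "0 \<le> r" by (cases "\<phi> ?l") auto
  have rpos: "0 < r" using boundary_pos[OF lpos] r by simp
  have F1: "r \<le> F \<epsilon> s1" using s1(3) r rpos by (simp add: ennreal_le_iff2)
  have cont: "continuous_on {0..s1} (F \<epsilon>)"
    by (rule continuous_on_subset[OF F_continuous[OF E]]) auto
  \<comment> \<open>\<open>F \<epsilon>\<close> may have a plateau at height r; the least point of
    the compact level set is its beginning, before which \<open>F \<epsilon>\<close> is strictly
    below r.\<close>
  let ?S = "{0..s1} \<inter> F \<epsilon> -` {r}"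
  have "closed ?S" using cont by (intro continuous_closed_preimage) auto
  then have "compact ?S" by (simp add: compact_eq_bounded_closed bounded_Int)
  moreover have "\<exists>s\<ge>0. s \<le> s1 \<and> F \<epsilon> s = r"
    using IVT'[of "F \<epsilon>" 0 r s1] F_0[OF E] F1 r s1 cont by auto
  then have "?S \<noteq> {}" by auto
  ultimately have "\<exists>s0\<in>?S. \<forall>s\<in>?S. s0 \<le> s"
    by (rule compact_attains_inf)
  then obtain s0 where s0: "s0 \<in> ?S" "\<And>s. s \<in> ?S \<Longrightarrow> s0 \<le> s"
    by blast
  have s0': "0 \<le> s0" "s0 < lifetime z \<epsilon>" "F \<epsilon> s0 = r" using s0 s1 by auto
  have small: "F \<epsilon> s < r" if "0 \<le> s" "s < s0" for s
  proof -
    have "F \<epsilon> s \<le> r"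
      using mono_onD[OF F_mono[OF E], of s s0] that s0' by auto
    moreover have "F \<epsilon> s \<noteq> r" using s0(2)[of s] that s0(1) by auto
    ultimately show ?thesis by simp
  qed
  define t where "t = start ?l + s0"
  have "s0 \<noteq> 0" using s0'(3) F_0[OF E] rpos by auto
  then have tpos: "0 < t" using s0' start_nonneg[of ?l] by (simp add: t_def)
  have Yt: "Y t = r" "L t \<omega> = ?l"
    using Y_excursion[OF l(1,2) s0'(1,2)] s0' by (auto simp: t_def)
  \<comment> \<open>A hit at w belongs to a crossing. In the first crossing it cannot precede
    \<open>s0\<close>; in any other one the local time is larger, hence so is the time.\<close>
  have ge: "t \<le> w" if w: "0 < w" "\<phi> (L w \<omega>) \<le> ennreal (Y w)" for w
  proof -
    obtain \<epsilon>' where h: "L w \<omega> \<in> crossings" "e (L w \<omega>) = Some \<epsilon>'" "start (L w \<omega>) < w"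
        "Y w = F \<epsilon>' (w - start (L w \<omega>))"
      using hit_crossing[OF w] by blast
    have le: "?l \<le> L w \<omega>" using first_level(2)[OF assms h(1)] .
    show ?thesis
    proof (cases "L w \<omega> = ?l")
      case True
      then have "\<epsilon>' = \<epsilon>" using h l by simp
      have "ennreal r \<le> ennreal (F \<epsilon> (w - start ?l))"
        using w(2) h True r \<open>\<epsilon>' = \<epsilon>\<close> by simp
      then have "r \<le> F \<epsilon> (w - start ?l)"
        using rpos by (simp add: ennreal_le_iff2)
      then have "s0 \<le> w - start ?l"
        using small[of "w - start ?l"] h True by (cases "w - start ?l < s0") auto
      then show ?thesis by (simp add: t_def)
    next
      case False
      then have "L t \<omega> < L w \<omega>" using le Yt by simp
      then show ?thesis using L_mono[of w t] w by (cases "t \<le> w") auto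
    qed
  qed
  have "T = ennreal t"
  proof (rule antisym)
    show "T \<le> ennreal t"
      unfolding boundary_time_def using tpos Yt r by (intro first_time_le) auto
    show "ennreal t \<le> T"
      unfolding boundary_time_def le_first_time_iff using ge ennreal_leI by blast
  qed
  moreover have "ennreal (Y s) < \<phi> ?l" if "0 \<le> s" "s < t" for s
  proof (cases "s = 0")
    case True
    then show ?thesis using Y_0 boundary_pos[OF lpos] by simp
  next
    case False
    then have "\<not> \<phi> (L s \<omega>) \<le> ennreal (Y s)" using ge[of s] that by auto
    \<comment> \<open>Monotonicity of the boundary lifts the bound at the current local time to the
      bound at the first crossing level.\<close>
    moreover have "\<phi> (L s \<omega>) \<le> \<phi> ?l"
      using monoD[OF boundary_mono, of "L s \<omega>" ?l] L_mono[of s t] that Yt by simp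
    ultimately show ?thesis by simp
  qed
  moreover have "\<phi> (L s \<omega>) \<le> ennreal (Y s)" if "t \<le> s" "s < start ?l + lifetime z \<epsilon>" for s
  proof -
    have s: "0 \<le> s - start ?l" "s - start ?l < lifetime z \<epsilon>" using that s0' by (auto simp: t_def)
    have "Y s = F \<epsilon> (s - start ?l)" "L s \<omega> = ?l"
      using Y_excursion[OF l(1,2) s] by auto
    moreover have "r \<le> F \<epsilon> (s - start ?l)"
      using mono_onD[OF F_mono[OF E], of s0 "s - start ?l"] that s0' by (auto simp: t_def)
    ultimately show ?thesis using r by (simp add: ennreal_leI)
  qed
  then have "\<exists>w>t. \<forall>s. t \<le> s \<longrightarrow> s < w \<longrightarrow> \<phi> (L s \<omega>) \<le> ennreal (Y s)"
    using s0' by (intro exI[of _ "start ?l + lifetime z \<epsilon>"]) (auto simp: t_def)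
  moreover have "ennreal (Y t) = \<phi> ?l" using Yt r by simp
  ultimately show ?thesis
    using tpos Yt(2) by (intro that[of t])
qed

lemma boundary_time_less_iff:
  "T < ennreal x \<longleftrightarrow> (\<exists>s\<in>\<rat>. 0 < s \<and> s < x \<and> \<phi> (L s \<omega>) \<le> ennreal (Y s))"
proof
  assume T: "T < ennreal x"
  then have "crossings \<noteq> {}" using boundary_time_top by auto
  then obtain t w where t: "0 < t" "T = ennreal t" "w > t" "\<forall>s. t \<le> s \<longrightarrow> s < w \<longrightarrow> \<phi> (L s \<omega>) \<le> ennreal (Y s)"
    using boundary_time_crossing by metis
  have "t < x" using T t by (simp add: ennreal_less_iff)
  then obtain s where "s \<in> \<rat>" "t < s" "s < min w x"
    using Rats_dense_in_real[of t "min w x"] t by auto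
  then show "\<exists>s\<in>\<rat>. 0 < s \<and> s < x \<and> \<phi> (L s \<omega>) \<le> ennreal (Y s)"
    using t by (intro bexI[of _ s]) auto
next
  assume "\<exists>s\<in>\<rat>. 0 < s \<and> s < x \<and> \<phi> (L s \<omega>) \<le> ennreal (Y s)"
  then obtain s where s: "0 < s" "s < x" "\<phi> (L s \<omega>) \<le> ennreal (Y s)" by auto
  then have "T \<le> ennreal s"
    unfolding boundary_time_def by (intro first_time_le) auto
  also have "\<dots> < ennreal x" using s by (simp add: ennreal_less_iff)
  finally show "T < ennreal x" .
qed

lemma SUP_before_boundary_time:
  assumes "crossings \<noteq> {}"
  shows "(SUP t\<in>{t. 0 \<le> t \<and> ennreal t \<le> T}. ennreal (Y t)) = ennreal (at_time (functional_process F X z L) (boundary_time (functional_process F X z L) L \<phi>) \<omega>)"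
proof -
  obtain t where t: "0 < t" "T = ennreal t" "ennreal (Y t) = \<phi> first_level"
    "\<And>s. 0 \<le> s \<Longrightarrow> s < t \<Longrightarrow> ennreal (Y s) < \<phi> first_level"
    using boundary_time_crossing[OF assms] by metis
  have "(SUP t\<in>{t. 0 \<le> t \<and> ennreal t \<le> T}. ennreal (Y t)) = ennreal (Y t)"
  proof (rule antisym)
    show "(SUP t\<in>{t. 0 \<le> t \<and> ennreal t \<le> T}. ennreal (Y t)) \<le> ennreal (Y t)"
    proof (rule SUP_least)
      fix s assume "s \<in> {t. 0 \<le> t \<and> ennreal t \<le> T}"
      then have "0 \<le> s" "s < t \<or> s = t" using t by auto
      then show "ennreal (Y s) \<le> ennreal (Y t)" using t(3) t(4)[of s] by (auto simp del: ennreal_le_iff)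
    qed
    show "ennreal (Y t) \<le> (SUP t\<in>{t. 0 \<le> t \<and> ennreal t \<le> T}. ennreal (Y t))"
      using t by (intro SUP_upper) auto
  qed
  then show ?thesis using t by (simp add: at_time_def)
qed

end

section \<open>The Poisson point process of excursions\<close>

lemma poisson_random_measure_void:
  assumes "poisson_random_measure M S N" "B \<in> sets S"
  shows "measure M {\<omega>\<in>space M. N \<omega> B = 0} = (if emeasure S B = \<top> then 0 else exp (- measure S B))"
proof (cases "emeasure S B = \<top>")
  case True
  then have "AE \<omega> in M. N \<omega> B = \<top>"
    using assms by (auto simp: poisson_random_measure_def)
  then have "AE \<omega> in M. \<not> N \<omega> B = 0"
    by eventually_elim simp
  moreover have "(\<lambda>\<omega>. N \<omega> B) \<in> borel_measurable M"
    using assms by (auto simp: poisson_random_measure_def)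
  then have "{\<omega>\<in>space M. N \<omega> B = 0} \<in> sets M" by simp
  ultimately have "emeasure M {\<omega>\<in>space M. N \<omega> B = 0} = 0"
    by (subst AE_iff_measurable[symmetric, of "{\<omega>\<in>space M. N \<omega> B = 0}" M "\<lambda>\<omega>. \<not> N \<omega> B = 0"]) auto
  then show ?thesis using True by (simp add: measure_def)
next
  case False
  then have "emeasure S B < \<top>" by (simp add: less_top)
  then have "measure M {\<omega>\<in>space M. N \<omega> B = of_nat 0} = exp (- measure S B) * measure S B ^ 0 / fact 0"
    using assms unfolding poisson_random_measure_def by blast
  then show ?thesis using False by simp
qed

text \<open>The Poisson weights sum to 1, which leaves no probability for an infinite count.\<close>

lemma (in prob_space) poisson_random_measure_finite:
  assumes P: "poisson_random_measure M S N" and B: "B \<in> sets S" and fin: "emeasure S B < \<top>"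
  shows "AE \<omega> in M. N \<omega> B < \<top>"
proof -
  have [measurable]: "(\<lambda>\<omega>. N \<omega> B) \<in> borel_measurable M"
    using P B by (auto simp: poisson_random_measure_def)
  define A where "A k = {\<omega>\<in>space M. N \<omega> B = of_nat k}" for k :: nat
  have A [measurable]: "A k \<in> events" for k unfolding A_def by measurable
  have "measure M (A k) = exp (- measure S B) * measure S B ^ k / fact k" for k
    using P B fin unfolding poisson_random_measure_def A_def by blast
  moreover have "(\<lambda>k. exp (- measure S B) * (measure S B ^ k /\<^sub>R fact k)) sums (exp (- measure S B) * exp (measure S B))"
    by (intro sums_mult exp_converges)
  ultimately have "(\<lambda>k. measure M (A k)) sums 1"
    by (simp add: exp_minus_inverse mult.commute scaleR_conv_of_real divide_inverse mult_ac)
  moreover have "(\<lambda>k. measure M (A k)) sums measure M (\<Union>k. A k)"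
    by (rule finite_measure_UNION) (auto simp: disjoint_family_on_def A_def)
  ultimately have "measure M (\<Union>k. A k) = 1"
    by (metis sums_unique2)
  then have "AE \<omega> in M. \<omega> \<in> (\<Union>k. A k)"
    by (subst AE_in_set_eq_1) auto
  then show ?thesis
    by eventually_elim (auto simp: A_def of_nat_less_top)
qed

text \<open>Completeness lets events that are described only up to null sets inherit
  measurability.\<close>

lemma (in complete_measure) sets_AE_cong:
  assumes A: "A \<in> sets M" and B: "B \<subseteq> space M" and AE: "AE x in M. x \<in> A \<longleftrightarrow> x \<in> B"
  shows "B \<in> sets M" "A - B \<in> null_sets M" "B - A \<in> null_sets M"
proof -
  obtain N where N: "{x\<in>space M. \<not> (x \<in> A \<longleftrightarrow> x \<in> B)} \<subseteq> N" "N \<in> null_sets M"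
    using AE by (auto elim!: AE_E simp: null_setsI)
  have null: "C \<in> null_sets M" if "C \<subseteq> N" for C
    using that N(2) complete[of C N] emeasure_mono[of C N M] by (auto simp: null_sets_def)
  show 1: "A - B \<in> null_sets M" and 2: "B - A \<in> null_sets M"
    using N(1) sets.sets_into_space[OF A] B by (auto intro!: null)
  have "B = (A - (A - B)) \<union> (B - A)" by auto
  then show "B \<in> sets M"
    using A 1 2 by (metis null_setsD2 sets.Diff sets.Un)
qed

text \<open>For each r the event \<open>g x \<le> r\<close> is almost surely contained in
  \<open>f x \<le> r\<close> and has the same probability, so almost surely no rational separates
  the two values.\<close>

lemma (in prob_space) AE_eq_of_le_same_distr:
  fixes f g :: "'a \<Rightarrow> real"
  assumes [measurable]: "f \<in> borel_measurable M" "g \<in> borel_measurable M"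
    and le: "AE x in M. f x \<le> g x" and d: "distr M borel f = distr M borel g"
  shows "AE x in M. f x = g x"
proof -
  have "AE x in M. \<not> (f x \<le> r \<and> r < g x)" for r
  proof -
    have 1: "prob {x\<in>space M. f x \<le> r} = measure (distr M borel f) {..r}"
      by (subst measure_distr) (auto intro!: arg_cong[where f=prob])
    have 2: "prob {x\<in>space M. g x \<le> r} = measure (distr M borel g) {..r}"
      by (subst measure_distr) (auto intro!: arg_cong[where f=prob])
    have "prob ({x\<in>space M. f x \<le> r} - {x\<in>space M. f x \<le> r \<and> g x \<le> r}) =
      prob {x\<in>space M. f x \<le> r} - prob {x\<in>space M. f x \<le> r \<and> g x \<le> r}"
      by (intro finite_measure_Diff) auto
    also have "prob {x\<in>space M. f x \<le> r \<and> g x \<le> r} = prob {x\<in>space M. g x \<le> r}"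
      using le by (intro finite_measure_eq_AE) (auto elim!: eventually_mono)
    also have "prob {x\<in>space M. f x \<le> r} - prob {x\<in>space M. g x \<le> r} = 0"
      using 1 2 d by simp
    finally have "prob ({x\<in>space M. f x \<le> r} - {x\<in>space M. f x \<le> r \<and> g x \<le> r}) = 0" .
    then have "AE x in M. x \<notin> {x\<in>space M. f x \<le> r} - {x\<in>space M. f x \<le> r \<and> g x \<le> r}"
      by (intro AE_not_in) (auto simp: null_sets_def emeasure_eq_measure)
    with AE_space show ?thesis
      by eventually_elim auto
  qed
  then have "AE x in M. \<forall>r\<in>\<rat>. \<not> (f x \<le> r \<and> r < g x)"
    by (intro AE_ball_countable[THEN iffD2]) (auto simp: countable_rat)
  with le show ?thesis
  proof eventually_elim
    case (elim x)
    show ?case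
    proof (rule ccontr)
      assume "f x \<noteq> g x"
      then obtain r where "r \<in> \<rat>" "f x < r" "r < g x"
        using Rats_dense_in_real[of "f x" "g x"] elim by auto
      then show False using elim by auto
    qed
  qed
qed

context excursion_setting begin

abbreviation S :: "(real \<times> (real \<Rightarrow> 'e)) measure" where
  "S \<equiv> restrict_space lborel {0..} \<Otimes>\<^sub>M n"

lemma space_n: "space n = U"
  using sets_eq_imp_space_eq[OF sets_n] U_excursions
  by (auto simp: space_restrict_space space_PiM excursion_paths_def PiE_def)

lemma space_S: "space S = {0..} \<times> U"
  by (simp add: space_pair_measure space_restrict_space space_n)

text \<open>Each local time carries at most one excursion, so local times suffice to record the
  points of the process in B; their order later selects the first crossing.\<close>

definition points :: "(real \<times> (real \<Rightarrow> 'e)) set \<Rightarrow> 'a \<Rightarrow> real set" where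
  "points B \<omega> = {l. 0 \<le> l \<and> (\<exists>\<epsilon>. excursion_process X z L l \<omega> = Some \<epsilon> \<and> (l, \<epsilon>) \<in> B)}"

lemma poisson: "poisson_random_measure M S (\<lambda>\<omega> B. emeasure (count_space UNIV) (points B \<omega>))"
  using excursions_poisson by (simp add: poisson_point_process_def points_def)

lemma count_eq_0_iff: "emeasure (count_space UNIV) (A :: real set) = 0 \<longleftrightarrow> A = {}"
  by (auto simp: emeasure_count_space)

lemma points_empty_measurable: "B \<in> sets S \<Longrightarrow> {\<omega>\<in>space M. points B \<omega> = {}} \<in> sets M"
proof -
  assume "B \<in> sets S"
  then have [measurable]: "(\<lambda>\<omega>. emeasure (count_space UNIV) (points B \<omega>)) \<in> borel_measurable M"
    using poisson by (auto simp: poisson_random_measure_def)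
  have "{\<omega>\<in>space M. emeasure (count_space UNIV) (points B \<omega>) = 0} \<in> sets M" by measurable
  then show ?thesis by (simp only: count_eq_0_iff)
qed

lemma prob_points_empty:
  "B \<in> sets S \<Longrightarrow> prob {\<omega>\<in>space M. points B \<omega> = {}} = (if emeasure S B = \<top> then 0 else exp (- measure S B))"
  using poisson_random_measure_void[OF poisson] by (simp only: count_eq_0_iff)

lemma AE_points_empty:
  assumes "B \<in> sets S" "emeasure S B = 0" shows "AE \<omega> in M. points B \<omega> = {}"
proof -
  have "prob {\<omega>\<in>space M. points B \<omega> = {}} = 1"
    using prob_points_empty[OF assms(1)] assms(2) by (simp add: measure_def)
  then show ?thesis
    using AE_in_set_eq_1[OF points_empty_measurable[OF assms(1)]] by (auto elim: eventually_mono)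
qed

lemma AE_points_finite:
  assumes "B \<in> sets S" "emeasure S B < \<top>" shows "AE \<omega> in M. finite (points B \<omega>)"
  using poisson_random_measure_finite[OF poisson assms]
  by eventually_elim (auto simp: emeasure_count_space split: if_splits)

lemma AE_points_infinite:
  assumes "B \<in> sets S" "emeasure S B = \<top>" shows "AE \<omega> in M. infinite (points B \<omega>)"
proof -
  have "AE \<omega> in M. emeasure (count_space UNIV) (points B \<omega>) = \<top>"
    using poisson assms by (auto simp: poisson_random_measure_def)
  then show ?thesis
    by eventually_elim (auto simp: emeasure_count_space split: if_splits)
qed

lemma emeasure_S:
  assumes "B \<in> sets S"
  shows "emeasure S B = (\<integral>\<^sup>+l. emeasure n (Pair l -` B) * indicator {0..} l \<partial>lborel)"
proof -
  interpret n: sigma_finite_measure n by (rule n_sigma_finite)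
  show ?thesis
    unfolding n.emeasure_pair_measure_alt[OF assms] by (subst nn_integral_restrict_space) auto
qed

end

section \<open>Terminal values, crossings and their Poisson intensities\<close>

locale embedding_setting = excursion_setting M X z K L U n
  for M :: "'a measure" and X :: "real \<Rightarrow> 'a \<Rightarrow> 'e::polish_space" and z K L U n +
  fixes F :: "(real \<Rightarrow> 'e) \<Rightarrow> real \<Rightarrow> real" and \<mu> :: "real measure"
  assumes functional_F: "excursion_functional M X z L U F"
    and positive_F: "positive_functional U F"
    and \<mu>_law: "prob_space \<mu>" "sets \<mu> = sets borel" "emeasure \<mu> {..<0} = 0"
    and tail_pos: "y \<in> measure_support \<mu> \<Longrightarrow> emeasure (characteristic_measure z n F) {y..} > 0"
    and atoms_reached: "measure \<mu> {y} > 0 \<Longrightarrow>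
      AE \<epsilon> in n. F \<epsilon> (lifetime z \<epsilon>) = y \<longrightarrow> (\<exists>s. 0 \<le> s \<and> s < lifetime z \<epsilon> \<and> F \<epsilon> s = y)"
begin

abbreviation \<nu> :: "real measure" where "\<nu> \<equiv> characteristic_measure z n F"

abbreviation FX :: "real \<Rightarrow> 'a \<Rightarrow> real" where "FX \<equiv> functional_process F X z L"

lemma lifetime_pos: "\<epsilon> \<in> U \<Longrightarrow> 0 < lifetime z \<epsilon>"
  by (rule lifetime_excursion(1)[OF subsetD[OF U_excursions]])

lemma F_props:
  assumes "\<epsilon> \<in> U"
  shows "mono_on {0..} (F \<epsilon>)" "continuous_on {0..} (F \<epsilon>)" "F \<epsilon> 0 = 0"
    "lifetime z \<epsilon> \<le> t \<Longrightarrow> F \<epsilon> t = F \<epsilon> (lifetime z \<epsilon>)" "0 < F \<epsilon> (lifetime z \<epsilon>)"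
proof -
  have p: "mono_on {0..} (F \<epsilon>) \<or> antimono_on {0..} (F \<epsilon>)" "continuous_on {0..} (F \<epsilon>)" "F \<epsilon> 0 = 0"
    "\<forall>t\<ge>lifetime z \<epsilon>. F \<epsilon> t = F \<epsilon> (lifetime z \<epsilon>)" "\<bar>F \<epsilon> (lifetime z \<epsilon>)\<bar> > 0"
    using functional_F[unfolded excursion_functional_def, THEN conjunct1, rule_format, OF assms] by blast+
  have "0 \<le> F \<epsilon> (lifetime z \<epsilon>)"
    using positive_F assms lifetime_pos[OF assms] by (simp add: positive_functional_def)
  then show 1: "0 < F \<epsilon> (lifetime z \<epsilon>)" using p(5) by simp
  show "continuous_on {0..} (F \<epsilon>)" "F \<epsilon> 0 = 0" "lifetime z \<epsilon> \<le> t \<Longrightarrow> F \<epsilon> t = F \<epsilon> (lifetime z \<epsilon>)"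
    using p(2,3,4) by blast+
  show "mono_on {0..} (F \<epsilon>)"
    using p(1)
  proof
    assume "antimono_on {0..} (F \<epsilon>)"
    then have "F \<epsilon> (lifetime z \<epsilon>) \<le> F \<epsilon> 0"
      using lifetime_pos[OF assms] by (auto simp: monotone_on_def)
    then show ?thesis using 1 p(3) by simp
  qed
qed

lemma F_vimage_measurable:
  "0 \<le> t \<Longrightarrow> (\<lambda>\<epsilon>. F \<epsilon> t) \<in> borel_measurable (vimage_algebra U (\<lambda>\<epsilon>. restrict \<epsilon> {0..t}) (PiM {0..t} (\<lambda>_. borel)))"
  by (rule functional_F[unfolded excursion_functional_def, THEN conjunct2, THEN conjunct1, rule_format])

lemma F_measurable:
  assumes "0 \<le> t" shows "(\<lambda>\<epsilon>. F \<epsilon> t) \<in> borel_measurable n"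
proof -
  have "(\<lambda>\<epsilon>. restrict \<epsilon> {0..t}) \<in> restrict_space path_space U \<rightarrow>\<^sub>M PiM {0..t} (\<lambda>_. borel :: 'e measure)"
    by (intro measurable_restrict_space1 measurable_restrict_subset) auto
  then have "(\<lambda>\<epsilon>. restrict \<epsilon> {0..t}) \<in> n \<rightarrow>\<^sub>M PiM {0..t} (\<lambda>_. borel :: 'e measure)"
    by (subst measurable_cong_sets[OF sets_n refl])
  then have "(\<lambda>\<epsilon>. \<epsilon>) \<in> n \<rightarrow>\<^sub>M vimage_algebra U (\<lambda>\<epsilon>. restrict \<epsilon> {0..t}) (PiM {0..t} (\<lambda>_. borel))"
    by (intro measurable_vimage_algebra2) (auto simp: space_n)
  from measurable_compose[OF this F_vimage_measurable[OF assms]] show ?thesis by simp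
qed

text \<open>\<open>F \<epsilon>\<close> is constant after the lifetime, so its values at integer
  times converge; measurability of \<open>lifetime\<close> itself does not have to be
  discussed.\<close>

lemma terminal_value_measurable [measurable]: "terminal_value z F \<in> borel_measurable n"
proof (rule borel_measurable_LIMSEQ_real)
  fix \<epsilon> assume "\<epsilon> \<in> space n"
  then have \<epsilon>: "\<epsilon> \<in> U" by (simp add: space_n)
  obtain k :: nat where k: "lifetime z \<epsilon> \<le> real k" using real_arch_simple by blast
  have "\<forall>\<^sub>F i in sequentially. F \<epsilon> (real i) = terminal_value z F \<epsilon>"
    using eventually_ge_at_top[of k]
  proof eventually_elim
    case (elim i)
    then have "lifetime z \<epsilon> \<le> real i" using k by simp
    then show ?case unfolding terminal_value_def by (rule F_props(4)[OF \<epsilon>])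
  qed
  then show "(\<lambda>i. F \<epsilon> (real i)) \<longlonglongrightarrow> terminal_value z F \<epsilon>"
    by (rule tendsto_eventually)
qed (use F_measurable in auto)

lemma emeasure_\<nu>: "emeasure \<nu> {y..} = emeasure n {\<epsilon>\<in>U. y \<le> F \<epsilon> (lifetime z \<epsilon>)}"
proof -
  have "terminal_value z F -` {y..} \<inter> space n = {\<epsilon>\<in>U. y \<le> F \<epsilon> (lifetime z \<epsilon>)}"
    by (auto simp: space_n terminal_value_def)
  then show ?thesis
    unfolding characteristic_measure_def by (subst emeasure_distr) auto
qed

lemma AE_good_path: "AE \<omega> in M. good_path X z L U F \<omega>"
proof -
  have "AE \<omega> in M. \<forall>l\<ge>0. excursion_process X z L l \<omega> = None \<or> excursion_process X z L l \<omega> \<in> Some ` space n"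
    using excursions_poisson by (simp add: poisson_point_process_def)
  with L_paths L_unbounded show ?thesis
  proof eventually_elim
    case (elim \<omega>)
    then show ?case
      using U_excursions F_props(1-3) by unfold_locales (simp_all add: space_n)
  qed
qed

lemma AE_path_regular: "AE \<omega> in M. \<forall>t\<ge>0. continuous (at_right t) (\<lambda>s. FX s \<omega>) \<and>
        (0 < t \<longrightarrow> (\<exists>x. ((\<lambda>s. FX s \<omega>) \<longlongrightarrow> x) (at_left t)))"
  by (rule functional_F[unfolded excursion_functional_def, THEN conjunct2, THEN conjunct2])

text \<open>Infinite mass would put infinitely many excursions of height at least y into the local
  times from 0 to 1, which right-continuity and left limits of the process forbid.\<close>

lemma \<nu>_finite:
  assumes "0 < y" shows "emeasure \<nu> {y..} < \<top>"
proof (rule ccontr)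
  assume "\<not> ?thesis"
  then have top: "emeasure n {\<epsilon>\<in>U. y \<le> F \<epsilon> (lifetime z \<epsilon>)} = \<top>"
    by (simp add: emeasure_\<nu> less_top[symmetric])
  have "{\<epsilon>\<in>space n. y \<le> terminal_value z F \<epsilon>} \<in> sets n" by measurable
  then have s: "{\<epsilon>\<in>U. y \<le> F \<epsilon> (lifetime z \<epsilon>)} \<in> sets n"
    by (simp add: space_n terminal_value_def)
  interpret n: sigma_finite_measure n by (rule n_sigma_finite)
  define B where "B = {0..1::real} \<times> {\<epsilon>\<in>U. y \<le> F \<epsilon> (lifetime z \<epsilon>)}"
  have i: "{0..1} \<in> sets (restrict_space lborel {0::real..})"
    by (auto simp: sets_restrict_space_iff)
  have "emeasure S B = emeasure (restrict_space lborel {0..}) {0..1::real} * \<top>"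
    unfolding B_def using i s top by (subst n.emeasure_pair_measure_Times) auto
  also have "emeasure (restrict_space lborel {0..}) {0..1::real} = 1"
    by (subst emeasure_restrict_space) auto
  finally have BS: "emeasure S B = \<top>" by simp
  have "B \<in> sets S" unfolding B_def using i s by (intro pair_measureI)
  from AE_points_infinite[OF this BS] AE_good_path AE_path_regular
  have "AE \<omega> in M. False"
  proof eventually_elim
    case (elim \<omega>)
    interpret good_path X z L U F \<omega> by fact
    have "finite {l. 0 \<le> l \<and> l \<le> 1 \<and> (\<exists>\<epsilon>. excursion_process X z L l \<omega> = Some \<epsilon> \<and> y \<le> F \<epsilon> (lifetime z \<epsilon>))}"
      using elim assms by (intro finite_large_excursions) auto
    then have "finite (points B \<omega>)"
      by (rule finite_subset[rotated]) (auto simp: points_def B_def)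
    then show False using elim by simp
  qed
  then show False by (simp add: AE_False)
qed

sublocale B: boundary_data \<mu> \<nu>
proof -
  interpret \<mu>: prob_space \<mu> by (rule \<mu>_law)
  show "boundary_data \<mu> \<nu>"
    using \<mu>_law \<nu>_finite tail_pos by unfold_locales (auto simp: characteristic_measure_def)
qed

text \<open>The predicate restricts the local time; it is used to bound the local time or the
  boundary value, or to count all crossings.\<close>

definition crossing_set :: "(real \<Rightarrow> bool) \<Rightarrow> (real \<times> (real \<Rightarrow> 'e)) set" where
  "crossing_set P = {x\<in>space S. P (fst x) \<and> B.\<phi> (fst x) \<le> ennreal (terminal_value z F (snd x))}"

lemma fst_S [measurable]: "fst \<in> borel_measurable S"
  by (rule measurable_compose[OF measurable_fst]) (intro measurable_restrict_space1 measurable_ident_sets, simp)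

lemma crossing_set_measurable:
  assumes [measurable]: "Measurable.pred borel P" shows "crossing_set P \<in> sets S"
  unfolding crossing_set_def by measurable

lemma emeasure_crossing_set:
  assumes [measurable]: "Measurable.pred borel P"
  shows "emeasure S (crossing_set P) = (\<integral>\<^sup>+l. emeasure \<nu> {enn2real (B.\<phi> l)..} * indicator {l. 0 \<le> l \<and> P l \<and> B.\<phi> l < \<top>} l \<partial>lborel)"
  unfolding emeasure_S[OF crossing_set_measurable[OF assms]]
proof (intro nn_integral_cong)
  fix l :: real
  show "emeasure n (Pair l -` crossing_set P) * indicator {0..} l =
      emeasure \<nu> {enn2real (B.\<phi> l)..} * indicator {l. 0 \<le> l \<and> P l \<and> B.\<phi> l < \<top>} l"
  proof (cases "0 \<le> l \<and> P l \<and> B.\<phi> l < \<top>")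
    case True
    then obtain r where r: "B.\<phi> l = ennreal r" "0 \<le> r" by (cases "B.\<phi> l") auto
    have "Pair l -` crossing_set P = {\<epsilon>\<in>U. enn2real (B.\<phi> l) \<le> F \<epsilon> (lifetime z \<epsilon>)}"
      using True r F_props(5) by (auto simp: crossing_set_def space_S terminal_value_def ennreal_le_iff2 intro: less_imp_le)
    then show ?thesis using True by (simp add: emeasure_\<nu>)
  next
    case False
    then have "l < 0 \<or> Pair l -` crossing_set P = {}"
      by (auto simp: crossing_set_def less_top[symmetric] top_unique)
    then show ?thesis using False by (auto simp: indicator_def)
  qed
qed

lemma points_crossing_set:
  assumes "good_path X z L U F \<omega>"
  shows "points (crossing_set P) \<omega> = {l. 0 \<le> l \<and> P l \<and> (\<exists>\<epsilon>. excursion_process X z L l \<omega> = Some \<epsilon> \<and>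
      B.\<phi> l \<le> ennreal (F \<epsilon> (lifetime z \<epsilon>)))}"
proof -
  interpret good_path X z L U F \<omega> by fact
  show ?thesis
    using excursion_Some(1) by (auto simp: points_def crossing_set_def space_S terminal_value_def)
qed

text \<open>A single local time has intensity zero.\<close>

lemma AE_no_excursion_0: "AE \<omega> in M. excursion_process X z L 0 \<omega> = None"
proof -
  interpret n: sigma_finite_measure n by (rule n_sigma_finite)
  have i: "{0} \<in> sets (restrict_space lborel {0::real..})"
    by (auto simp: sets_restrict_space_iff)
  have U: "U \<in> sets n" using sets.top[of n] by (simp add: space_n)
  have "emeasure S ({0} \<times> U) = emeasure (restrict_space lborel {0..}) {0::real} * emeasure n U"
    using i U by (rule n.emeasure_pair_measure_Times)
  also have "emeasure (restrict_space lborel {0..}) {0::real} = 0"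
    by (subst emeasure_restrict_space) auto
  finally have "AE \<omega> in M. points ({0} \<times> U) \<omega> = {}"
    using i U by (intro AE_points_empty pair_measureI) auto
  with AE_good_path show ?thesis
  proof eventually_elim
    case (elim \<omega>)
    interpret good_path X z L U F \<omega> by fact
    show ?case
      using elim excursion_Some(1)[of 0] by (cases "excursion_process X z L 0 \<omega>") (auto simp: points_def)
  qed
qed

text \<open>An excursion may end exactly at the boundary. If the boundary value is an atom of \<open>\<mu>\<close>, it is
  then also attained before the end; otherwise the boundary takes this value on a null set of levels only.\<close>

lemma AE_boundary_reached:
  "AE \<omega> in M. \<forall>l \<epsilon>. 0 \<le> l \<longrightarrow> excursion_process X z L l \<omega> = Some \<epsilon> \<longrightarrow> B.\<phi> l \<le> ennreal (F \<epsilon> (lifetime z \<epsilon>)) \<longrightarrow>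
      (\<exists>s\<ge>0. s < lifetime z \<epsilon> \<and> B.\<phi> l \<le> ennreal (F \<epsilon> s))"
proof -
  interpret n: sigma_finite_measure n by (rule n_sigma_finite)
  interpret lb: sigma_finite_measure "restrict_space lborel {0::real..}"
    by (rule sigma_finite_measure_restrict_space) (auto intro: lborel.sigma_finite_measure_axioms)
  interpret P: pair_sigma_finite "restrict_space lborel {0::real..}" n ..
  define A where "A = {y. B.prob {y} \<noteq> 0}"
  have cA: "countable A" unfolding A_def by (rule B.countable_support)
  have "AE \<epsilon> in n. \<forall>y\<in>A. F \<epsilon> (lifetime z \<epsilon>) = y \<longrightarrow> (\<exists>s. 0 \<le> s \<and> s < lifetime z \<epsilon> \<and> F \<epsilon> s = y)"
    \<comment> \<open>\<mu> has countably many atoms, so one null set of excursions serves all of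
      them.\<close>
    using atoms_reached by (intro AE_ball_countable[THEN iffD2, OF cA] ballI) (auto simp: A_def zero_less_measure_iff)
  then obtain N where N: "N \<in> null_sets n"
    "\<And>\<epsilon>. \<epsilon> \<in> U - N \<Longrightarrow> \<forall>y\<in>A. F \<epsilon> (lifetime z \<epsilon>) = y \<longrightarrow> (\<exists>s. 0 \<le> s \<and> s < lifetime z \<epsilon> \<and> F \<epsilon> s = y)"
    by (auto elim!: AE_E3 simp: space_n)
  have mA: "A \<in> sets borel" using cA by (rule sets.countable[rotated]) auto
  define B1 where "B1 = {x\<in>space S. B.\<phi> (fst x) = ennreal (terminal_value z F (snd x)) \<and> terminal_value z F (snd x) \<notin> A}"
  have B1: "B1 \<in> sets S"
  proof -
    note [measurable] = mA
    show ?thesis unfolding B1_def by measurable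
  qed
  \<comment> \<open>Fubini with the local time integrated first: for a fixed excursion the boundary
    equals its terminal value on a null set of local times, by
    \<open>phi_level_null\<close>.\<close>
  have "emeasure S B1 = (\<integral>\<^sup>+\<epsilon>. emeasure (restrict_space lborel {0..}) ((\<lambda>l. (l, \<epsilon>)) -` B1) \<partial>n)"
    by (rule P.emeasure_pair_measure_alt2[OF B1])
  also have "\<dots> = (\<integral>\<^sup>+\<epsilon>. 0 \<partial>n)"
  proof (rule nn_integral_cong)
    fix \<epsilon> assume "\<epsilon> \<in> space n"
    have "emeasure (restrict_space lborel {0..}) ((\<lambda>l. (l, \<epsilon>)) -` B1) \<le>
        emeasure lborel {l. 0 \<le> l \<and> B.\<phi> l = ennreal (terminal_value z F \<epsilon>)}" if "terminal_value z F \<epsilon> \<notin> A"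
    proof -
      have "(\<lambda>l. (l, \<epsilon>)) -` B1 \<subseteq> {0..}" by (auto simp: B1_def space_S)
      then have "emeasure (restrict_space lborel {0..}) ((\<lambda>l. (l, \<epsilon>)) -` B1) = emeasure lborel ((\<lambda>l. (l, \<epsilon>)) -` B1)"
        by (intro emeasure_restrict_space) auto
      also have "\<dots> \<le> emeasure lborel {l. 0 \<le> l \<and> B.\<phi> l = ennreal (terminal_value z F \<epsilon>)}"
        by (intro emeasure_mono) (auto simp: B1_def space_S)
      finally show ?thesis .
    qed
    moreover have "(\<lambda>l. (l, \<epsilon>)) -` B1 = {}" if "terminal_value z F \<epsilon> \<in> A"
      using that by (auto simp: B1_def)
    ultimately show "emeasure (restrict_space lborel {0..}) ((\<lambda>l. (l, \<epsilon>)) -` B1) = 0"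
      using B.phi_level_null[of "terminal_value z F \<epsilon>"]
      by (cases "terminal_value z F \<epsilon> \<in> A") (auto simp: A_def)
  qed
  finally have 1: "AE \<omega> in M. points B1 \<omega> = {}"
    using B1 by (intro AE_points_empty) auto
  have i: "{0..} \<in> sets (restrict_space lborel {0::real..})"
    by (auto simp: sets_restrict_space_iff)
  have "emeasure S ({0..} \<times> N) = emeasure (restrict_space lborel {0..}) {0::real..} * emeasure n N"
    using i N by (intro n.emeasure_pair_measure_Times) auto
  then have 2: "AE \<omega> in M. points ({0..} \<times> N) \<omega> = {}"
    using i N by (intro AE_points_empty pair_measureI) auto
  from 1 2 AE_good_path show ?thesis
  proof eventually_elim
    case (elim \<omega>)
    interpret good_path X z L U F \<omega> by fact
    show ?case
    proof (intro allI impI)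
      fix l \<epsilon> assume l: "0 \<le> l" "excursion_process X z L l \<omega> = Some \<epsilon>" "B.\<phi> l \<le> ennreal (F \<epsilon> (lifetime z \<epsilon>))"
      have \<epsilon>: "\<epsilon> \<in> U" using excursion_Some(1)[OF l(1,2)] .
      have "\<epsilon> \<notin> N" using elim(2) l by (auto simp: points_def)
      have "(l, \<epsilon>) \<notin> B1" using elim(1) l by (auto simp: points_def)
      show "\<exists>s\<ge>0. s < lifetime z \<epsilon> \<and> B.\<phi> l \<le> ennreal (F \<epsilon> s)"
      proof (cases "B.\<phi> l = ennreal (F \<epsilon> (lifetime z \<epsilon>))")
        case True
        then have "F \<epsilon> (lifetime z \<epsilon>) \<in> A"
          using \<open>(l, \<epsilon>) \<notin> B1\<close> l \<epsilon> by (auto simp: B1_def space_S terminal_value_def)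
        then obtain s where "0 \<le> s" "s < lifetime z \<epsilon>" "F \<epsilon> s = F \<epsilon> (lifetime z \<epsilon>)"
          using N(2)[of \<epsilon>] \<epsilon> \<open>\<epsilon> \<notin> N\<close> by auto
        then show ?thesis using True by auto
      next
        case False
        with l have lt: "B.\<phi> l < ennreal (F \<epsilon> (lifetime z \<epsilon>))" by simp
        then have "B.\<phi> l < \<top>" by (rule less_trans) simp
        then obtain r where r: "B.\<phi> l = ennreal r" "0 \<le> r" by (cases "B.\<phi> l") auto
        have "r < F \<epsilon> (lifetime z \<epsilon>)" using lt r by (simp add: ennreal_less_iff)
        moreover have "\<exists>s\<ge>0. s \<le> lifetime z \<epsilon> \<and> F \<epsilon> s = r"
          using IVT'[of "F \<epsilon>" 0 r "lifetime z \<epsilon>"] F_props(3)[OF \<epsilon>] calculation r lifetime_pos[OF \<epsilon>]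
            continuous_on_subset[OF F_props(2)[OF \<epsilon>], of "{0..lifetime z \<epsilon>}"] by auto
        ultimately obtain s where s: "0 \<le> s" "s \<le> lifetime z \<epsilon>" "F \<epsilon> s = r" "r < F \<epsilon> (lifetime z \<epsilon>)" by auto
        then have "s < lifetime z \<epsilon>" by (cases "s = lifetime z \<epsilon>") auto
        then show ?thesis using s r by (intro exI[of _ s]) simp
      qed
    qed
  qed
qed

lemma AE_finite_crossings:
  "AE \<omega> in M. \<forall>l. finite ({l. 0 \<le> l \<and> (\<exists>\<epsilon>. excursion_process X z L l \<omega> = Some \<epsilon> \<and>
      B.\<phi> l \<le> ennreal (F \<epsilon> (lifetime z \<epsilon>)))} \<inter> {..l})"
proof -
  have "AE \<omega> in M. finite (points (crossing_set (\<lambda>l. l \<le> real k)) \<omega>)" for k :: nat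
  proof (rule AE_points_finite)
    show "crossing_set (\<lambda>l. l \<le> real k) \<in> sets S"
      by (rule crossing_set_measurable) measurable
    show "emeasure S (crossing_set (\<lambda>l. l \<le> real k)) < \<top>"
      using B.level_mass_locally_finite[of "real k"] by (subst emeasure_crossing_set) auto
  qed
  then have "AE \<omega> in M. \<forall>k::nat. finite (points (crossing_set (\<lambda>l. l \<le> real k)) \<omega>)"
    by (simp add: AE_all_countable)
  with AE_good_path show ?thesis
  proof eventually_elim
    case (elim \<omega>)
    show ?case
    proof
      fix l
      obtain k :: nat where "l \<le> real k" using real_arch_simple by blast
      then have "{l. 0 \<le> l \<and> (\<exists>\<epsilon>. excursion_process X z L l \<omega> = Some \<epsilon> \<and>
          B.\<phi> l \<le> ennreal (F \<epsilon> (lifetime z \<epsilon>)))} \<inter> {..l} \<subseteq> points (crossing_set (\<lambda>l. l \<le> real k)) \<omega>"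
        unfolding points_crossing_set[OF elim(1)] by auto
      then show "finite ({l. 0 \<le> l \<and> (\<exists>\<epsilon>. excursion_process X z L l \<omega> = Some \<epsilon> \<and>
          B.\<phi> l \<le> ennreal (F \<epsilon> (lifetime z \<epsilon>)))} \<inter> {..l})"
        using elim(2) finite_subset by blast
    qed
  qed
qed

lemma AE_good_boundary: "AE \<omega> in M. good_boundary X z L U F \<omega> B.\<phi>"
  using AE_good_path AE_no_excursion_0 AE_boundary_reached AE_finite_crossings
proof eventually_elim
  case (elim \<omega>)
  interpret good_path X z L U F \<omega> by fact
  show ?case
    using elim(2-) B.phi_mono B.phi_pos by unfold_locales auto
qed

text \<open>The void probability is the exponential of minus the intensity, which undoes the
  logarithm in \<open>level_mass_eq\<close>. A vanishing tail corresponds to infinite intensity and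
  void probability 0.\<close>

lemma prob_no_crossing_below:
  assumes "y = \<top> \<or> (\<exists>r>0. y = ennreal r)"
  shows "prob {\<omega>\<in>space M. points (crossing_set (\<lambda>l. B.\<phi> l < y)) \<omega> = {}} =
    (if y = \<top> then B.\<sigma> else 1 + B.\<sigma> - B.prob {..<enn2real y})" (is "_ = ?a")
proof -
  have S: "crossing_set (\<lambda>l. B.\<phi> l < y) \<in> sets S"
    by (rule crossing_set_measurable) measurable
  have "emeasure S (crossing_set (\<lambda>l. B.\<phi> l < y)) = B.level_mass y"
  proof -
    have "{l. 0 \<le> l \<and> B.\<phi> l < y \<and> B.\<phi> l < \<top>} = {l. 0 \<le> l \<and> B.\<phi> l < y}"
      by (auto intro: order.strict_trans2[OF _ top_greatest])
    then show ?thesis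
      unfolding B.level_mass_def by (subst emeasure_crossing_set) auto
  qed
  also have "\<dots> = ln_ratio 1 (ennreal ?a)"
    by (rule B.level_mass_eq[OF assms])
  finally have m: "emeasure S (crossing_set (\<lambda>l. B.\<phi> l < y)) = ln_ratio 1 (ennreal ?a)" .
  have a: "0 \<le> ?a" "?a \<le> 1"
    using assms B.\<sigma>_bounds B.\<sigma>_le B.prob_le_1[of "{..<enn2real y}"] by (auto simp del: B.prob_le_1)
  show ?thesis
  proof (cases "?a = 0")
    case True
    then have "emeasure S (crossing_set (\<lambda>l. B.\<phi> l < y)) = \<top>"
      unfolding m by (simp add: ln_ratio_def)
    then show ?thesis using prob_points_empty[OF S] True by simp
  next
    case False
    then have a0: "0 < ?a" using a by simp
    have "emeasure S (crossing_set (\<lambda>l. B.\<phi> l < y)) = ennreal (ln (1 / ?a))"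
      unfolding m using a0 by (simp add: ln_ratio_def)
    moreover have "0 \<le> ln (1 / ?a)" using a a0 by (simp add: ln_div)
    moreover have "exp (- ln (1 / ?a)) = ?a" using a0 by (simp add: ln_div)
    ultimately show ?thesis
      using prob_points_empty[OF S] by (simp add: measure_def)
  qed
qed

text \<open>As the boundary is increasing, the first crossing has the least boundary value, so it is
  below y as soon as some crossing is. The law thus follows from void probabilities alone.
  \<open>R\<close> is kept abstract to serve both the hitting time and the capped time.\<close>

lemma has_law_boundary:
  assumes R: "AE \<omega> in M. if points (crossing_set (\<lambda>_. True)) \<omega> = {} then R \<omega> = 0
    else 0 \<le> R \<omega> \<and> ennreal (R \<omega>) = B.\<phi> (Inf (points (crossing_set (\<lambda>_. True)) \<omega>))"
  shows "has_law M R \<mu>"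
proof -
  let ?V = "\<lambda>y. {\<omega>\<in>space M. points (crossing_set (\<lambda>l. B.\<phi> l < y)) \<omega> = {}}"
  have V: "?V y \<in> sets M" for y
    by (rule points_empty_measurable, rule crossing_set_measurable) measurable
  have main: "{\<omega>\<in>space M. R \<omega> < y} \<in> sets M \<and> prob {\<omega>\<in>space M. R \<omega> < y} = B.prob {..<y}" for y
  proof (cases "0 < y")
    case True
    have VV: "?V \<top> \<subseteq> ?V (ennreal y)"
      by (auto simp: points_def crossing_set_def less_top[symmetric] top_unique)
    \<comment> \<open>The removed event says that there are crossings but none with boundary value
      below y. Paths without any crossing stay in, since \<open>R\<close> is 0 there.\<close>
    have "AE \<omega> in M. \<omega> \<in> space M - (?V (ennreal y) - ?V \<top>) \<longleftrightarrow> \<omega> \<in> {\<omega>\<in>space M. R \<omega> < y}"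
      using R AE_good_boundary AE_space
    proof eventually_elim
      case (elim \<omega>)
      interpret P: good_boundary X z L U F \<omega> B.\<phi> by fact
      have C: "points (crossing_set (\<lambda>_. True)) \<omega> = P.crossings"
        unfolding points_crossing_set[OF P.good_path_axioms] P.crossings_def by simp
      have Cy: "points (crossing_set (\<lambda>l. B.\<phi> l < w)) \<omega> = {l\<in>P.crossings. B.\<phi> l < w}" for w :: ennreal
        unfolding points_crossing_set[OF P.good_path_axioms] P.crossings_def by auto
      have top: "B.\<phi> l < \<top>" if "l \<in> P.crossings" for l
        using that by (auto simp: P.crossings_def intro: le_less_trans)
      show ?case
      proof (cases "P.crossings = {}")
        case True
        then show ?thesis using elim(1,3) \<open>0 < y\<close> by (simp add: C Cy)
      next
        case False
        note fl = P.first_level[OF False]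
        have Rfl: "ennreal (R \<omega>) = B.\<phi> P.first_level" "0 \<le> R \<omega>"
          using elim(1) False unfolding C P.first_level_def by auto
        have "R \<omega> < y \<longleftrightarrow> ennreal (R \<omega>) < ennreal y" by (simp add: ennreal_less_iff[OF Rfl(2)])
        also have "\<dots> \<longleftrightarrow> (\<exists>l\<in>P.crossings. B.\<phi> l < ennreal y)"
          unfolding Rfl using fl monoD[OF B.phi_mono] by (blast intro: le_less_trans)
        finally show ?thesis
          using elim(3) False top by (auto simp: Cy)
      qed
    qed
    then have AE: "AE \<omega> in M. \<omega> \<in> space M - (?V (ennreal y) - ?V \<top>) \<longleftrightarrow> \<omega> \<in> {\<omega>\<in>space M. R \<omega> < y}" .
    have m: "space M - (?V (ennreal y) - ?V \<top>) \<in> sets M" using V by blast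
    have m2: "{\<omega>\<in>space M. R \<omega> < y} \<in> sets M"
      by (rule sets_AE_cong(1)[OF m _ AE]) auto
    have "prob {\<omega>\<in>space M. R \<omega> < y} = prob (space M - (?V (ennreal y) - ?V \<top>))"
      using AE m m2 by (intro finite_measure_eq_AE) (auto elim: eventually_mono)
    also have "\<dots> = 1 - prob (?V (ennreal y) - ?V \<top>)"
      using V by (intro prob_compl) blast
    also have "prob (?V (ennreal y) - ?V \<top>) = prob (?V (ennreal y)) - prob (?V \<top>)"
      using V VV by (intro finite_measure_Diff)
    \<comment> \<open>With p the mass of \<open>{..<y}\<close>, the result is
      \<open>1 - ((1 + \<sigma> - p) - \<sigma>)\<close>, that is, p.\<close>
    also have "prob (?V (ennreal y)) = 1 + B.\<sigma> - B.prob {..<y}"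
      using \<open>0 < y\<close> prob_no_crossing_below[of "ennreal y"] by auto
    also have "prob (?V \<top>) = B.\<sigma>"
      using prob_no_crossing_below[of \<top>] by simp
    finally show ?thesis using m2 by simp
  next
    case False
    have AE: "AE \<omega> in M. \<omega> \<in> {} \<longleftrightarrow> \<omega> \<in> {\<omega>\<in>space M. R \<omega> < y}"
      using R by eventually_elim (use False in \<open>auto split: if_splits\<close>)
    have m2: "{\<omega>\<in>space M. R \<omega> < y} \<in> sets M"
      by (rule sets_AE_cong(1)[OF sets.empty_sets _ AE]) auto
    have "prob {\<omega>\<in>space M. R \<omega> < y} = prob {}"
      using AE m2 by (intro finite_measure_eq_AE) (auto elim: eventually_mono)
    then show ?thesis using m2 False B.prob_lessThan_nonpos[of y] by simp
  qed
  have R_meas [measurable]: "R \<in> borel_measurable M"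
    unfolding borel_measurable_iff_less using main by blast
  have "distr M borel R = \<mu>"
  proof (rule measure_eqI_Iio)
    have "emeasure (distr M borel R) {..<y} = emeasure \<mu> {..<y}" for y
    proof -
      have "emeasure (distr M borel R) {..<y} = emeasure M (R -` {..<y} \<inter> space M)"
        by (rule emeasure_distr) auto
      also have "R -` {..<y} \<inter> space M = {\<omega>\<in>space M. R \<omega> < y}" by auto
      finally show ?thesis using main by (simp add: emeasure_eq_measure B.emeasure_eq_measure)
    qed
    then show "emeasure (distr M borel R) {..<y} = emeasure \<mu> {..<y}" "emeasure (distr M borel R) {..<y} < \<infinity>" for y
      by (auto simp: B.emeasure_eq_measure)
  qed auto
  then show ?thesis by (simp add: has_law_def)
qed

abbreviation T :: "'a \<Rightarrow> ennreal" where "T \<equiv> boundary_time FX L B.\<phi>"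

text \<open>The void probability of the set of all crossings is \<sigma>.\<close>

lemma crossings_nonempty:
  assumes "B.\<sigma> = 0" shows "AE \<omega> in M. points (crossing_set (\<lambda>_. True)) \<omega> \<noteq> {}"
proof -
  let ?V = "{\<omega>\<in>space M. points (crossing_set (\<lambda>l. B.\<phi> l < \<top>)) \<omega> = {}}"
  have V: "?V \<in> sets M"
    by (rule points_empty_measurable, rule crossing_set_measurable) measurable
  have "prob ?V = 0"
    using prob_no_crossing_below[of \<top>] assms by simp
  then have "AE \<omega> in M. \<omega> \<notin> ?V"
    using V by (intro AE_not_in) (auto simp: null_sets_def emeasure_eq_measure)
  with AE_space show ?thesis
    by eventually_elim (auto simp: points_def crossing_set_def)
qed

lemma AE_boundary_time:
  "AE \<omega> in M. good_boundary X z L U F \<omega> B.\<phi> \<and>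
     points (crossing_set (\<lambda>_. True)) \<omega> = good_boundary.crossings X z L F \<omega> B.\<phi>"
  using AE_good_boundary
proof eventually_elim
  case (elim \<omega>)
  interpret P: good_boundary X z L U F \<omega> B.\<phi> by fact
  show ?case
    using elim unfolding points_crossing_set[OF P.good_path_axioms] P.crossings_def by simp
qed

lemma boundary_time_law:
  assumes "B.\<sigma> = 0"
  shows "AE \<omega> in M. T \<omega> < \<top>" "has_law M (at_time FX T) \<mu>"
    "AE \<omega> in M. (SUP t\<in>{t. 0 \<le> t \<and> ennreal t \<le> T \<omega>}. ennreal (FX t \<omega>)) = ennreal (at_time FX T \<omega>)"
proof -
  show "AE \<omega> in M. T \<omega> < \<top>"
    using AE_boundary_time crossings_nonempty[OF assms]
  proof eventually_elim
    case (elim \<omega>)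
    then interpret P: good_boundary X z L U F \<omega> B.\<phi> by simp
    have "P.crossings \<noteq> {}" using elim by simp
    then obtain t where "T \<omega> = ennreal t" by (rule P.boundary_time_crossing)
    then show ?case by simp
  qed
  show "AE \<omega> in M. (SUP t\<in>{t. 0 \<le> t \<and> ennreal t \<le> T \<omega>}. ennreal (FX t \<omega>)) = ennreal (at_time FX T \<omega>)"
    using AE_boundary_time crossings_nonempty[OF assms]
  proof eventually_elim
    case (elim \<omega>)
    then interpret P: good_boundary X z L U F \<omega> B.\<phi> by simp
    show ?case using elim by (intro P.SUP_before_boundary_time) simp
  qed
  show "has_law M (at_time FX T) \<mu>"
  proof (rule has_law_boundary)
    show "AE \<omega> in M. if points (crossing_set (\<lambda>_. True)) \<omega> = {} then at_time FX T \<omega> = 0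
      else 0 \<le> at_time FX T \<omega> \<and> ennreal (at_time FX T \<omega>) = B.\<phi> (Inf (points (crossing_set (\<lambda>_. True)) \<omega>))"
      using AE_boundary_time crossings_nonempty[OF assms]
    proof eventually_elim
      case (elim \<omega>)
      then interpret P: good_boundary X z L U F \<omega> B.\<phi> by simp
      have ne: "P.crossings \<noteq> {}" using elim by simp
      obtain t where t: "0 < t" "T \<omega> = ennreal t" "ennreal (FX t \<omega>) = B.\<phi> P.first_level"
        using P.boundary_time_crossing[OF ne] by metis
      show ?case
        using elim ne t P.Y_nonneg[of t] by (simp add: at_time_def P.first_level_def)
    qed
  qed
qed

text \<open>Before \<open>T\<close> the process stays strictly below its value at \<open>T\<close>, so stopping earlier with the same
  law is impossible.\<close>

lemma boundary_time_minimal: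
  assumes "B.\<sigma> = 0"
  shows "minimal_stopping_time M \<G> FX T"
  unfolding minimal_stopping_time_def
proof (intro allI impI)
  fix S assume S: "AE \<omega> in M. S \<omega> \<le> T \<omega>" "has_law M (at_time FX S) (distr M borel (at_time FX T))"
  have less: "AE \<omega> in M. S \<omega> = T \<omega> \<or> at_time FX S \<omega> < at_time FX T \<omega>"
    using AE_boundary_time crossings_nonempty[OF assms] S(1)
  proof eventually_elim
    case (elim \<omega>)
    then interpret P: good_boundary X z L U F \<omega> B.\<phi> by simp
    have ne: "P.crossings \<noteq> {}" using elim by simp
    obtain t where t: "0 < t" "T \<omega> = ennreal t" "ennreal (FX t \<omega>) = B.\<phi> P.first_level"
        "\<And>s. 0 \<le> s \<Longrightarrow> s < t \<Longrightarrow> ennreal (FX s \<omega>) < B.\<phi> P.first_level"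
      using P.boundary_time_crossing[OF ne] by metis
    have "S \<omega> \<le> ennreal t" using elim t by simp
    then obtain s where s: "S \<omega> = ennreal s" "0 \<le> s" by (cases "S \<omega>") (auto simp: top_unique)
    show ?case
    proof (cases "s < t")
      case True
      then have "ennreal (FX s \<omega>) < ennreal (FX t \<omega>)" using t s by simp
      then have "FX s \<omega> < FX t \<omega>" using P.Y_nonneg[of s] s by (simp add: ennreal_less_iff)
      then show ?thesis using s t by (simp add: at_time_def)
    next
      case False
      then have "s = t" using s t \<open>S \<omega> \<le> ennreal t\<close> by simp
      then show ?thesis using s t by simp
    qed
  qed
  have "AE \<omega> in M. at_time FX S \<omega> = at_time FX T \<omega>"
  proof (rule AE_eq_of_le_same_distr)
    show "AE \<omega> in M. at_time FX S \<omega> \<le> at_time FX T \<omega>"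
      using less by eventually_elim (auto simp: at_time_def)
    show "at_time FX T \<in> borel_measurable M"
      using boundary_time_law(2)[OF assms] by (simp add: has_law_def)
  qed (use S(2) in \<open>auto simp: has_law_def\<close>)
  with less show "AE \<omega> in M. S \<omega> = T \<omega>"
    by eventually_elim auto
qed

lemma local_time_level_eq:
  assumes "good_path X z L U F \<omega>" "0 \<le> c"
  shows "local_time_level L (ennreal c) \<omega> = ennreal (good_path.start L \<omega> c)"
proof -
  interpret P: good_path X z L U F \<omega> by fact
  show ?thesis
    unfolding local_time_level_def
  proof (rule antisym)
    show "first_time (\<lambda>t. ennreal (L t \<omega>) = ennreal c) \<le> ennreal (P.start c)"
      using P.start_nonneg P.L_start[OF assms(2)] by (intro first_time_le) auto
    show "ennreal (P.start c) \<le> first_time (\<lambda>t. ennreal (L t \<omega>) = ennreal c)"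
      unfolding le_first_time_iff using P.start_le_iff[OF _ assms(2)] P.L_nonneg assms(2)
      by (auto intro!: ennreal_leI)
  qed
qed

text \<open>Without a crossing the time is the start of the local time level c, where the process
  vanishes; this recovers the mass at 0. A crossing happens at a finite boundary value, hence at a
  local time below c, and the cap has no effect.\<close>

lemma capped_boundary_time_law:
  assumes fin: "emeasure B.D UNIV < \<top>"
  defines "T' \<equiv> \<lambda>\<omega>. min (T \<omega>) (local_time_level L (emeasure B.D UNIV) \<omega>)"
  shows "AE \<omega> in M. T' \<omega> < \<top>" "has_law M (at_time FX T') \<mu>"
proof -
  obtain c where c: "0 \<le> c" "emeasure B.D UNIV = ennreal c"
    using fin by (cases "emeasure B.D UNIV") auto
  have *: "AE \<omega> in M. T' \<omega> < \<top> \<and> (if points (crossing_set (\<lambda>_. True)) \<omega> = {} then at_time FX T' \<omega> = 0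
      else 0 \<le> at_time FX T' \<omega> \<and> ennreal (at_time FX T' \<omega>) = B.\<phi> (Inf (points (crossing_set (\<lambda>_. True)) \<omega>)))"
    using AE_boundary_time
  proof eventually_elim
    case (elim \<omega>)
    then interpret P: good_boundary X z L U F \<omega> B.\<phi> by simp
    have lev: "local_time_level L (emeasure B.D UNIV) \<omega> = ennreal (P.start c)"
      unfolding c by (rule local_time_level_eq[OF P.good_path_axioms c(1)])
    show ?case
    proof (cases "P.crossings = {}")
      case True
      then have "T' \<omega> = ennreal (P.start c)"
        unfolding T'_def lev using P.boundary_time_top by simp
      moreover have "FX (P.start c) \<omega> = 0"
        using P.Y_zero[of "P.start c"] P.L_start[OF c(1)] P.start_nonneg[of c] by simp
      ultimately show ?thesis
        using True elim P.start_nonneg[of c] by (simp add: at_time_def)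
    next
      case False
      obtain t where t: "0 < t" "T \<omega> = ennreal t" "L t \<omega> = P.first_level" "ennreal (FX t \<omega>) = B.\<phi> P.first_level"
        using P.boundary_time_crossing[OF False] by metis
      have fl: "0 \<le> P.first_level" using P.first_level(1)[OF False] by (simp add: P.crossings_def)
      have "B.\<phi> P.first_level \<noteq> \<top>" using t(4) by (metis ennreal_neq_top)
      then have "\<not> emeasure B.D UNIV \<le> ennreal P.first_level"
        using B.phi_top_iff[OF fl] by simp
      then have "P.first_level < c" using c fl by (simp add: ennreal_less_iff not_le)
      then have "\<not> P.start c \<le> t" using P.start_le_iff[of t c] t c by simp
      then have "T' \<omega> = ennreal t"
        unfolding T'_def lev t using t(1) by (simp add: min_def)
      then show ?thesis
        using elim False t P.Y_nonneg[of t] by (simp add: at_time_def P.first_level_def)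
    qed
  qed
  then show "AE \<omega> in M. T' \<omega> < \<top>" by eventually_elim simp
  show "has_law M (at_time FX T') \<mu>"
    by (rule has_law_boundary) (use * in \<open>eventually_elim, simp\<close>)
qed

end

section \<open>Stopping times\<close>

context markov_process begin

interpretation filtration "space M" "usual_filtration M X"
  by (rule filtration_usual_filtration)

lemma space_usual [simp]: "space (usual_filtration M X t) = space M"
  by (rule space_F)

lemma usual_mono: "s \<le> t \<Longrightarrow> sets (usual_filtration M X s) \<subseteq> sets (usual_filtration M X t)"
  by (rule sets_F_mono)

lemma pre_filtration_generators:
  "{X r -` B \<inter> space M | r B. 0 \<le> r \<and> ennreal r \<le> s \<and> B \<in> sets borel} \<union> null_sets M \<subseteq> sets M"
  using X_measurable by (auto intro: measurable_sets)

lemma pre_filtration_subset: "pre_filtration M X s \<subseteq> sets M"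
  unfolding pre_filtration_def by (rule sets.sigma_sets_subset[OF pre_filtration_generators])

lemma sigma_algebra_pre_filtration: "sigma_algebra (space M) (pre_filtration M X s)"
  unfolding pre_filtration_def
  using pre_filtration_generators[of s] sets.space_closed[of M]
  by (intro sigma_algebra_sigma_sets) blast

text \<open>An intersection of \<sigma>-algebras is already a \<sigma>-algebra, so generating adds
  nothing.\<close>

lemma sets_usual: "sets (usual_filtration M X t) = (\<Inter>s\<in>{s. t < s \<or> s = \<top>}. pre_filtration M X s)"
proof -
  let ?I = "\<Inter>s\<in>{s. t < s \<or> s = \<top>}. pre_filtration M X s"
  have "?I \<subseteq> pre_filtration M X \<top>" by blast
  then have "?I \<subseteq> Pow (space M)"
    using pre_filtration_subset[of \<top>] sets.space_closed[of M] by blast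
  then have "sets (usual_filtration M X t) = sigma_sets (space M) ?I"
    unfolding usual_filtration_def by (rule sets_measure_of)
  also have "\<dots> = ?I"
  proof
    show "sigma_sets (space M) ?I \<subseteq> ?I"
    proof (rule INT_greatest)
      fix s assume "s \<in> {s. t < s \<or> s = \<top>}"
      then show "sigma_sets (space M) ?I \<subseteq> pre_filtration M X s"
        by (intro sigma_algebra.sigma_sets_subset[OF sigma_algebra_pre_filtration] INT_lower)
    qed
  qed (auto intro: sigma_sets.Basic)
  finally show ?thesis .
qed

lemma sets_usual_subset: "sets (usual_filtration M X t) \<subseteq> sets M"
  unfolding sets_usual using pre_filtration_subset by blast

lemma null_sets_usual: "null_sets M \<subseteq> sets (usual_filtration M X t)"
  unfolding sets_usual pre_filtration_def by (auto intro: sigma_sets.Basic)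

lemma usual_right_continuous:
  assumes "t < \<top>" "\<And>u. t < u \<Longrightarrow> u < \<top> \<Longrightarrow> A \<in> sets (usual_filtration M X u)"
  shows "A \<in> sets (usual_filtration M X t)"
  unfolding sets_usual
proof
  fix s assume "s \<in> {s. t < s \<or> s = \<top>}"
  then have "t < s" using assms(1) by auto
  then obtain u where u: "t < u" "u < s" using dense by blast
  then have "A \<in> sets (usual_filtration M X u)"
    using assms(2)[of u] less_top[of u] by auto
  then show "A \<in> pre_filtration M X s"
    using u unfolding sets_usual by blast
qed

text \<open>All null sets belong to the filtration at every time, so statements proved on good paths
  only still give adapted events.\<close>

lemma sets_usual_AE_cong:
  assumes A: "A \<in> sets (usual_filtration M X t)" and B: "B \<subseteq> space M"
    and AE: "AE \<omega> in M. \<omega> \<in> A \<longleftrightarrow> \<omega> \<in> B"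
  shows "B \<in> sets (usual_filtration M X t)"
proof -
  have "A \<in> sets M" using A sets_usual_subset by blast
  note N = sets_AE_cong[OF this B AE]
  have 1: "A - B \<in> sets (usual_filtration M X t)" and 2: "B - A \<in> sets (usual_filtration M X t)"
    using N(2,3) null_sets_usual[of t] by blast+
  have "(A - (A - B)) \<union> (B - A) \<in> sets (usual_filtration M X t)"
    by (rule sets.Un[OF sets.Diff[OF A 1] 2])
  moreover have "(A - (A - B)) \<union> (B - A) = B" by auto
  ultimately show ?thesis by simp
qed

lemma measurable_usual_mono:
  "f \<in> usual_filtration M X s \<rightarrow>\<^sub>M N \<Longrightarrow> s \<le> t \<Longrightarrow> f \<in> usual_filtration M X t \<rightarrow>\<^sub>M N"
  using usual_mono[of s t] by (auto simp: measurable_def)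

lemma X_adapted:
  assumes "0 \<le> r" "ennreal r \<le> t" shows "X r \<in> borel_measurable (usual_filtration M X t)"
proof (rule measurableI)
  fix B :: "'e set" assume "B \<in> sets borel"
  then have "X r -` B \<inter> space M \<in> pre_filtration M X s" if "t < s \<or> s = \<top>" for s
    unfolding pre_filtration_def
    using assms that by (intro sigma_sets.Basic UnI1 CollectI exI[of _ r] exI[of _ B]) (auto intro: order_trans less_imp_le)
  then show "X r -` B \<inter> space (usual_filtration M X t) \<in> sets (usual_filtration M X t)"
    by (auto simp: sets_usual)
qed simp

text \<open>Adaptedness alone handles deterministic times; a random time up to t is approximated
  from the right by times with countably many values, and right-continuity of the paths passes to
  the limit.\<close>

lemma X_progressive:
  assumes \<sigma> [measurable]: "\<sigma> \<in> borel_measurable (usual_filtration M X (ennreal t))"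
    and bounds: "\<And>\<omega>. \<omega> \<in> space M \<Longrightarrow> 0 \<le> \<sigma> \<omega> \<and> \<sigma> \<omega> \<le> t" and t: "0 \<le> t"
  shows "(\<lambda>\<omega>. X (\<sigma> \<omega>) \<omega>) \<in> borel_measurable (usual_filtration M X (ennreal t))"
proof (rule borel_measurable_LIMSEQ_metric)
  \<comment> \<open>The next point to the right on the grid of mesh \<open>1 / (k + 1)\<close>,
    capped at t so that X there is known at time t.\<close>
  let ?s = "\<lambda>k \<omega>. min t ((real (nat \<lfloor>\<sigma> \<omega> * real (Suc k)\<rfloor>) + 1) / real (Suc k))"
  show "(\<lambda>\<omega>. X (?s k \<omega>) \<omega>) \<in> borel_measurable (usual_filtration M X (ennreal t))" for k
  proof (rule measurable_compose_countable[where g="\<lambda>\<omega>. nat \<lfloor>\<sigma> \<omega> * real (Suc k)\<rfloor>" and f="\<lambda>i \<omega>. X (min t ((real i + 1) / real (Suc k))) \<omega>"])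
    show "X (min t ((real i + 1) / real (Suc k))) \<in> borel_measurable (usual_filtration M X (ennreal t))" for i
      using t by (intro X_adapted) (auto intro!: ennreal_leI)
    show "(\<lambda>\<omega>. nat \<lfloor>\<sigma> \<omega> * real (Suc k)\<rfloor>) \<in> usual_filtration M X (ennreal t) \<rightarrow>\<^sub>M count_space UNIV"
      by measurable
  qed
  fix \<omega> assume "\<omega> \<in> space (usual_filtration M X (ennreal t))"
  then have \<omega>: "\<omega> \<in> space M" by simp
  note b = bounds[OF \<omega>]
  have fl: "\<sigma> \<omega> * real (Suc k) \<le> real (nat \<lfloor>\<sigma> \<omega> * real (Suc k)\<rfloor>) + 1"
    "real (nat \<lfloor>\<sigma> \<omega> * real (Suc k)\<rfloor>) \<le> \<sigma> \<omega> * real (Suc k)" for k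
    using b by (auto simp del: of_nat_Suc)
  have low: "\<sigma> \<omega> \<le> (real (nat \<lfloor>\<sigma> \<omega> * real (Suc k)\<rfloor>) + 1) / real (Suc k)" for k
    using fl(1)[of k] by (simp add: pos_le_divide_eq del: of_nat_Suc)
  have up: "?s k \<omega> \<le> \<sigma> \<omega> + 1 / real (Suc k)" for k
  proof -
    have "(real (nat \<lfloor>\<sigma> \<omega> * real (Suc k)\<rfloor>) + 1) / real (Suc k) \<le> (\<sigma> \<omega> * real (Suc k) + 1) / real (Suc k)"
      using fl(2)[of k] by (intro divide_right_mono) auto
    also have "\<dots> = \<sigma> \<omega> + 1 / real (Suc k)" by (simp add: add_divide_distrib del: of_nat_Suc)
    finally show ?thesis by simp
  qed
  have low': "\<sigma> \<omega> \<le> ?s k \<omega>" for k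
    using low[of k] b by (simp del: of_nat_Suc)
  have "(\<lambda>k. 1 / real (Suc k)) \<longlonglongrightarrow> 0"
    by (rule LIMSEQ_Suc[OF lim_1_over_n])
  then have "(\<lambda>k. \<sigma> \<omega> + 1 / real (Suc k)) \<longlonglongrightarrow> \<sigma> \<omega> + 0"
    by (intro tendsto_add tendsto_const)
  then have upper: "(\<lambda>k. \<sigma> \<omega> + 1 / real (Suc k)) \<longlonglongrightarrow> \<sigma> \<omega>"
    unfolding add_0_right .
  have lim: "(\<lambda>k. ?s k \<omega>) \<longlonglongrightarrow> \<sigma> \<omega>"
    by (rule tendsto_sandwich[OF _ _ tendsto_const upper]) (intro always_eventually allI low' up)+
  have cont: "continuous (at (\<sigma> \<omega>) within {\<sigma> \<omega>..}) (\<lambda>s. X s \<omega>)"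
    using X_right_continuous[OF \<omega>, of "\<sigma> \<omega>"] b by (simp add: at_within_Ici_at_right)
  have "((\<lambda>s. X s \<omega>) \<circ> (\<lambda>k. ?s k \<omega>)) \<longlonglongrightarrow> X (\<sigma> \<omega>) \<omega>"
    by (rule cont[unfolded continuous_within_sequentially, THEN spec, THEN mp])
      (intro conjI allI lim, simp only: atLeast_iff low')
  then show "(\<lambda>k. X (?s k \<omega>) \<omega>) \<longlonglongrightarrow> X (\<sigma> \<omega>) \<omega>" by (simp add: o_def)
qed

text \<open>By right-continuity of the filtration it suffices to decide \<open>T < t\<close> at time \<open>t\<close>.\<close>

lemma stopping_time_usualI:
  assumes "\<And>x. 0 < x \<Longrightarrow> {\<omega>\<in>space M. T \<omega> < ennreal x} \<in> sets (usual_filtration M X (ennreal x))"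
  shows "stopping_time (usual_filtration M X) T"
proof (rule stopping_timeI)
  fix t :: ennreal
  show "Measurable.pred (usual_filtration M X t) (\<lambda>\<omega>. T \<omega> \<le> t)"
  proof (cases "t = \<top>")
    case True
    then show ?thesis by simp
  next
    case False
    then obtain x where x: "t = ennreal x" "0 \<le> x" by (cases t) auto
    have "{\<omega>\<in>space M. T \<omega> \<le> t} \<in> sets (usual_filtration M X t)"
    proof (rule usual_right_continuous)
      show "t < \<top>" using x by simp
      fix u assume u: "t < u" "u < \<top>"
      then obtain y where y: "u = ennreal y" "0 \<le> y" by (cases u) auto
      have xy: "x < y" using u x y by (simp add: ennreal_less_iff)
      have eq: "T \<omega> \<le> t \<longleftrightarrow> (\<forall>r\<in>\<rat> \<inter> {x<..<y}. T \<omega> < ennreal r)" for \<omega>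
      proof
        assume "T \<omega> \<le> t"
        then show "\<forall>r\<in>\<rat> \<inter> {x<..<y}. T \<omega> < ennreal r"
          using x by (auto intro!: le_less_trans[of "T \<omega>" "ennreal x"] simp: ennreal_less_iff)
      next
        assume *: "\<forall>r\<in>\<rat> \<inter> {x<..<y}. T \<omega> < ennreal r"
        show "T \<omega> \<le> t"
        proof (rule ccontr)
          assume "\<not> T \<omega> \<le> t"
          then have "ennreal x < min (T \<omega>) (ennreal y)" using x xy by (simp add: ennreal_less_iff)
          then obtain v where v: "ennreal x < v" "v < min (T \<omega>) (ennreal y)" using dense by blast
          then obtain w where w: "v = ennreal w" "0 \<le> w" by (cases v) auto
          have "x < w" using v w x by (simp add: ennreal_less_iff)
          then obtain r where r: "r \<in> \<rat>" "x < r" "r < w" using Rats_dense_in_real by blast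
          have "w < y" using v w y by (simp add: ennreal_less_iff)
          then have "T \<omega> < ennreal r" using * r by auto
          moreover have "ennreal r \<le> v" using r w by (auto intro: ennreal_leI)
          moreover have "v < T \<omega>" using v by simp
          ultimately show False by order
        qed
      qed
      have "{\<omega>\<in>space M. T \<omega> < ennreal r} \<in> sets (usual_filtration M X u)" if "r \<in> \<rat> \<inter> {x<..<y}" for r
        using assms[of r] usual_mono[of "ennreal r" u] that x y by (auto simp: ennreal_leI)
      moreover have "countable (\<rat> \<inter> {x<..<y})" using countable_rat by blast
      ultimately have "(\<Union>r\<in>\<rat> \<inter> {x<..<y}. space M - {\<omega>\<in>space M. T \<omega> < ennreal r}) \<in> sets (usual_filtration M X u)"
        using sets.top[of "usual_filtration M X u"] by (intro sets.countable_UN' sets.Diff) auto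
      then have "space M - (\<Union>r\<in>\<rat> \<inter> {x<..<y}. space M - {\<omega>\<in>space M. T \<omega> < ennreal r}) \<in> sets (usual_filtration M X u)"
        using sets.compl_sets[of _ "usual_filtration M X u"] by simp
      also have "space M - (\<Union>r\<in>\<rat> \<inter> {x<..<y}. space M - {\<omega>\<in>space M. T \<omega> < ennreal r}) = {\<omega>\<in>space M. T \<omega> \<le> t}"
        unfolding eq by auto
      finally show "{\<omega>\<in>space M. T \<omega> \<le> t} \<in> sets (usual_filtration M X u)" .
    qed
    then show ?thesis by (simp add: pred_def)
  qed
qed

end

section \<open>Adaptedness of the induced process and the stopping times\<close>

context embedding_setting begin

text \<open>The start of the excursion straddling \<open>t\<close> is a function of the local time up to \<open>t\<close> only, hence
  known at time \<open>t\<close>; no hitting time of the zero set is needed.\<close>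

lemma FX_adapted:
  assumes t: "0 \<le> t"
  shows "FX t \<in> borel_measurable (usual_filtration M X (ennreal t))"
proof -
  let ?\<G> = "usual_filtration M X (ennreal t)"
  obtain N where N: "N \<in> null_sets M" "\<And>\<omega>. \<omega> \<in> space M - N \<Longrightarrow> good_path X z L U F \<omega>"
    using AE_good_path by (auto elim!: AE_E3)
  define G0 where "G0 = space M - N"
  have G0: "G0 \<in> sets ?\<G>"
    using N(1) null_sets_usual[of "ennreal t"] sets.compl_sets[of N ?\<G>] by (auto simp: G0_def)
  have good: "good_path X z L U F \<omega>" if "\<omega> \<in> G0" for \<omega> using that N by (simp add: G0_def)
  have L_meas: "L s \<in> borel_measurable ?\<G>" if "0 \<le> s" "s \<le> t" for s
    by (rule measurable_usual_mono[OF L_adapted[OF that(1)]]) (use that in \<open>simp add: ennreal_leI\<close>)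
  have Lt [measurable]: "L t \<in> borel_measurable ?\<G>" using L_meas t by simp
  define g where "g \<omega> = enn2real (inverse_local_time_left L (L t \<omega>) \<omega>)" for \<omega>
  have g_start: "g \<omega> = good_path.start L \<omega> (L t \<omega>)" if "good_path X z L U F \<omega>" for \<omega>
  proof -
    interpret P: good_path X z L U F \<omega> by fact
    show ?thesis by (simp add: g_def P.start_def)
  qed
  have g_nonneg: "0 \<le> g \<omega>" for \<omega> by (simp add: g_def)
  have g_meas [measurable]: "g \<in> borel_measurable ?\<G>"
    unfolding borel_measurable_iff_le
  proof
    fix r
    \<comment> \<open>The excursion straddling t starts by time r exactly when the local time at r
      has reached its value at t; from t on this always holds.\<close>
    define A where "A = (if r < 0 then {} else if r < t then {\<omega>\<in>space M. L t \<omega> \<le> L r \<omega>} else space M)"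
    have A1: "A \<in> sets ?\<G>"
    proof -
      have "{\<omega>\<in>space ?\<G>. L t \<omega> \<le> L r \<omega>} \<in> sets ?\<G>" if "0 \<le> r" "r < t"
      proof -
        have [measurable]: "L r \<in> borel_measurable ?\<G>" using L_meas that by simp
        show ?thesis by measurable
      qed
      moreover have "space M \<in> sets ?\<G>" using sets.top[of ?\<G>] by simp
      ultimately show ?thesis by (auto simp: A_def)
    qed
    have A2: "AE \<omega> in M. \<omega> \<in> A \<longleftrightarrow> \<omega> \<in> {\<omega>\<in>space M. g \<omega> \<le> r}"
      using AE_good_path AE_space
    proof eventually_elim
      case (elim \<omega>)
      then interpret P: good_path X z L U F \<omega> by simp
      note le = P.start_le_iff[OF _ P.L_nonneg[OF t]]
      show ?case
        using elim(2) g_start[OF elim(1)] g_nonneg[of \<omega>] le[of r] le[of t] t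
        by (auto simp: A_def)
    qed
    have "{\<omega>\<in>space M. g \<omega> \<le> r} \<in> sets ?\<G>"
      by (rule sets_usual_AE_cong[OF A1 _ A2]) auto
    then show "{\<omega>\<in>space ?\<G>. g \<omega> \<le> r} \<in> sets ?\<G>" by simp
  qed
  have X_meas: "(\<lambda>\<omega>. X (min t (g \<omega> + s)) \<omega>) \<in> borel_measurable ?\<G>" if "0 \<le> s" for s
    using that g_nonneg t by (intro X_progressive) auto
  have Xt [measurable]: "X t \<in> borel_measurable ?\<G>" by (rule X_adapted[OF t]) simp
  \<comment> \<open>Good paths that are inside an excursion at time t, of age at least r.\<close>
  define W where "W r = {\<omega>\<in>G0. X t \<omega> \<noteq> z \<and> g \<omega> < t \<and> g \<omega> + r \<le> t}" for r
  have W: "W r \<in> sets ?\<G>" for r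
  proof -
    have "{\<omega>\<in>space ?\<G>. X t \<omega> \<noteq> z \<and> g \<omega> < t \<and> g \<omega> + r \<le> t} \<in> sets ?\<G>" by measurable
    then have "G0 \<inter> {\<omega>\<in>space ?\<G>. X t \<omega> \<noteq> z \<and> g \<omega> < t \<and> g \<omega> + r \<le> t} \<in> sets ?\<G>"
      using G0 by blast
    moreover have "G0 \<inter> {\<omega>\<in>space ?\<G>. X t \<omega> \<noteq> z \<and> g \<omega> < t \<and> g \<omega> + r \<le> t} = W r"
      by (auto simp: W_def G0_def)
    ultimately show ?thesis by simp
  qed
  define E where "E \<omega> = the (excursion_process X z L (L t \<omega>) \<omega>)" for \<omega>
  have E: "E \<omega> \<in> U" "t - g \<omega> < lifetime z (E \<omega>)" "FX t \<omega> = F (E \<omega>) (t - g \<omega>)"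
      "0 \<le> s \<Longrightarrow> s \<le> t - g \<omega> \<Longrightarrow> E \<omega> s = X (g \<omega> + s) \<omega>"
    if "\<omega> \<in> W r" for \<omega> r s
  proof -
    have gp: "good_path X z L U F \<omega>" using that good by (simp add: W_def)
    interpret P: good_path X z L U F \<omega> by fact
    note gs = g_start[OF gp]
    have ne: "P.start (L t \<omega>) \<noteq> t" "X t \<omega> \<noteq> z" using that gs by (auto simp: W_def)
    obtain \<epsilon> where \<epsilon>: "\<epsilon> \<in> U" "excursion_process X z L (L t \<omega>) \<omega> = Some \<epsilon>" "t < P.start (L t \<omega>) + lifetime z \<epsilon>"
        "FX t \<omega> = F \<epsilon> (t - P.start (L t \<omega>))"
      using P.Y_nonzero[OF t ne] by metis
    have E: "E \<omega> = \<epsilon>" using \<epsilon> by (simp add: E_def)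
    show "E \<omega> \<in> U" "t - g \<omega> < lifetime z (E \<omega>)" "FX t \<omega> = F (E \<omega>) (t - g \<omega>)"
      using \<epsilon> gs E by auto
    assume s: "0 \<le> s" "s \<le> t - g \<omega>"
    have "t \<le> P.stop (L t \<omega>)" using P.le_stop_iff[OF t P.L_nonneg[OF t]] by simp
    then show "E \<omega> s = X (g \<omega> + s) \<omega>"
      using P.excursion_Some(3)[OF P.L_nonneg[OF t] \<epsilon>(2) s(1)] s gs E by simp
  qed
  have FE: "{\<omega>\<in>W r. x < F (E \<omega>) r} \<in> sets ?\<G>" if r: "0 \<le> r" for r x
  proof -
    let ?R = "restrict_space ?\<G> (W r)"
    have sp: "space ?R = W r"
      using sets.sets_into_space[OF W[of r]] by (auto simp: space_restrict_space)
    have "(\<lambda>\<omega>. \<lambda>s\<in>{0..r}. X (min t (g \<omega> + s)) \<omega>) \<in> ?R \<rightarrow>\<^sub>M PiM {0..r} (\<lambda>_. borel)"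
      using X_meas by (intro measurable_restrict measurable_restrict_space1) auto
    moreover have "restrict (E \<omega>) {0..r} = (\<lambda>s\<in>{0..r}. X (min t (g \<omega> + s)) \<omega>)" if "\<omega> \<in> space ?R" for \<omega>
    proof (rule restrict_ext)
      fix s assume s: "s \<in> {0..r}"
      have \<omega>: "\<omega> \<in> W r" using that sp by simp
      then have "s \<le> t - g \<omega>" using s by (simp add: W_def)
      then show "E \<omega> s = X (min t (g \<omega> + s)) \<omega>"
        using E(4)[OF \<omega>, of s] s by (simp add: min_absorb2)
    qed
    ultimately have "(\<lambda>\<omega>. restrict (E \<omega>) {0..r}) \<in> ?R \<rightarrow>\<^sub>M PiM {0..r} (\<lambda>_. borel)"
      by (subst measurable_cong)
    \<comment> \<open>Only coordinates up to age r have been used, which is what the nonanticipating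
      measurability of \<open>F\<close> at r asks for.\<close>
    then have "E \<in> ?R \<rightarrow>\<^sub>M vimage_algebra U (\<lambda>\<epsilon>. restrict \<epsilon> {0..r}) (PiM {0..r} (\<lambda>_. borel))"
      using E(1) sp by (intro measurable_vimage_algebra2) auto
    from measurable_compose[OF this F_vimage_measurable[OF r]]
    have "{\<omega>\<in>space ?R. x < F (E \<omega>) r} \<in> sets ?R" by measurable
    then show ?thesis
      using W[of r] sp sets.Int_space_eq2[OF W[of r]] by (subst (asm) sets_restrict_space_iff) auto
  qed
  show ?thesis
    unfolding borel_measurable_iff_greater
  proof
    fix x
    \<comment> \<open>For x at least 0, monotonicity and continuity of \<open>F\<close> in time
      allow the random age of the excursion to be replaced by a rational age r not exceeding it, at
      which x is already exceeded.\<close>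
    define A where "A = (if x < 0 then space M else (\<Union>r\<in>\<rat> \<inter> {0..}. {\<omega>\<in>W r. x < F (E \<omega>) r}))"
    have A1: "A \<in> sets ?\<G>"
    proof -
      have "(\<Union>r\<in>\<rat> \<inter> {0..}. {\<omega>\<in>W r. x < F (E \<omega>) r}) \<in> sets ?\<G>"
        using FE countable_rat by (intro sets.countable_UN') auto
      moreover have "space M \<in> sets ?\<G>" using sets.top[of ?\<G>] by simp
      ultimately show ?thesis by (simp add: A_def)
    qed
    have A2: "AE \<omega> in M. \<omega> \<in> A \<longleftrightarrow> \<omega> \<in> {\<omega>\<in>space M. x < FX t \<omega>}"
      using AE_not_in[OF N(1)] AE_space
    proof eventually_elim
      case (elim \<omega>)
      then have \<omega>: "\<omega> \<in> G0" by (simp add: G0_def)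
      note gp = good[OF \<omega>]
      interpret P: good_path X z L U F \<omega> by fact
      note gs = g_start[OF gp]
      show ?case
      proof (cases "x < 0")
        case True
        then show ?thesis using P.Y_nonneg[OF t] elim by (auto simp: A_def)
      next
        case False
        show ?thesis
        proof
          assume "\<omega> \<in> A"
          then obtain r where r: "0 \<le> r" "\<omega> \<in> W r" "x < F (E \<omega>) r" using False by (auto simp: A_def)
          have "F (E \<omega>) r \<le> F (E \<omega>) (t - g \<omega>)"
            using r mono_onD[OF F_props(1)[OF E(1)[OF r(2)]], of r "t - g \<omega>"] by (auto simp: W_def)
          then show "\<omega> \<in> {\<omega>\<in>space M. x < FX t \<omega>}"
            using r E(3)[OF r(2)] elim by simp
        next
          assume "\<omega> \<in> {\<omega>\<in>space M. x < FX t \<omega>}"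
          then have x: "x < FX t \<omega>" by simp
          then have "g \<omega> \<noteq> t" "X t \<omega> \<noteq> z"
            using False P.Y_zero[OF t] gs by auto
          moreover have "g \<omega> \<le> t" using P.start_le_iff[OF t P.L_nonneg[OF t]] gs by simp
          ultimately have w: "\<omega> \<in> W 0" using \<omega> by (simp add: W_def)
          note E0 = E[OF w]
          have tg: "0 < t - g \<omega>" using w by (simp add: W_def)
          obtain y where y: "x < y" "y < F (E \<omega>) (t - g \<omega>)" using dense x E0(3) by metis
          have "\<exists>s\<ge>0. s \<le> t - g \<omega> \<and> F (E \<omega>) s = y"
            using IVT'[of "F (E \<omega>)" 0 y "t - g \<omega>"] F_props(3)[OF E0(1)] y False tg
              continuous_on_subset[OF F_props(2)[OF E0(1)], of "{0..t - g \<omega>}"] by auto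
          then obtain s where s: "0 \<le> s" "s \<le> t - g \<omega>" "F (E \<omega>) s = y" by auto
          then have "s < t - g \<omega>" using y by (cases "s = t - g \<omega>") auto
          then obtain r where r: "r \<in> \<rat>" "s < r" "r < t - g \<omega>" using Rats_dense_in_real by blast
          have "y \<le> F (E \<omega>) r"
            using mono_onD[OF F_props(1)[OF E0(1)], of s r] s r by simp
          moreover have "\<omega> \<in> W r" using w r by (simp add: W_def)
          ultimately show "\<omega> \<in> A"
            using False r s y by (auto simp: A_def intro!: bexI[of _ r])
        qed
      qed
    qed
    have "{\<omega>\<in>space M. x < FX t \<omega>} \<in> sets ?\<G>"
      by (rule sets_usual_AE_cong[OF A1 _ A2]) auto
    then show "{\<omega>\<in>space ?\<G>. x < FX t \<omega>} \<in> sets ?\<G>" by simp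
  qed
qed

text \<open>By \<open>boundary_time_less_iff\<close> only the adapted values of L and of the process
  at rational times before x enter.\<close>

lemma stopping_time_boundary: "stopping_time (usual_filtration M X) T"
proof (rule stopping_time_usualI)
  fix x :: real assume "0 < x"
  let ?\<G> = "usual_filtration M X (ennreal x)"
  let ?H = "\<lambda>s. {\<omega>\<in>space ?\<G>. B.\<phi> (L s \<omega>) \<le> ennreal (FX s \<omega>)}"
  have "?H s \<in> sets ?\<G>" if s: "0 < s" "s < x" for s
  proof -
    have le: "ennreal s \<le> ennreal x" using s by (simp add: ennreal_leI)
    have [measurable]: "FX s \<in> borel_measurable ?\<G>" "L s \<in> borel_measurable ?\<G>"
      using s measurable_usual_mono[OF FX_adapted le] measurable_usual_mono[OF L_adapted le] by auto
    show ?thesis by measurable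
  qed
  moreover have "countable (\<rat> \<inter> {0<..<x})" using countable_rat by blast
  ultimately have A: "(\<Union>s\<in>\<rat> \<inter> {0<..<x}. ?H s) \<in> sets ?\<G>"
    by (intro sets.countable_UN') auto
  show "{\<omega>\<in>space M. T \<omega> < ennreal x} \<in> sets ?\<G>"
  proof (rule sets_usual_AE_cong[OF A])
    show "AE \<omega> in M. \<omega> \<in> (\<Union>s\<in>\<rat> \<inter> {0<..<x}. ?H s) \<longleftrightarrow> \<omega> \<in> {\<omega>\<in>space M. T \<omega> < ennreal x}"
      using AE_good_boundary AE_space
    proof eventually_elim
      case (elim \<omega>)
      interpret P: good_boundary X z L U F \<omega> B.\<phi> by fact
      show ?case using elim(2) P.boundary_time_less_iff[of x] by auto
    qed
  qed auto
qed

text \<open>L is increasing, so the level is reached strictly before x exactly when L is at least c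
  at some rational time before x.\<close>

lemma stopping_time_local_time_level:
  assumes c: "0 \<le> c" shows "stopping_time (usual_filtration M X) (local_time_level L (ennreal c))"
proof (rule stopping_time_usualI)
  fix x :: real assume "0 < x"
  let ?\<G> = "usual_filtration M X (ennreal x)"
  let ?H = "\<lambda>s. {\<omega>\<in>space ?\<G>. c \<le> L s \<omega>}"
  have "?H s \<in> sets ?\<G>" if s: "0 < s" "s < x" for s
  proof -
    have le: "ennreal s \<le> ennreal x" using s by (simp add: ennreal_leI)
    have [measurable]: "L s \<in> borel_measurable ?\<G>"
      using s measurable_usual_mono[OF L_adapted le] by auto
    show ?thesis by measurable
  qed
  moreover have "countable (\<rat> \<inter> {0<..<x})" using countable_rat by blast
  ultimately have A: "(\<Union>s\<in>\<rat> \<inter> {0<..<x}. ?H s) \<in> sets ?\<G>"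
    by (intro sets.countable_UN') auto
  show "{\<omega>\<in>space M. local_time_level L (ennreal c) \<omega> < ennreal x} \<in> sets ?\<G>"
  proof (rule sets_usual_AE_cong[OF A])
    show "AE \<omega> in M. \<omega> \<in> (\<Union>s\<in>\<rat> \<inter> {0<..<x}. ?H s) \<longleftrightarrow> \<omega> \<in> {\<omega>\<in>space M. local_time_level L (ennreal c) \<omega> < ennreal x}"
      using AE_good_path AE_space
    proof eventually_elim
      case (elim \<omega>)
      interpret P: good_path X z L U F \<omega> by fact
      have "(\<exists>s\<in>\<rat> \<inter> {0<..<x}. c \<le> L s \<omega>) \<longleftrightarrow> P.start c < x"
      proof
        assume "\<exists>s\<in>\<rat> \<inter> {0<..<x}. c \<le> L s \<omega>"
        then obtain s where "0 < s" "s < x" "c \<le> L s \<omega>" by auto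
        then show "P.start c < x" using P.start_le_iff[of s c] c by simp
      next
        assume "P.start c < x"
        then obtain s where s: "s \<in> \<rat>" "P.start c < s" "s < x" using Rats_dense_in_real by blast
        then have "0 < s" using P.start_nonneg[of c] by simp
        then show "\<exists>s\<in>\<rat> \<inter> {0<..<x}. c \<le> L s \<omega>"
          using s P.start_le_iff[of s c] c by (intro bexI[of _ s]) auto
      qed
      then show ?case
        using elim(2) P.start_nonneg[of c]
        by (auto simp: local_time_level_eq[OF elim(1) c] ennreal_less_iff)
    qed
  qed auto
qed

end

theorem theorem4:
  fixes M :: "'a measure" and X :: "real \<Rightarrow> 'a \<Rightarrow> 'e::polish_space" and z :: 'e
    and K :: "'e \<Rightarrow> (real \<Rightarrow> 'e) measure" and L :: "real \<Rightarrow> 'a \<Rightarrow> real"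
    and U :: "(real \<Rightarrow> 'e) set" and n :: "(real \<Rightarrow> 'e) measure"
    and F :: "(real \<Rightarrow> 'e) \<Rightarrow> real \<Rightarrow> real" and Ft :: "real \<Rightarrow> 'a \<Rightarrow> real"
    and n\<^sub>F :: "real measure" and \<F> :: "ennreal \<Rightarrow> 'a measure" and \<mu> :: "real measure"
  assumes setting: "excursion_setting M X z K L U n"
    and functional_F: "excursion_functional M X z L U F"
    and positive_F: "positive_functional U F"
    and \<F>_eq: "\<F> = usual_filtration M X"
    and Ft_eq: "Ft = functional_process F X z L"
    and n\<^sub>F_eq: "n\<^sub>F = characteristic_measure z n F"
    and \<mu>_law: "prob_space \<mu>" "sets \<mu> = sets borel" "emeasure \<mu> {..<0} = 0"
    and tail_pos: "\<And>y. y \<in> measure_support \<mu> \<Longrightarrow> emeasure n\<^sub>F {y..} > 0"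
    and atoms_reached: "\<And>y. measure \<mu> {y} > 0 \<Longrightarrow>
      AE \<epsilon> in n. F \<epsilon> (lifetime z \<epsilon>) = y \<longrightarrow> (\<exists>s. 0 \<le> s \<and> s < lifetime z \<epsilon> \<and> F \<epsilon> s = y)"
  shows
    "(measure \<mu> {0} = 0 \<longrightarrow>
       (let T = boundary_time Ft L (phi n\<^sub>F (extend_law \<mu>)) in
          skorokhod_embeds M \<F> Ft \<mu> T \<and> minimal_stopping_time M \<F> Ft T \<and>
          (AE \<omega> in M. (SUP t\<in>{t. 0 \<le> t \<and> ennreal t \<le> T \<omega>}. ennreal (Ft t \<omega>)) = ennreal (at_time Ft T \<omega>)))) \<and>
     (measure \<mu> {0} > 0 \<and> (\<integral>\<^sup>+y\<in>{0<..}. 1 / emeasure n\<^sub>F {y..} \<partial>\<mu>) < \<top> \<longrightarrow>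
       (let \<mu>' = shift_zero_mass \<mu>; c = psi_infinity n\<^sub>F \<mu>';
            T' = (\<lambda>\<omega>. min (boundary_time Ft L (phi n\<^sub>F \<mu>') \<omega>) (local_time_level L c \<omega>)) in
          c < \<top> \<and> skorokhod_embeds M \<F> Ft \<mu> T'))"
proof -
  interpret excursion_setting M X z K L U n by (rule setting)
  interpret embedding_setting M X z K L U n F \<mu>
    using functional_F positive_F \<mu>_law tail_pos[unfolded n\<^sub>F_eq] atoms_reached
    by (intro embedding_setting.intro embedding_setting_axioms.intro setting)
  note [simp] = \<F>_eq Ft_eq n\<^sub>F_eq
  show ?thesis
  proof (intro conjI impI)
    assume "measure \<mu> {0} = 0"
    then have \<sigma>: "B.\<sigma> = 0" by (simp add: B.\<sigma>_def)
    show "let T = boundary_time Ft L (phi n\<^sub>F (extend_law \<mu>)) in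
          skorokhod_embeds M \<F> Ft \<mu> T \<and> minimal_stopping_time M \<F> Ft T \<and>
          (AE \<omega> in M. (SUP t\<in>{t. 0 \<le> t \<and> ennreal t \<le> T \<omega>}. ennreal (Ft t \<omega>)) = ennreal (at_time Ft T \<omega>))"
      using stopping_time_boundary boundary_time_law[OF \<sigma>] boundary_time_minimal[OF \<sigma>]
      by (simp add: Let_def skorokhod_embeds_def B.extend_law_eq[OF \<sigma>])
  next
    assume *: "measure \<mu> {0} > 0 \<and> (\<integral>\<^sup>+y\<in>{0<..}. 1 / emeasure n\<^sub>F {y..} \<partial>\<mu>) < \<top>"
    then have fin: "emeasure B.D UNIV < \<top>"
      by (intro B.total_finite) (auto simp: B.\<sigma>_def)
    then obtain c where c: "0 \<le> c" "emeasure B.D UNIV = ennreal c"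
      by (cases "emeasure B.D UNIV") auto
    have "stopping_time (usual_filtration M X) (\<lambda>\<omega>. min (T \<omega>) (local_time_level L (emeasure B.D UNIV) \<omega>))"
      unfolding c by (intro stopping_time_min stopping_time_boundary stopping_time_local_time_level c)
    then show "let \<mu>' = shift_zero_mass \<mu>; c = psi_infinity n\<^sub>F \<mu>';
            T' = (\<lambda>\<omega>. min (boundary_time Ft L (phi n\<^sub>F \<mu>') \<omega>) (local_time_level L c \<omega>)) in
          c < \<top> \<and> skorokhod_embeds M \<F> Ft \<mu> T'"
      using fin capped_boundary_time_law[OF fin]
      by (simp add: Let_def skorokhod_embeds_def B.psi_infinity_eq)
  qed
qed

end
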